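(* Let $\delta\in(0,1)$. Suppose $f$ lies in the reproducing kernel Hilbert space of the neural tangent kernel $k_{\mathrm{NN}}$, with $\|f\|_{k_{\mathrm{NN}}}\le B$. Samples of $f$ are observed with i.i.d. zero-mean sub-Gaussian noise with variance proxy $\sigma^2>0$. Then for the constant choice $\beta_t=2\log\big(2T|\mathcal{A}|/\delta\big)$, with probability greater than $1-\delta$, the SupNTK-UCB algorithm run for $T$ rounds satisfies $$R(T)=\mathcal{O}\left(\sqrt{T}\left(\sqrt{\gamma_T\,\sigma^{-2}(\log T)^3\log\big(T\log T\,|\mathcal{A}|/\delta\big)}+\sigma B\right)\right).$$
   Context: Contextual bandit problem: $\mathcal{A}$ is a finite set of actions, represented as one-hot vectors in $\mathbb{R}^{|\mathcal{A}|}$. There is an arbitrary sequence of context matrices $z_t\in\mathbb{R}^{d\times|\mathcal{A}|}$, whose columns lie in the input space $\mathcal{X}\subset\mathbb{S}^{d-1}$ (the unit sphere of $\mathbb{R}^d$). At round $t\le T$ the learner observes $z_t$, picks $a_t\in\mathcal{A}$, sets $x_t=z_ta_t$, and receives $y_t=f(x_t)+\epsilon_t$. The regret is $R(T)=\sum_{t=1}^T\big(f(x_t^* )-f(x_t)\big)$ with $x_t^*\in\arg\max_{x=z_ta,\,a\in\mathcal{A}}f(x)$. Neural tangent kernel: for the fully-connected ReLU network with $L$ hidden layers of width $m$, $f^{(1)}(x)=W^{(1)}x$, $f^{(l)}(x)=\sqrt{2/m}\,W^{(l)}\sigma_{\mathrm{relu}}(f^{(l-1)}(x))$ for $1<l\le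 L$, $f(x;\theta)=\sqrt2\,W^{(L+1)}\sigma_{\mathrm{relu}}(f^{(L)}(x))$, with i.i.d. standard normal weights $\theta=(W^{(i)})_{i\le L+1}$ and gradient $g=\nabla_\theta f$, $k_{\mathrm{NN}}(x,x')$ is the deterministic limit of $\langle g(x;\theta),g(x';\theta)\rangle/m$ as $m\to\infty$. Maximum information gain: $\gamma_T=\max_{x_1,\dots,x_T\in\mathcal{X}}\frac12\log\det\big(I+\sigma^{-2}[k_{\mathrm{NN}}(x_i,x_j)]_{i,j\le T}\big)$. SupNTK-UCB: let $S=\log T$ (number of levels, rounded up) and initialize index sets $\Psi_1^{(s)}=\emptyset$ for $s\le S$. For an index set $\Psi=\Psi_t^{(s)}\subset\{1,\dots,t-1\}$ let $K=[k_{\mathrm{NN}}(x_i,x_j)]_{i,j\in\Psi}$, $\mathbf k(x)=[k_{\mathrm{NN}}(x_i,x)]_{i\in\Psi}$, $\mathbf y=[y_i]_{i\in\Psi}$, $\mu_{t-1}^{(s)}(x)=\mathbf k(x)^T(K+\sigma^2I)^{-1}\mathbf y$, $\sigma_{t-1}^{(s)}(x)=\sqrt{k_{\mathrm{NN}}(x,x)-\mathbf k(x)^T(K+\sigma^2I)^{-1}\mathbf k(x)}$. At each round $t=1,\dots,T$ set $s=1$, $A_1=\mathcal{A}$ and repeat until an action is chosen: (i) if $\sqrt{\beta_t}\,\sigma_{t-1}^{(s)}(z_ta)\le\sigma/\sqrt T$ for all $a\in A_s$: choose $a_t\in\arg\max_{a\in A_s}\mu_{t-1}^{(s)}(z_ta)+\sqrt{\beta_t}\,\sigma_{t-1}^{(s)}(z_ta)$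 and keep $\Psi_{t+1}^{(s')}=\Psi_t^{(s')}$ for all $s'$; (ii) else if $\sqrt{\beta_t}\,\sigma_{t-1}^{(s)}(z_ta)\le\sigma2^{-s}$ for all $a\in A_s$: set $A_{s+1}=\{a\in A_s:\mu_{t-1}^{(s)}(z_ta)+\sqrt{\beta_t}\sigma_{t-1}^{(s)}(z_ta)\ge\max_{a'\in A_s}[\mu_{t-1}^{(s)}(z_ta')+\sqrt{\beta_t}\sigma_{t-1}^{(s)}(z_ta')]-\sigma2^{1-s}\}$ and $s\leftarrow s+1$; (iii) else: choose (at random) some $a_t\in A_s$ with $\sqrt{\beta_t}\,\sigma_{t-1}^{(s)}(z_ta_t)>\sigma2^{-s}$, set $\Psi_{t+1}^{(s)}=\Psi_t^{(s)}\cup\{t\}$ and $\Psi_{t+1}^{(s')}=\Psi_t^{(s')}$ for $s'\ne s$. The $\mathcal{O}(\cdot)$ describes growth in $T$. *)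

theory Defs
  imports
    "Jordan_Normal_Form.Gauss_Jordan_Elimination"
    "Jordan_Normal_Form.Determinant"
    "HOL-Probability.Probability"
begin

section \<open>The neural tangent kernel\<close>

text \<open>Scalar weights: \<open>In i j\<close> is the entry \<open>(i, j)\<close> of \<open>W\<^sup>1\<close>, \<open>Hid l i j\<close> that of \<open>W\<^sup>l\<close> for
  \<open>2 \<le> l \<le> L\<close>, and \<open>Out j\<close> the entry \<open>j\<close> of the single row of \<open>W\<^sup>L\<^sup>+\<^sup>1\<close>.\<close>

datatype 'd param = In nat 'd | Hid nat nat nat | Out nat

definition params :: "nat \<Rightarrow> nat \<Rightarrow> 'd param set" where
  "params L m = {In i j | i j. i < m} \<union> {Hid l i j | l i j. 2 \<le> l \<and> l \<le> L \<and> i < m \<and> j < m}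
    \<union> {Out j | j. j < m}"

definition relu :: "real \<Rightarrow> real" where
  "relu u = max 0 u"

text \<open>\<open>layer m \<theta> x l i\<close> is the coordinate \<open>i < m\<close> of \<open>f\<^sup>l(x)\<close>, for \<open>l \<ge> 1\<close>; layer 0 is a dummy.\<close>

fun layer :: "nat \<Rightarrow> ('d::finite param \<Rightarrow> real) \<Rightarrow> real ^ 'd \<Rightarrow> nat \<Rightarrow> nat \<Rightarrow> real" where
  "layer m \<theta> x 0 i = 0"
| "layer m \<theta> x (Suc 0) i = (\<Sum>j\<in>UNIV. \<theta> (In i j) * vec_nth x j)"
| "layer m \<theta> x (Suc (Suc l)) i =
    sqrt (2 / real m) * (\<Sum>j<m. \<theta> (Hid (Suc (Suc l)) i j) * relu (layer m \<theta> x (Suc l) j))"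

definition network :: "nat \<Rightarrow> nat \<Rightarrow> ('d::finite param \<Rightarrow> real) \<Rightarrow> real ^ 'd \<Rightarrow> real" where
  "network L m \<theta> x = sqrt 2 * (\<Sum>j<m. \<theta> (Out j) * relu (layer m \<theta> x L j))"

definition gradient ::
    "nat \<Rightarrow> nat \<Rightarrow> ('d::finite param \<Rightarrow> real) \<Rightarrow> real ^ 'd \<Rightarrow> 'd param \<Rightarrow> real" where
  "gradient L m \<theta> x p = deriv (\<lambda>w. network L m (\<theta>(p := w)) x) (\<theta> p)"

definition empirical_ntk ::
    "nat \<Rightarrow> nat \<Rightarrow> ('d::finite param \<Rightarrow> real) \<Rightarrow> real ^ 'd \<Rightarrow> real ^ 'd \<Rightarrow> real" where
  "empirical_ntk L m \<theta> x x' =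
    (\<Sum>p\<in>params L m. gradient L m \<theta> x p * gradient L m \<theta> x' p) / real m"

definition init_weights :: "nat \<Rightarrow> nat \<Rightarrow> ('d param \<Rightarrow> real) measure" where
  "init_weights L m = Pi\<^sub>M (params L m) (\<lambda>_. density lborel std_normal_density)"

text \<open>\<open>k\<close> is the limit in probability of the empirical kernels as the width tends to infinity. The
  probabilities of the good events are required to tend to 1 (rather than those of the bad events
  to 0) because \<^const>\<open>measure\<close> is 0 on non-measurable sets.\<close>

definition is_ntk :: "nat \<Rightarrow> (real ^ 'd::finite) set \<Rightarrow> (real ^ 'd \<Rightarrow> real ^ 'd \<Rightarrow> real) \<Rightarrow> bool" where
  "is_ntk L X k \<longleftrightarrow> (\<forall>x\<in>X. \<forall>x'\<in>X. \<forall>e>0.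
    (\<lambda>m. measure (init_weights L m)
       {\<theta> \<in> space (init_weights L m). \<bar>empirical_ntk L m \<theta> x x' - k x x'\<bar> \<le> e}) \<longlonglongrightarrow> 1)"


section \<open>Reproducing kernel Hilbert spaces\<close>

text \<open>\<open>H\<close> with inner product \<open>ip\<close> is the reproducing kernel Hilbert space on \<open>X\<close> with kernel \<open>k\<close>.
  A function on \<open>X\<close> is represented by its extension by 0 to the whole type.\<close>

locale rkhs =
  fixes X :: "'x set" and k :: "'x \<Rightarrow> 'x \<Rightarrow> real"
    and H :: "('x \<Rightarrow> real) set" and ip :: "('x \<Rightarrow> real) \<Rightarrow> ('x \<Rightarrow> real) \<Rightarrow> real"
  assumes zero_outside: "\<And>f x. f \<in> H \<Longrightarrow> x \<notin> X \<Longrightarrow> f x = 0"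
    and zero_mem: "(\<lambda>_. 0) \<in> H"
    and add_mem: "\<And>f g. f \<in> H \<Longrightarrow> g \<in> H \<Longrightarrow> (\<lambda>x. f x + g x) \<in> H"
    and scale_mem: "\<And>c f. f \<in> H \<Longrightarrow> (\<lambda>x. c * f x) \<in> H"
    and ip_commute: "\<And>f g. f \<in> H \<Longrightarrow> g \<in> H \<Longrightarrow> ip f g = ip g f"
    and ip_add: "\<And>f g h. f \<in> H \<Longrightarrow> g \<in> H \<Longrightarrow> h \<in> H \<Longrightarrow>
                   ip (\<lambda>x. f x + g x) h = ip f h + ip g h"
    and ip_scale: "\<And>c f g. f \<in> H \<Longrightarrow> g \<in> H \<Longrightarrow> ip (\<lambda>x. c * f x) g = c * ip f g"
    and ip_pos: "\<And>f. f \<in> H \<Longrightarrow> f \<noteq> (\<lambda>_. 0) \<Longrightarrow> ip f f > 0"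
    and complete: "\<And>F. (\<And>n::nat. F n \<in> H) \<Longrightarrow>
      (\<And>e. e > 0 \<Longrightarrow> \<exists>N. \<forall>m\<ge>N. \<forall>n\<ge>N.
         sqrt (ip (\<lambda>x. F m x - F n x) (\<lambda>x. F m x - F n x)) < e) \<Longrightarrow>
      \<exists>g\<in>H. (\<lambda>n. sqrt (ip (\<lambda>x. F n x - g x) (\<lambda>x. F n x - g x))) \<longlonglongrightarrow> 0"
    and kernel_mem: "\<And>x. x \<in> X \<Longrightarrow> (\<lambda>y. if y \<in> X then k x y else 0) \<in> H"
    and reproducing: "\<And>f x. f \<in> H \<Longrightarrow> x \<in> X \<Longrightarrow> ip f (\<lambda>y. if y \<in> X then k x y else 0) = f x"


section \<open>Noise\<close>

definition sub_gaussian :: "'w measure \<Rightarrow> ('w \<Rightarrow> real) \<Rightarrow> real \<Rightarrow> bool" where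
  "sub_gaussian M Y v \<longleftrightarrow> Y \<in> borel_measurable M \<and>
    (\<forall>c::real. integrable M (\<lambda>\<omega>. exp (c * Y \<omega>)) \<and>
       integral\<^sup>L M (\<lambda>\<omega>. exp (c * Y \<omega>)) \<le> exp (c\<^sup>2 * v / 2))"

definition iid_sub_gaussian_noise :: "'w measure \<Rightarrow> nat set \<Rightarrow> (nat \<Rightarrow> 'w \<Rightarrow> real) \<Rightarrow> real \<Rightarrow> bool" where
  "iid_sub_gaussian_noise M I \<epsilon> v \<longleftrightarrow>
    prob_space.indep_vars M (\<lambda>_. borel) \<epsilon> I \<and>
    (\<forall>s\<in>I. \<forall>t\<in>I. distr M borel (\<epsilon> s) = distr M borel (\<epsilon> t)) \<and>
    (\<forall>t\<in>I. integral\<^sup>L M (\<epsilon> t) = 0 \<and> sub_gaussian M (\<epsilon> t) v)"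


section \<open>Kernel regression and information gain\<close>

definition kernel_mat :: "('x \<Rightarrow> 'x \<Rightarrow> real) \<Rightarrow> (nat \<Rightarrow> 'x) \<Rightarrow> nat set \<Rightarrow> real Matrix.mat" where
  "kernel_mat k x \<Psi> = (let is = sorted_list_of_set \<Psi> in
     Matrix.mat (card \<Psi>) (card \<Psi>) (\<lambda>(i, j). k (x (is ! i)) (x (is ! j))))"

definition kernel_vec :: "('x \<Rightarrow> 'x \<Rightarrow> real) \<Rightarrow> (nat \<Rightarrow> 'x) \<Rightarrow> nat set \<Rightarrow> 'x \<Rightarrow> real Matrix.vec" where
  "kernel_vec k x \<Psi> u = (let is = sorted_list_of_set \<Psi> in
     Matrix.vec (card \<Psi>) (\<lambda>i. k (x (is ! i)) u))"

definition reward_vec :: "(nat \<Rightarrow> real) \<Rightarrow> nat set \<Rightarrow> real Matrix.vec" where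
  "reward_vec y \<Psi> = (let is = sorted_list_of_set \<Psi> in Matrix.vec (card \<Psi>) (\<lambda>i. y (is ! i)))"

definition reg_inverse :: "('x \<Rightarrow> 'x \<Rightarrow> real) \<Rightarrow> real \<Rightarrow> (nat \<Rightarrow> 'x) \<Rightarrow> nat set \<Rightarrow> real Matrix.mat" where
  "reg_inverse k \<sigma> x \<Psi> = the (mat_inverse (kernel_mat k x \<Psi> + \<sigma>\<^sup>2 \<cdot>\<^sub>m 1\<^sub>m (card \<Psi>)))"

definition post_mean ::
    "('x \<Rightarrow> 'x \<Rightarrow> real) \<Rightarrow> real \<Rightarrow> (nat \<Rightarrow> 'x) \<Rightarrow> (nat \<Rightarrow> real) \<Rightarrow> nat set \<Rightarrow> 'x \<Rightarrow> real" where
  "post_mean k \<sigma> x y \<Psi> u =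
    scalar_prod (kernel_vec k x \<Psi> u) (reg_inverse k \<sigma> x \<Psi> *\<^sub>v reward_vec y \<Psi>)"

definition post_sd :: "('x \<Rightarrow> 'x \<Rightarrow> real) \<Rightarrow> real \<Rightarrow> (nat \<Rightarrow> 'x) \<Rightarrow> nat set \<Rightarrow> 'x \<Rightarrow> real" where
  "post_sd k \<sigma> x \<Psi> u =
    sqrt (k u u - scalar_prod (kernel_vec k x \<Psi> u) (reg_inverse k \<sigma> x \<Psi> *\<^sub>v kernel_vec k x \<Psi> u))"

text \<open>The supremum is the maximum whenever the latter exists; \<open>X\<close> need not be compact.\<close>

definition info_gain :: "('x \<Rightarrow> 'x \<Rightarrow> real) \<Rightarrow> real \<Rightarrow> 'x set \<Rightarrow> nat \<Rightarrow> real" where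
  "info_gain k \<sigma> X T = (SUP x\<in>{1..T} \<rightarrow> X.
     1 / 2 * ln (Determinant.det (1\<^sub>m T + (1 / \<sigma>\<^sup>2) \<cdot>\<^sub>m kernel_mat k x {1..T})))"


section \<open>SupNTK-UCB\<close>

definition num_levels :: "nat \<Rightarrow> nat" where
  "num_levels T = nat \<lceil>ln (real T)\<rceil>"

text \<open>Within one round, \<open>\<mu> s a\<close> and \<open>w s a\<close> denote the mean and the scaled width
  (square root of \<open>\<beta>\<^sub>t\<close> times standard deviation) of action \<open>a\<close> at level \<open>s\<close>.\<close>

definition all_certain :: "real \<Rightarrow> nat \<Rightarrow> (nat \<Rightarrow> 'a \<Rightarrow> real) \<Rightarrow> nat \<Rightarrow> 'a set \<Rightarrow> bool" where
  "all_certain \<sigma> T w s A \<longleftrightarrow> (\<forall>a\<in>A. w s a \<le> \<sigma> / sqrt (real T))"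

definition all_narrow :: "real \<Rightarrow> (nat \<Rightarrow> 'a \<Rightarrow> real) \<Rightarrow> nat \<Rightarrow> 'a set \<Rightarrow> bool" where
  "all_narrow \<sigma> w s A \<longleftrightarrow> (\<forall>a\<in>A. w s a \<le> \<sigma> * 2 powr (- real s))"

definition surviving ::
    "real \<Rightarrow> (nat \<Rightarrow> 'a \<Rightarrow> real) \<Rightarrow> (nat \<Rightarrow> 'a \<Rightarrow> real) \<Rightarrow> nat \<Rightarrow> 'a set \<Rightarrow> 'a set" where
  "surviving \<sigma> \<mu> w s A =
    {a \<in> A. \<mu> s a + w s a \<ge> Max ((\<lambda>a'. \<mu> s a' + w s a') ` A) - \<sigma> * 2 powr (1 - real s)}"

text \<open>\<open>visits \<sigma> T \<mu> w s A\<close>: the inner loop of the round reaches level \<open>s\<close> with \<open>A\<^sub>s = A\<close>.\<close>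

inductive visits ::
    "real \<Rightarrow> nat \<Rightarrow> (nat \<Rightarrow> 'a \<Rightarrow> real) \<Rightarrow> (nat \<Rightarrow> 'a \<Rightarrow> real) \<Rightarrow> nat \<Rightarrow> 'a set \<Rightarrow> bool"
  for \<sigma> T \<mu> w where
  start: "visits \<sigma> T \<mu> w 1 UNIV"
| eliminate: "visits \<sigma> T \<mu> w s A \<Longrightarrow> \<not> all_certain \<sigma> T w s A \<Longrightarrow> all_narrow \<sigma> w s A \<Longrightarrow>
    visits \<sigma> T \<mu> w (Suc s) (surviving \<sigma> \<mu> w s A)"

text \<open>Round \<open>t\<close> chooses \<open>a\<close> and turns the index sets \<open>\<Psi>\<close> into \<open>\<Psi>'\<close>. The random choice in the
  exploration step is made by the choice function \<open>pick\<close> applied to the set of eligible actions.\<close>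

definition sup_ucb_round ::
    "real \<Rightarrow> nat \<Rightarrow> (nat \<Rightarrow> 'a \<Rightarrow> real) \<Rightarrow> (nat \<Rightarrow> 'a \<Rightarrow> real) \<Rightarrow> ('a set \<Rightarrow> 'a) \<Rightarrow>
     nat \<Rightarrow> (nat \<Rightarrow> nat set) \<Rightarrow> 'a \<Rightarrow> (nat \<Rightarrow> nat set) \<Rightarrow> bool" where
  "sup_ucb_round \<sigma> T \<mu> w pick t \<Psi> a \<Psi>' \<longleftrightarrow>
    (\<exists>s A. 1 \<le> s \<and> s \<le> num_levels T \<and> visits \<sigma> T \<mu> w s A \<and>
      (all_certain \<sigma> T w s A \<and> is_arg_max (\<lambda>b. \<mu> s b + w s b) (\<lambda>b. b \<in> A) a \<and> \<Psi>' = \<Psi>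
       \<or> \<not> all_certain \<sigma> T w s A \<and> \<not> all_narrow \<sigma> w s A \<and>
         a = pick {b \<in> A. w s b > \<sigma> * 2 powr (- real s)} \<and> \<Psi>' = \<Psi>(s := \<Psi> s \<union> {t})))"

text \<open>\<open>arm t b\<close> is the input offered by action \<open>b\<close> in round \<open>t\<close>, and \<open>y\<close>, \<open>a\<close> are the observed
  rewards and the chosen actions.\<close>

definition sup_ucb_run ::
    "('x \<Rightarrow> 'x \<Rightarrow> real) \<Rightarrow> real \<Rightarrow> (nat \<Rightarrow> real) \<Rightarrow> nat \<Rightarrow> (nat \<Rightarrow> 'a \<Rightarrow> 'x) \<Rightarrow>
     (nat \<Rightarrow> 'a set \<Rightarrow> 'a) \<Rightarrow> (nat \<Rightarrow> real) \<Rightarrow> (nat \<Rightarrow> 'a) \<Rightarrow> bool" where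
  "sup_ucb_run k \<sigma> \<beta> T arm pick y a \<longleftrightarrow>
    (\<exists>\<Psi> :: nat \<Rightarrow> nat \<Rightarrow> nat set. (\<forall>s. \<Psi> 1 s = {}) \<and>
      (\<forall>t\<in>{1..T}. sup_ucb_round \<sigma> T
         (\<lambda>s b. post_mean k \<sigma> (\<lambda>i. arm i (a i)) y (\<Psi> t s) (arm t b))
         (\<lambda>s b. sqrt (\<beta> t) * post_sd k \<sigma> (\<lambda>i. arm i (a i)) (\<Psi> t s) (arm t b))
         (pick t) t (\<Psi> t) (a t) (\<Psi> (Suc t))))"

definition indep_rvs :: "'w measure \<Rightarrow> 'b measure \<Rightarrow> ('w \<Rightarrow> 'b) \<Rightarrow> 'c measure \<Rightarrow> ('w \<Rightarrow> 'c) \<Rightarrow> bool" where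
  "indep_rvs M N Y N' Y' \<longleftrightarrow> Y \<in> measurable M N \<and> Y' \<in> measurable M N' \<and>
    prob_space.indep_set M {Y -` E \<inter> space M | E. E \<in> sets N} {Y' -` E \<inter> space M | E. E \<in> sets N'}"

text \<open>The random choices are admissible and, as a process, independent of the noise.
  (\<^const>\<open>prob_space.indep_var\<close> is confined to two variables of the same type.)\<close>

definition random_picks ::
    "'w measure \<Rightarrow> nat \<Rightarrow> (nat \<Rightarrow> 'w \<Rightarrow> real) \<Rightarrow> (nat \<Rightarrow> 'w \<Rightarrow> 'a set \<Rightarrow> 'a) \<Rightarrow> bool" where
  "random_picks M T \<epsilon> pick \<longleftrightarrow>
    (\<forall>t\<in>{1..T}. \<forall>\<omega>\<in>space M. \<forall>Q. Q \<noteq> {} \<longrightarrow> pick t \<omega> Q \<in> Q) \<and>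
    indep_rvs M
      (Pi\<^sub>M {1..T} (\<lambda>_. borel)) (\<lambda>\<omega>. \<lambda>t\<in>{1..T}. \<epsilon> t \<omega>)
      (Pi\<^sub>M {1..T} (\<lambda>_. count_space UNIV)) (\<lambda>\<omega>. \<lambda>t\<in>{1..T}. pick t \<omega>)"

text \<open>Action \<open>b\<close> is the one-hot vector \<open>axis b 1\<close>.\<close>

definition context_arm :: "(nat \<Rightarrow> real ^ 'a ^ 'd) \<Rightarrow> nat \<Rightarrow> 'a::finite \<Rightarrow> real ^ 'd" where
  "context_arm z t b = z t *v axis b 1"

definition regret :: "('x \<Rightarrow> real) \<Rightarrow> (nat \<Rightarrow> 'a::finite \<Rightarrow> 'x) \<Rightarrow> nat \<Rightarrow> (nat \<Rightarrow> 'a) \<Rightarrow> real" where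
  "regret f arm T a = (\<Sum>t=1..T. Max (range (\<lambda>b. f (arm t b))) - f (arm t (a t)))"

end

theory Submission
  imports Defs "HOL-Real_Asymp.Real_Asymp"
begin

text \<open>Write \<open>w\<close> for the scaled width of a level. The posterior mean of a level misses \<open>f\<close> by a bias of at
  most \<open>B\<close> standard deviations plus a linear form in the noise at that level. Which rounds enter a level
  is decided by the means of the lower levels and by widths, which ignore the rewards; so this noise is
  still independent and the linear form is sub-Gaussian. A mean thus misses by more than \<open>w\<close> with
  probability at most \<open>q = 2 * exp (- (sqrt \<beta> - B)\<^sup>2 / 2)\<close>.

  This \<open>\<beta>\<close> accounts neither for \<open>B\<close> nor for the number of levels, so that a union bound over all rounds does not
  give confidence \<open>1 - \<delta>\<close>. But \<open>q\<close> is of order \<open>T\<close> to the power \<open>-1 + o(1)\<close>, hence the expected number of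
  inaccurate rounds is \<open>o(sqrt T)\<close>, and by Markov's inequality there are more than \<open>sqrt T\<close> of them only with
  vanishing probability. Each costs at most \<open>2 * B * sqrt \<kappa>\<close>, where \<open>\<kappa>\<close> bounds the kernel on the diagonal; by
  rotation invariance of the Gaussian weights such a \<open>\<kappa>\<close> exists. In the accurate rounds the best
  action is never eliminated: an exploration at level \<open>s\<close> costs a multiple of \<open>2\<close> to the power \<open>-s\<close>, and the number
  of explorations at level \<open>s\<close> is at most \<open>4 * \<beta> * \<gamma>\<^sub>T\<close> times \<open>4\<close> to the power \<open>s\<close> by the chain rule for the
  determinant.\<close>


section \<open>Boundedness of the neural tangent kernel\<close>

text \<open>The history of a run depends on the noise, so the linear form in the noise has random
  weights. Conditioning is replaced by a finite decomposition. For a fixed value \<open>p\<close> of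
  the picks and a fixed history \<open>h\<close> the weights are constants; the event that the run
  follows \<open>p\<close> and \<open>h\<close>, seen from levels up to \<open>s\<close>, involves
  no noise of level \<open>s\<close>; and such events are disjoint for different pairs. Summing
  products of probabilities therefore costs no factor for the number of histories.

  Tolerating \<open>sqrt T\<close> inaccurate rounds is affordable because
  \<open>sqrt T * max_gap\<close> is of the order of \<open>sqrt T * (\<sigma> * B)\<close> when
  \<open>B > 0\<close>; this is why \<open>C\<close> depends on \<open>B\<close>,
  \<open>\<sigma>\<close> and \<open>\<kappa>\<close>. The kernel is given only as a limit in
  probability at each pair of points, without formula or continuity, and \<open>X\<close> need not
  be compact; so \<open>\<kappa>\<close> comes from comparing two inputs at one common finite width.
  The same \<open>\<kappa>\<close> makes the supremum in \<open>info_gain\<close> finite.\<close>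

abbreviation std_normal :: "real measure" where
  "std_normal \<equiv> density lborel std_normal_density"

lemma prob_space_std_normal: "prob_space std_normal"
  by (rule prob_space_normal_density) simp

section \<open>Standard Gaussian vectors and orthogonal maps\<close>

lemma PiM_density_lborel:
  fixes g :: "real \<Rightarrow> real"
  assumes g[measurable]: "g \<in> borel_measurable borel" and "\<And>x. 0 \<le> g x" and "prob_space (density lborel g)"
  shows "Pi\<^sub>M (UNIV :: 'i::finite set) (\<lambda>_. density lborel g) =
    density (Pi\<^sub>M UNIV (\<lambda>_. lborel)) (\<lambda>v. \<Prod>i\<in>UNIV. ennreal (g (v i)))"
proof -
  interpret P: product_sigma_finite "\<lambda>_::'i. density lborel (\<lambda>x. ennreal (g x))"
    using assms(3) by (simp add: product_sigma_finite_def prob_space_imp_sigma_finite)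
  interpret L: product_sigma_finite "\<lambda>_::'i. lborel :: real measure"
    by (simp add: product_sigma_finite_def lborel.sigma_finite_measure_axioms)
  show ?thesis
  proof (rule P.PiM_eqI[symmetric])
    show "sets (density (Pi\<^sub>M UNIV (\<lambda>_. lborel)) (\<lambda>v. \<Prod>i\<in>UNIV. ennreal (g (v i)))) =
        sets (Pi\<^sub>M (UNIV :: 'i set) (\<lambda>_. density lborel (\<lambda>x. ennreal (g x))))"
      by (simp cong: sets_PiM_cong)
  next
    fix A :: "'i \<Rightarrow> real set"
    assume A: "\<And>i. i \<in> UNIV \<Longrightarrow> A i \<in> sets (density lborel (\<lambda>x. ennreal (g x)))"
    then have A'[measurable]: "A i \<in> sets borel" for i by simp
    have "emeasure (density (Pi\<^sub>M UNIV (\<lambda>_. lborel)) (\<lambda>v. \<Prod>i\<in>UNIV. ennreal (g (v i)))) (Pi\<^sub>E UNIV A) =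
      (\<integral>\<^sup>+v. (\<Prod>i\<in>UNIV. ennreal (g (v i))) * indicator (Pi\<^sub>E UNIV A) v \<partial>(Pi\<^sub>M UNIV (\<lambda>_. lborel)))"
      by (subst emeasure_density) (auto intro!: sets_PiM_I_finite)
    also have "\<dots> = (\<integral>\<^sup>+v. (\<Prod>i\<in>UNIV. ennreal (g (v i)) * indicator (A i) (v i)) \<partial>(Pi\<^sub>M UNIV (\<lambda>_. lborel)))"
    proof (rule nn_integral_cong)
      fix v :: "'i \<Rightarrow> real"
      have "indicator (Pi\<^sub>E UNIV A) v = (\<Prod>i\<in>UNIV. indicator (A i) (v i) :: ennreal)"
        by (auto simp: indicator_def PiE_iff prod_zero_iff)
      then show "(\<Prod>i\<in>UNIV. ennreal (g (v i))) * indicator (Pi\<^sub>E UNIV A) v =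
          (\<Prod>i\<in>UNIV. ennreal (g (v i)) * indicator (A i) (v i))"
        by (simp add: prod.distrib)
    qed
    also have "\<dots> = (\<Prod>i\<in>UNIV. \<integral>\<^sup>+x. ennreal (g x) * indicator (A i) x \<partial>lborel)"
      by (rule L.product_nn_integral_prod) auto
    also have "\<dots> = (\<Prod>i\<in>UNIV. emeasure (density lborel (\<lambda>x. ennreal (g x))) (A i))"
      by (subst emeasure_density) auto
    finally show "emeasure (density (Pi\<^sub>M UNIV (\<lambda>_. lborel)) (\<lambda>v. \<Prod>i\<in>UNIV. ennreal (g (v i)))) (Pi\<^sub>E UNIV A) =
      (\<Prod>i\<in>UNIV. emeasure (density lborel (\<lambda>x. ennreal (g x))) (A i))" .
  qed simp
qed

lemma measurable_vec_lambda_PiM [measurable]: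
  "(\<lambda>v. \<chi> i. v i) \<in> Pi\<^sub>M (UNIV :: 'n::finite set) (\<lambda>_. borel) \<rightarrow>\<^sub>M (borel :: (real ^ 'n) measure)"
proof (rule borel_measurable_euclidean_space[THEN iffD2], safe)
  fix b :: "real ^ 'n" assume "b \<in> Basis"
  then obtain i where b: "b = axis i 1" by (auto simp: Basis_vec_def)
  have "(\<lambda>v. inner (\<chi> i. v i) b) = (\<lambda>v. v i)"
    by (simp add: b inner_axis fun_eq_iff)
  then show "(\<lambda>v. inner (\<chi> i. v i) b) \<in> borel_measurable (Pi\<^sub>M UNIV (\<lambda>_. borel))"
    by simp
qed

text \<open>Links the product measure, in which the weights are sampled, to the Euclidean space on
  which orthogonal maps act. Both sides agree on boxes.\<close>

lemma lborel_vec_eq_PiM: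
  "(lborel :: (real ^ 'n::finite) measure) = distr (Pi\<^sub>M UNIV (\<lambda>_. lborel)) borel (\<lambda>v. \<chi> i. v i)"
proof (rule lborel_eqI)
  fix l u :: "real ^ 'n"
  assume le: "\<And>b. b \<in> Basis \<Longrightarrow> inner l b \<le> inner u b"
  interpret L: product_sigma_finite "\<lambda>_::'n. lborel :: real measure"
    by (simp add: product_sigma_finite_def lborel.sigma_finite_measure_axioms)
  have le': "vec_nth l i \<le> vec_nth u i" for i
    using le[of "axis i 1"] by (simp add: inner_axis axis_in_Basis_iff)
  have meas[measurable]: "(\<lambda>v. \<chi> i. v i) \<in> Pi\<^sub>M (UNIV :: 'n set) (\<lambda>_. lborel) \<rightarrow>\<^sub>M (borel :: (real ^ 'n) measure)"
    using measurable_vec_lambda_PiM by (simp cong: measurable_cong_sets sets_PiM_cong)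
  have "emeasure (distr (Pi\<^sub>M UNIV (\<lambda>_. lborel)) borel (\<lambda>v. \<chi> i. v i)) (box l u) =
      emeasure (Pi\<^sub>M UNIV (\<lambda>_. lborel)) (Pi\<^sub>E UNIV (\<lambda>i. {vec_nth l i<..<vec_nth u i}))"
    by (subst emeasure_distr) (auto simp: mem_box_cart space_PiM PiE_iff intro!: arg_cong2[where f=emeasure])
  also have "\<dots> = (\<Prod>i\<in>UNIV. ennreal (vec_nth (u - l) i))"
    by (subst L.emeasure_PiM) (auto simp: le')
  also have "\<dots> = ennreal (\<Prod>i\<in>UNIV. vec_nth (u - l) i)"
    by (rule prod_ennreal) (simp add: le')
  also have "(\<Prod>i\<in>UNIV. vec_nth (u - l) i) = (\<Prod>b\<in>Basis. inner (u - l) b)"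
  proof -
    have B: "(Basis :: (real ^ 'n) set) = range (\<lambda>i. axis i 1)"
      by (auto simp: Basis_vec_def)
    show ?thesis
      unfolding B by (subst prod.reindex) (auto simp: inj_on_def axis_eq_axis inner_axis)
  qed
  finally show "emeasure (distr (Pi\<^sub>M UNIV (\<lambda>_. lborel)) borel (\<lambda>v. \<chi> i. v i)) (box l u) =
      (\<Prod>b\<in>Basis. inner (u - l) b)" by simp
qed simp

text \<open>Boxes determine the measure, and the preimage of a box is its image under the inverse
  map, which is again orthogonal and so keeps Lebesgue measure.\<close>

lemma lborel_distr_orthogonal:
  fixes f :: "real ^ 'n::{finite,wellorder} \<Rightarrow> real ^ 'n::{finite,wellorder}"
  assumes f: "orthogonal_transformation f"
  shows "distr lborel borel f = lborel"
proof (rule lborel_eqI[symmetric])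
  have lin: "linear f" and bij: "bij f"
    using f by (auto simp: orthogonal_transformation_linear orthogonal_transformation_bij)
  have [measurable]: "f \<in> borel \<rightarrow>\<^sub>M borel"
    using lin by (intro borel_measurable_continuous_onI linear_continuous_on) (simp add: linear_conv_bounded_linear)
  have g: "orthogonal_transformation (inv_into UNIV f)"
    using f by (rule orthogonal_transformation_inv)
  fix l u :: "real ^ 'n::{finite,wellorder}"
  assume le: "\<And>b. b \<in> Basis \<Longrightarrow> inner l b \<le> inner u b"
  have lm: "inv_into UNIV f ` box l u \<in> lmeasurable"
    by (rule measurable_orthogonal_image[OF g]) simp
  have "emeasure (distr lborel borel f) (box l u) = emeasure lborel (f -` box l u)"
    by (subst emeasure_distr) auto
  also have "f -` box l u = inv_into UNIV f ` box l u"
    using bij by (simp add: bij_vimage_eq_inv_image)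
  also have "emeasure lborel (inv_into UNIV f ` box l u) = emeasure lebesgue (inv_into UNIV f ` box l u)"
    using measurable_sets_borel[OF \<open>f \<in> borel \<rightarrow>\<^sub>M borel\<close>, of "box l u"]
    by (simp add: bij_vimage_eq_inv_image[OF bij])
  also have "\<dots> = ennreal (measure lebesgue (inv_into UNIV f ` box l u))"
    using lm by (simp add: emeasure_eq_measure2)
  also have "measure lebesgue (inv_into UNIV f ` box l u) = measure lebesgue (box l u)"
    by (rule measure_orthogonal_image[OF g]) simp
  finally show "emeasure (distr lborel borel f) (box l u) = (\<Prod>b\<in>Basis. inner (u - l) b)"
    using le by (simp add: measure_lborel_box_eq)
qed simp

text \<open>The product of the one-dimensional densities depends on the vector only through its
  norm; rotation invariance rests on this.\<close>

lemma PiM_std_normal_eq: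
  "distr (Pi\<^sub>M UNIV (\<lambda>_. std_normal)) borel (\<lambda>v. \<chi> i. v i) =
    density lborel (\<lambda>x :: real ^ 'n::finite. ennreal ((1 / sqrt (2 * pi)) ^ CARD('n) * exp (- (norm x)\<^sup>2 / 2)))"
proof -
  have meas[measurable]: "(\<lambda>v. \<chi> i. v i) \<in> Pi\<^sub>M (UNIV :: 'n set) (\<lambda>_. lborel) \<rightarrow>\<^sub>M (borel :: (real ^ 'n) measure)"
    using measurable_vec_lambda_PiM by (simp cong: measurable_cong_sets sets_PiM_cong)
  have d: "(\<Prod>i\<in>UNIV. ennreal (std_normal_density (vec_nth x i))) =
      ennreal ((1 / sqrt (2 * pi)) ^ CARD('n) * exp (- (norm x)\<^sup>2 / 2))" for x :: "real ^ 'n"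
  proof -
    have "(norm x)\<^sup>2 = (\<Sum>i\<in>UNIV. (vec_nth x i)\<^sup>2)"
      unfolding power2_norm_eq_inner inner_vec_def by (simp add: power2_eq_square)
    then have "exp (- (norm x)\<^sup>2 / 2) = (\<Prod>i\<in>UNIV. exp (- (vec_nth x i)\<^sup>2 / 2))"
      by (simp add: exp_sum[symmetric] sum_negf sum_divide_distrib)
    then show ?thesis
      by (subst prod_ennreal) (simp_all add: std_normal_density_def prod_dividef power_divide)
  qed
  have "Pi\<^sub>M (UNIV :: 'n set) (\<lambda>_. std_normal) =
      density (Pi\<^sub>M UNIV (\<lambda>_. lborel)) (\<lambda>v. \<Prod>i\<in>UNIV. ennreal (std_normal_density (v i)))"
    by (rule PiM_density_lborel) (simp_all add: prob_space_std_normal)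
  also have "\<dots> = density (Pi\<^sub>M UNIV (\<lambda>_. lborel)) (\<lambda>v. ennreal ((1 / sqrt (2 * pi)) ^ CARD('n) * exp (- (norm (\<chi> i. v i :: real ^ 'n))\<^sup>2 / 2)))"
    by (simp only: d[symmetric] vec_lambda_beta)
  finally have "distr (Pi\<^sub>M UNIV (\<lambda>_. std_normal)) borel (\<lambda>v. \<chi> i. v i) =
      distr (density (Pi\<^sub>M UNIV (\<lambda>_. lborel)) (\<lambda>v. ennreal ((1 / sqrt (2 * pi)) ^ CARD('n) *
        exp (- (norm (\<chi> i. v i :: real ^ 'n))\<^sup>2 / 2)))) borel (\<lambda>v. \<chi> i. v i)" by simp
  also have "\<dots> = density (distr (Pi\<^sub>M UNIV (\<lambda>_. lborel)) borel (\<lambda>v. \<chi> i. v i))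
      (\<lambda>x :: real ^ 'n. ennreal ((1 / sqrt (2 * pi)) ^ CARD('n) * exp (- (norm x)\<^sup>2 / 2)))"
    by (rule density_distr[symmetric]) auto
  finally show ?thesis by (simp only: lborel_vec_eq_PiM[symmetric])
qed

lemma PiM_std_normal_orthogonal:
  fixes f :: "real ^ 'n::{finite,wellorder} \<Rightarrow> real ^ 'n::{finite,wellorder}"
  assumes f: "orthogonal_transformation f"
  shows "distr (Pi\<^sub>M UNIV (\<lambda>_. std_normal)) (Pi\<^sub>M UNIV (\<lambda>_. std_normal)) (\<lambda>v. vec_nth (f (\<chi> i. v i))) =
    Pi\<^sub>M UNIV (\<lambda>_. std_normal)"
proof -
  let ?P = "Pi\<^sub>M (UNIV :: 'n::{finite,wellorder} set) (\<lambda>_. std_normal)"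
  let ?G = "density lborel (\<lambda>x :: real ^ 'n::{finite,wellorder}. ennreal ((1 / sqrt (2 * pi)) ^ CARD('n::{finite,wellorder}) * exp (- (norm x)\<^sup>2 / 2)))"
  have [measurable]: "f \<in> borel \<rightarrow>\<^sub>M borel"
    using f by (intro borel_measurable_continuous_onI linear_continuous_on)
      (simp add: linear_conv_bounded_linear[symmetric] orthogonal_transformation_linear)
  have m1[measurable]: "(\<lambda>v. \<chi> i. v i) \<in> ?P \<rightarrow>\<^sub>M (borel :: (real ^ 'n::{finite,wellorder}) measure)"
    using measurable_vec_lambda_PiM by (simp cong: measurable_cong_sets sets_PiM_cong)
  have m2[measurable]: "vec_nth \<in> (borel :: (real ^ 'n::{finite,wellorder}) measure) \<rightarrow>\<^sub>M ?P"
    by (rule measurable_PiM_single') (auto simp: space_PiM)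
  have G: "distr ?G borel f = ?G"
  proof -
    have "?G = density (distr lborel borel f) (\<lambda>x. ennreal ((1 / sqrt (2 * pi)) ^ CARD('n::{finite,wellorder}) * exp (- (norm x)\<^sup>2 / 2)))"
      by (simp add: lborel_distr_orthogonal[OF f])
    also have "\<dots> = distr (density lborel (\<lambda>x. ennreal ((1 / sqrt (2 * pi)) ^ CARD('n::{finite,wellorder}) * exp (- (norm (f x))\<^sup>2 / 2)))) borel f"
      by (subst density_distr) auto
    also have "\<dots> = distr ?G borel f"
      using f by (simp add: orthogonal_transformation_norm)
    finally show ?thesis by simp
  qed
  have "distr ?P ?P (\<lambda>v. vec_nth (f (\<chi> i. v i))) = distr (distr (distr ?P borel (\<lambda>v. \<chi> i. v i)) borel f) ?P vec_nth"
    by (simp add: distr_distr comp_def)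
  also have "\<dots> = distr (distr ?P borel (\<lambda>v. \<chi> i. v i)) ?P vec_nth"
    by (simp only: PiM_std_normal_eq G)
  also have "\<dots> = distr ?P ?P (\<lambda>v. v)"
    by (simp add: distr_distr comp_def vec_lambda_inverse)
  finally show ?thesis by (simp add: distr_id)
qed

text \<open>The library has the invariance of Lebesgue measure under orthogonal maps only for vectors whose index
  type is a well-order, hence this copy of an arbitrary finite index type.\<close>

typedef 'a wo = "UNIV :: 'a set" morphisms wo_rep wo_abs ..

lemma wo_rep_abs [simp]: "wo_rep (wo_abs x) = x" "wo_abs (wo_rep y) = y"
  by (simp_all add: wo_abs_inverse wo_rep_inverse)

lemma bij_wo_rep: "bij wo_rep"
  by (metis bijI' wo_rep_abs)

instantiation wo :: (finite) "{finite, wellorder}"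
begin

definition less_eq_wo :: "'a wo \<Rightarrow> 'a wo \<Rightarrow> bool" where
  "less_eq_wo x y \<longleftrightarrow> to_nat (wo_rep x) \<le> to_nat (wo_rep y)"

definition less_wo :: "'a wo \<Rightarrow> 'a wo \<Rightarrow> bool" where
  "less_wo x y \<longleftrightarrow> to_nat (wo_rep x) < to_nat (wo_rep y)"

instance
proof
  have "(UNIV :: 'a wo set) = wo_abs ` UNIV"
    by (metis surj_def wo_rep_abs(2))
  then show "finite (UNIV :: 'a wo set)" by (metis finite finite_imageI)
next
  fix P :: "'a wo \<Rightarrow> bool" and x
  assume *: "\<And>x. (\<And>y. y < x \<Longrightarrow> P y) \<Longrightarrow> P x"
  show "P x"
    by (induction "to_nat (wo_rep x)" arbitrary: x rule: less_induct) (metis * less_wo_def)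
qed (auto simp: less_eq_wo_def less_wo_def, metis wo_rep_abs(2))

end

text \<open>The product over \<open>P\<close> is the image under \<open>merge\<close> of the product
  of its two blocks, and there \<open>r\<close> acts on the first factor alone. This lets one neuron
  be rotated while all other weights stay.\<close>

lemma PiM_block_map:
  assumes N: "prob_space N" and fin: "finite P" and IP: "I \<subseteq> P"
    and r[measurable]: "r \<in> Pi\<^sub>M I (\<lambda>_. N) \<rightarrow>\<^sub>M Pi\<^sub>M I (\<lambda>_. N)"
    and inv: "distr (Pi\<^sub>M I (\<lambda>_. N)) (Pi\<^sub>M I (\<lambda>_. N)) r = Pi\<^sub>M I (\<lambda>_. N)"
  defines "R \<equiv> \<lambda>\<theta>. merge I (P - I) (r (restrict \<theta> I), \<theta>)"
  shows "R \<in> Pi\<^sub>M P (\<lambda>_. N) \<rightarrow>\<^sub>M Pi\<^sub>M P (\<lambda>_. N)"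
    and "distr (Pi\<^sub>M P (\<lambda>_. N)) (Pi\<^sub>M P (\<lambda>_. N)) R = Pi\<^sub>M P (\<lambda>_. N)"
proof -
  interpret N: prob_space N by fact
  interpret product_sigma_finite "\<lambda>_. N" by standard
  interpret PP: product_prob_space "\<lambda>_. N" by standard
  let ?J = "P - I" and ?M = "\<lambda>I. Pi\<^sub>M I (\<lambda>_. N)"
  have fin': "finite I" "finite ?J" using fin IP by (auto intro: finite_subset)
  have P: "P = I \<union> ?J" using IP by auto
  have R_eq: "R = (\<lambda>\<theta>. merge I ?J (r (restrict \<theta> I), restrict \<theta> ?J))"
    unfolding R_def by (auto simp: fun_eq_iff merge_def)
  have "(\<lambda>\<theta>. (r (restrict \<theta> I), restrict \<theta> ?J)) \<in> ?M P \<rightarrow>\<^sub>M ?M I \<Otimes>\<^sub>M ?M ?J"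
    using IP by (intro measurable_Pair measurable_compose[OF measurable_restrict_subset r] measurable_restrict_subset) auto
  then have "R \<in> ?M P \<rightarrow>\<^sub>M ?M (I \<union> ?J)"
    unfolding R_eq by (rule measurable_compose) (rule measurable_merge)
  then show R[measurable]: "R \<in> ?M P \<rightarrow>\<^sub>M ?M P" using P by simp
  have PM: "?M P = distr (?M I \<Otimes>\<^sub>M ?M ?J) (?M P) (merge I ?J)"
    using distr_merge[of I ?J] fin' P by auto
  have mm[measurable]: "merge I ?J \<in> ?M I \<Otimes>\<^sub>M ?M ?J \<rightarrow>\<^sub>M ?M P"
    using measurable_merge[of I ?J "\<lambda>_. N"] P by simp
  have "distr (?M P) (?M P) R = distr (?M I \<Otimes>\<^sub>M ?M ?J) (?M P) (R \<circ> merge I ?J)"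
    by (subst PM) (simp add: distr_distr)
  also have "\<dots> = distr (?M I \<Otimes>\<^sub>M ?M ?J) (?M P) (merge I ?J \<circ> (\<lambda>(a, b). (r a, b)))"
  proof (rule distr_cong)
    fix z assume "z \<in> space (?M I \<Otimes>\<^sub>M ?M ?J)"
    then obtain a b where z: "z = (a, b)" "a \<in> space (?M I)" "b \<in> space (?M ?J)"
      by (auto simp: space_pair_measure)
    have "restrict (merge I ?J (a, b)) I = a" "restrict (merge I ?J (a, b)) ?J = b"
      using z by (auto simp: space_PiM PiE_iff merge_def fun_eq_iff extensional_def)
    then show "(R \<circ> merge I ?J) z = (merge I ?J \<circ> (\<lambda>(a, b). (r a, b))) z"
      by (simp add: R_def z) (simp add: merge_def fun_eq_iff)
  qed auto
  also have "\<dots> = distr (distr (?M I \<Otimes>\<^sub>M ?M ?J) (?M I \<Otimes>\<^sub>M ?M ?J) (\<lambda>(a, b). (r a, b))) (?M P) (merge I ?J)"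
    by (rule distr_distr[symmetric]) auto
  also have "distr (?M I \<Otimes>\<^sub>M ?M ?J) (?M I \<Otimes>\<^sub>M ?M ?J) (\<lambda>(a, b). (r a, b)) =
      distr (?M I) (?M I) r \<Otimes>\<^sub>M distr (?M ?J) (?M ?J) (\<lambda>b. b)"
  proof (subst pair_measure_distr)
    show "sigma_finite_measure (distr (?M ?J) (?M ?J) (\<lambda>b. b))"
      by (simp add: distr_id) (rule sigma_finite[OF fin'(2)])
  qed auto
  also have "\<dots> = ?M I \<Otimes>\<^sub>M ?M ?J" by (simp add: inv distr_id)
  also have "distr \<dots> (?M P) (merge I ?J) = ?M P" by (rule PM[symmetric])
  finally show "distr (?M P) (?M P) R = ?M P" .
qed

text \<open>Conjugation by the relabelling \<open>t\<close>: the rotation acts on vectors indexed by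
  \<open>'d wo\<close>, whereas the weights of a neuron are indexed by the parameters
  \<open>In n j\<close>.\<close>

lemma PiM_reindex_map:
  assumes N: "prob_space N" and t: "bij_betw t K I"
    and \<rho>[measurable]: "\<rho> \<in> Pi\<^sub>M K (\<lambda>_. N) \<rightarrow>\<^sub>M Pi\<^sub>M K (\<lambda>_. N)"
    and inv: "distr (Pi\<^sub>M K (\<lambda>_. N)) (Pi\<^sub>M K (\<lambda>_. N)) \<rho> = Pi\<^sub>M K (\<lambda>_. N)"
  defines "r \<equiv> \<lambda>\<theta>. \<lambda>p\<in>I. \<rho> (\<lambda>n\<in>K. \<theta> (t n)) (inv_into K t p)"
  shows "r \<in> Pi\<^sub>M I (\<lambda>_. N) \<rightarrow>\<^sub>M Pi\<^sub>M I (\<lambda>_. N)"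
    and "distr (Pi\<^sub>M I (\<lambda>_. N)) (Pi\<^sub>M I (\<lambda>_. N)) r = Pi\<^sub>M I (\<lambda>_. N)"
proof -
  let ?M = "\<lambda>I. Pi\<^sub>M I (\<lambda>_. N)"
  let ?fwd = "\<lambda>\<theta>. \<lambda>n\<in>K. \<theta> (t n)" and ?bwd = "\<lambda>v. \<lambda>p\<in>I. v (inv_into K t p)"
  have tK: "t \<in> K \<rightarrow> I" "inj_on t K" "inv_into K t \<in> I \<rightarrow> K" "inj_on (inv_into K t) I"
    using t by (auto simp: bij_betw_def inv_into_into inj_on_inv_into)
  have fwd[measurable]: "?fwd \<in> ?M I \<rightarrow>\<^sub>M ?M K"
    using tK(1) by (intro measurable_restrict measurable_component_singleton) auto
  have bwd[measurable]: "?bwd \<in> ?M K \<rightarrow>\<^sub>M ?M I"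
    using tK(3) by (intro measurable_restrict measurable_component_singleton) auto
  have r_eq: "r = ?bwd \<circ> (\<rho> \<circ> ?fwd)" by (simp add: r_def fun_eq_iff)
  show "r \<in> ?M I \<rightarrow>\<^sub>M ?M I" unfolding r_eq by measurable
  have "distr (?M I) (?M I) r = distr (distr (distr (?M I) (?M K) ?fwd) (?M K) \<rho>) (?M I) ?bwd"
    unfolding r_eq by (simp add: distr_distr comp_assoc)
  also have "distr (?M I) (?M K) ?fwd = ?M K"
    by (rule distr_PiM_reindex[where M="\<lambda>_. N"]) (use N tK in auto)
  also note inv
  also have "distr (?M K) (?M I) ?bwd = ?M I"
    by (rule distr_PiM_reindex[where M="\<lambda>_. N"]) (use N tK in auto)
  finally show "distr (?M I) (?M I) r = ?M I" .
qed

section \<open>Rotating the rows of the first weight matrix\<close>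

definition wo_vec :: "real ^ 'd::finite \<Rightarrow> real ^ 'd wo" where
  "wo_vec x = (\<chi> j. vec_nth x (wo_rep j))"

lemma inner_wo_vec: "inner (wo_vec x) (wo_vec y) = inner x y"
  unfolding wo_vec_def inner_vec_def
  using sum.reindex_bij_betw[OF bij_wo_rep, of "\<lambda>j. inner (vec_nth x j) (vec_nth y j)"] by simp

lemma finite_params: "finite (params L m :: 'd::finite param set)"
proof -
  have "params L m \<subseteq> (\<lambda>(i, j). In i j) ` ({..<m} \<times> (UNIV :: 'd set)) \<union>
    (\<lambda>(l, i, j). Hid l i j) ` ({..L} \<times> {..<m} \<times> {..<m}) \<union> Out ` {..<m}"
    by (auto simp: params_def image_iff)
  then show ?thesis by (rule finite_subset) auto
qed

text \<open>The rows are independent, so they can be rotated one at a time, by induction on the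
  number \<open>n\<close> of rows already rotated; composing measure-preserving maps preserves the
  measure. The case \<open>n = m\<close> is the one applied later.\<close>

lemma rotate_first_layer:
  fixes f :: "real ^ 'd::finite wo \<Rightarrow> real ^ 'd wo"
  assumes f: "orthogonal_transformation f" and "n \<le> m"
  shows "\<exists>R. R \<in> init_weights L m \<rightarrow>\<^sub>M init_weights L m \<and> distr (init_weights L m) (init_weights L m) R = init_weights L m \<and>
    (\<forall>\<theta> p. (\<forall>i<n. \<forall>j. p \<noteq> In i j) \<longrightarrow> p \<in> params L m \<longrightarrow> R \<theta> p = \<theta> p) \<and>
    (\<forall>\<theta>. \<forall>i<n. (\<chi> j. R \<theta> (In i j)) = (\<chi> j. vec_nth (f (wo_vec (\<chi> j. \<theta> (In i j)))) (wo_abs j)))"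
  using \<open>n \<le> m\<close>
proof (induction n)
  case 0
  show ?case
    by (rule exI[of _ "\<lambda>\<theta>. \<theta>"]) (auto simp: distr_id)
next
  case (Suc n)
  then obtain R where R[measurable]: "R \<in> init_weights L m \<rightarrow>\<^sub>M init_weights L m"
    and Rd: "distr (init_weights L m) (init_weights L m) R = init_weights L m"
    and R1: "\<And>\<theta> p. (\<forall>i<n. \<forall>j. p \<noteq> In i j) \<Longrightarrow> p \<in> params L m \<Longrightarrow> R \<theta> p = \<theta> p"
    and R2: "\<And>\<theta> i. i < n \<Longrightarrow> (\<chi> j. R \<theta> (In i j)) = (\<chi> j. vec_nth (f (wo_vec (\<chi> j. \<theta> (In i j)))) (wo_abs j))"
    by auto
  define I where "I = range (In n :: 'd \<Rightarrow> 'd param)"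
  define t where "t = (In n :: 'd \<Rightarrow> 'd param) \<circ> wo_rep"
  have bij: "bij_betw t UNIV I"
    unfolding t_def I_def by (rule bij_betw_trans[OF bij_wo_rep]) (auto simp: bij_betw_def inj_on_def)
  have inv_t: "inv_into UNIV t (In n j) = wo_abs j" for j
    using bij by (intro inv_into_f_eq) (auto simp: bij_betw_def t_def)
  have IP: "I \<subseteq> params L m" using Suc.prems by (auto simp: I_def params_def)
  let ?\<rho> = "\<lambda>v. vec_nth (f (\<chi> i. v i))"
  let ?r = "\<lambda>\<theta>. \<lambda>p\<in>I. ?\<rho> (\<lambda>n\<in>UNIV. \<theta> (t n)) (inv_into UNIV t p)"
  have \<rho>: "?\<rho> \<in> Pi\<^sub>M UNIV (\<lambda>_. std_normal) \<rightarrow>\<^sub>M Pi\<^sub>M UNIV (\<lambda>_. std_normal)"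
  proof -
    have [measurable]: "f \<in> borel \<rightarrow>\<^sub>M borel"
      using f by (intro borel_measurable_continuous_onI linear_continuous_on)
        (simp add: linear_conv_bounded_linear[symmetric] orthogonal_transformation_linear)
    have [measurable]: "(\<lambda>v. \<chi> i. v i) \<in> Pi\<^sub>M (UNIV :: 'd wo set) (\<lambda>_. std_normal) \<rightarrow>\<^sub>M (borel :: (real ^ 'd wo) measure)"
      using measurable_vec_lambda_PiM by (simp cong: measurable_cong_sets sets_PiM_cong)
    have [measurable]: "vec_nth \<in> (borel :: (real ^ 'd wo) measure) \<rightarrow>\<^sub>M Pi\<^sub>M UNIV (\<lambda>_. std_normal)"
      by (rule measurable_PiM_single') (auto simp: space_PiM)
    show ?thesis by measurable
  qed
  note r = PiM_reindex_map[OF prob_space_std_normal bij \<rho> PiM_std_normal_orthogonal[OF f]]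
  define R' where "R' = (\<lambda>\<theta>. merge I (params L m - I) (?r (restrict \<theta> I), \<theta>))"
  have R': "R' \<in> init_weights L m \<rightarrow>\<^sub>M init_weights L m"
      "distr (init_weights L m) (init_weights L m) R' = init_weights L m"
    unfolding R'_def init_weights_def by (rule PiM_block_map[OF prob_space_std_normal finite_params IP r])+
  have R'1: "R' \<theta> p = \<theta> p" if "\<forall>j. p \<noteq> In n j" "p \<in> params L m" for \<theta> p
    using that by (auto simp: R'_def merge_def I_def)
  have R'2: "R' \<theta> (In n j) = vec_nth (f (wo_vec (\<chi> j. \<theta> (In n j)))) (wo_abs j)" for \<theta> j
  proof -
    have "(\<chi> i. (\<lambda>n\<in>UNIV. restrict \<theta> I (t n)) i) = wo_vec (\<chi> j. \<theta> (In n j))"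
      by (auto simp: wo_vec_def vec_eq_iff t_def I_def)
    then show ?thesis by (simp add: R'_def merge_def inv_t) (simp add: I_def)
  qed
  have inP: "In i j \<in> params L m" if "i \<le> n" for i j
    using that Suc.prems by (auto simp: params_def)
  show ?case
  proof (intro exI[of _ "R' \<circ> R"] conjI allI impI)
    show "R' \<circ> R \<in> init_weights L m \<rightarrow>\<^sub>M init_weights L m" using R R'(1) by (rule measurable_comp)
    show "distr (init_weights L m) (init_weights L m) (R' \<circ> R) = init_weights L m"
      using distr_distr[OF R'(1) R] by (simp add: Rd R'(2))
  next
    fix \<theta> :: "'d param \<Rightarrow> real" and p :: "'d param"
    assume "\<forall>i<Suc n. \<forall>j. p \<noteq> In i j" "p \<in> params L m"
    then show "(R' \<circ> R) \<theta> p = \<theta> p" by (simp add: R'1 R1)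
  next
    fix \<theta> :: "'d param \<Rightarrow> real" and i assume i: "i < Suc n"
    show "(\<chi> j. (R' \<circ> R) \<theta> (In i j)) = (\<chi> j. vec_nth (f (wo_vec (\<chi> j. \<theta> (In i j)))) (wo_abs j))"
    proof (cases "i = n")
      case True
      then show ?thesis using R1[OF _ inP, of n] by (simp add: R'2)
    next
      case False
      then have "i < n" using i by simp
      moreover have "R' (R \<theta>) (In i j) = R \<theta> (In i j)" for j
        using False \<open>i < n\<close> by (intro R'1 inP) auto
      ultimately show ?thesis using R2[of i \<theta>] by simp
    qed
  qed
qed

section \<open>The network as a function of the first-layer preactivations\<close>

fun layer_from :: "nat \<Rightarrow> (nat \<Rightarrow> real) \<Rightarrow> ('d param \<Rightarrow> real) \<Rightarrow> nat \<Rightarrow> nat \<Rightarrow> real" where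
  "layer_from m u \<theta> 0 i = 0"
| "layer_from m u \<theta> (Suc 0) i = u i"
| "layer_from m u \<theta> (Suc (Suc l)) i =
    sqrt (2 / real m) * (\<Sum>j<m. \<theta> (Hid (Suc (Suc l)) i j) * relu (layer_from m u \<theta> (Suc l) j))"

text \<open>The input enters the network only through the preactivations \<open>u\<close>, so inputs
  with equal preactivations and equal later weights are indistinguishable.\<close>

definition network_from :: "nat \<Rightarrow> nat \<Rightarrow> (nat \<Rightarrow> real) \<Rightarrow> ('d param \<Rightarrow> real) \<Rightarrow> real" where
  "network_from L m u \<theta> = sqrt 2 * (\<Sum>j<m. \<theta> (Out j) * relu (layer_from m u \<theta> L j))"

definition preact :: "('d::finite param \<Rightarrow> real) \<Rightarrow> real ^ 'd \<Rightarrow> nat \<Rightarrow> real" where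
  "preact \<theta> x i = (\<Sum>j\<in>UNIV. \<theta> (In i j) * vec_nth x j)"

lemma network_eq_from: "network L m \<theta> x = network_from L m (preact \<theta> x) \<theta>"
proof -
  have "layer m \<theta> x l i = layer_from m (preact \<theta> x) \<theta> l i" for l i
    by (induction m \<theta> x l i rule: layer.induct) (simp_all add: preact_def)
  then show ?thesis by (simp add: network_def network_from_def)
qed

lemma network_from_cong:
  assumes u: "\<And>i. i < m \<Longrightarrow> u i = u' i"
    and \<theta>: "\<And>p. p \<in> params L m \<Longrightarrow> (\<And>i j. p \<noteq> In i j) \<Longrightarrow> \<theta> p = \<theta>' p"
  shows "network_from L m u \<theta> = network_from L m u' \<theta>'"
proof -
  have "layer_from m u \<theta> l i = layer_from m u' \<theta>' l i" if "l \<le> L" "i < m" for l i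
    using that
  proof (induction l arbitrary: i rule: less_induct)
    case (less l)
    consider "l = 0" | "l = Suc 0" | l' where "l = Suc (Suc l')" by (metis old.nat.exhaust)
    then show ?case
    proof cases
      case 3
      have "\<theta> (Hid l i j) = \<theta>' (Hid l i j)" if "j < m" for j
        using that 3 less.prems by (intro \<theta>) (auto simp: params_def)
      then show ?thesis using 3 less by (auto intro!: sum.cong)
    qed (use u less.prems in auto)
  qed
  moreover have "\<theta> (Out j) = \<theta>' (Out j)" if "j < m" for j
    using that by (intro \<theta>) (auto simp: params_def)
  ultimately show ?thesis by (simp add: network_from_def)
qed

text \<open>For \<open>c \<noteq> 0\<close> the affine substitution is invertible, so the two
  functions are differentiable together. If they are not, \<open>deriv\<close> chooses among no
  candidates at all, and \<open>SOME D. False\<close> is that value, the same for every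
  function.\<close>

lemma deriv_comp_affine:
  fixes F :: "real \<Rightarrow> real"
  shows "deriv (\<lambda>w. F (a + (w - w0) * c)) w0 =
    (if c = 0 then 0 else if F field_differentiable at a then c * deriv F a else (SOME D. False))"
proof -
  consider "c = 0" | "c \<noteq> 0" "F field_differentiable at a" | "c \<noteq> 0" "\<not> F field_differentiable at a" by auto
  then show ?thesis
  proof cases
    case 2
    then have "(F has_field_derivative deriv F a) (at (a + (w0 - w0) * c))"
      by (simp add: field_differentiable_derivI)
    then have "((\<lambda>w. F (a + (w - w0) * c)) has_field_derivative deriv F a * c) (at w0)"
      by (rule DERIV_chain2) (auto intro!: derivative_eq_intros)
    then show ?thesis using 2 by (simp add: DERIV_imp_deriv mult.commute)
  next
    case 3
    have "\<not> ((\<lambda>w. F (a + (w - w0) * c)) has_field_derivative D) (at w0)" for D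
    proof
      assume "((\<lambda>w. F (a + (w - w0) * c)) has_field_derivative D) (at w0)"
      \<comment> \<open>Writing \<open>w0\<close> as the value at \<open>a\<close> of the inverse
        substitution lets the chain rule carry differentiability back to \<open>F\<close>.\<close>
      then have "((\<lambda>w. F (a + (w - w0) * c)) has_field_derivative D) (at (w0 + (a - a) / c))" by simp
      then have "((\<lambda>v. F (a + ((w0 + (v - a) / c) - w0) * c)) has_field_derivative D * (1 / c)) (at a)"
        by (rule DERIV_chain2) (use 3 in \<open>auto intro!: derivative_eq_intros\<close>)
      then have "(F has_field_derivative D * (1 / c)) (at a)" using 3 by simp
      then show False using 3 by (auto simp: field_differentiable_def)
    qed
    then show ?thesis using 3 by (simp add: deriv_def)
  qed simp
qed

lemma preact_upd_In:
  "preact (\<theta>(In i j := w)) x = (preact \<theta> x)(i := preact \<theta> x i + (w - \<theta> (In i j)) * vec_nth x j)"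
proof
  fix i'
  have "(\<Sum>j'\<in>UNIV. (\<theta>(In i j := w)) (In i j') * vec_nth x j') =
      (\<Sum>j'\<in>UNIV. \<theta> (In i j') * vec_nth x j' + (if j' = j then (w - \<theta> (In i j)) * vec_nth x j else 0))"
    by (intro sum.cong) (auto simp: algebra_simps)
  then show "preact (\<theta>(In i j := w)) x i' = ((preact \<theta> x)(i := preact \<theta> x i + (w - \<theta> (In i j)) * vec_nth x j)) i'"
    by (auto simp: preact_def sum.distrib)
qed

text \<open>At a point where the network is not differentiable, \<^const>\<open>deriv\<close> is a fixed junk value, so that
  the gradient is not exactly equivariant. This is the reason for the factor \<open>CARD('d)\<close>.\<close>

lemma empirical_ntk_le:
  fixes x x0 :: "real ^ 'd::finite"
  assumes x: "norm x = 1" and x0: "norm x0 = 1"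
    and pre: "\<And>i. i < m \<Longrightarrow> preact \<theta> x i = preact \<theta>' x0 i"
    and \<theta>: "\<And>p. p \<in> params L m \<Longrightarrow> (\<And>i j. p \<noteq> In i j) \<Longrightarrow> \<theta> p = \<theta>' p"
  shows "empirical_ntk L m \<theta> x x \<le> CARD('d) * empirical_ntk L m \<theta>' x0 x0"
proof -
  let ?J = "(SOME D. False) :: real"
  let ?F = "\<lambda>\<theta> x i v. network_from L m ((preact \<theta> x)(i := v)) \<theta>"
  have In: "gradient L m \<theta> x (In i j) = (if vec_nth x j = 0 then 0
      else if ?F \<theta> x i field_differentiable at (preact \<theta> x i) then vec_nth x j * deriv (?F \<theta> x i) (preact \<theta> x i) else ?J)"
    for \<theta> :: "'d param \<Rightarrow> real" and x i j
  proof -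
    have "network L m (\<theta>(In i j := w)) x = ?F \<theta> x i (preact \<theta> x i + (w - \<theta> (In i j)) * vec_nth x j)" for w
      unfolding network_eq_from preact_upd_In by (rule network_from_cong) auto
    then show ?thesis unfolding gradient_def by (simp only:) (rule deriv_comp_affine[where F="?F \<theta> x i"])
  qed
  have F_eq: "?F \<theta> x i = ?F \<theta>' x0 i" if "i < m" for i
    by (intro ext network_from_cong) (auto simp: pre intro: \<theta>)
  have sq: "(\<Sum>j\<in>UNIV. (vec_nth x j)\<^sup>2) = 1" if "norm x = 1" for x :: "real ^ 'd"
  proof -
    have "(norm x)\<^sup>2 = (\<Sum>j\<in>UNIV. (vec_nth x j)\<^sup>2)"
      unfolding power2_norm_eq_inner inner_vec_def by (simp add: power2_eq_square)
    then show ?thesis using that by simp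
  qed
  have In_le: "(\<Sum>j\<in>UNIV. (gradient L m \<theta> x (In i j))\<^sup>2) \<le> CARD('d) * (\<Sum>j\<in>UNIV. (gradient L m \<theta>' x0 (In i j))\<^sup>2)"
    if i: "i < m" for i
  proof (cases "?F \<theta>' x0 i field_differentiable at (preact \<theta>' x0 i)")
    case True
    let ?D = "deriv (?F \<theta>' x0 i) (preact \<theta>' x0 i)"
    have "gradient L m \<theta> x (In i j) = vec_nth x j * ?D" "gradient L m \<theta>' x0 (In i j) = vec_nth x0 j * ?D" for j
      using True unfolding In F_eq[OF i] pre[OF i] by simp_all
    then have "(\<Sum>j\<in>UNIV. (gradient L m \<theta> x (In i j))\<^sup>2) = ?D\<^sup>2" "(\<Sum>j\<in>UNIV. (gradient L m \<theta>' x0 (In i j))\<^sup>2) = ?D\<^sup>2"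
      by (simp_all add: power_mult_distrib sum_distrib_right[symmetric] sq[OF x] sq[OF x0])
    moreover have "1 * ?D\<^sup>2 \<le> CARD('d) * ?D\<^sup>2" by (intro mult_right_mono) (simp_all add: Suc_le_eq)
    ultimately show ?thesis by simp
  next
    case False
    then have g: "gradient L m \<theta> x (In i j) = (if vec_nth x j = 0 then 0 else ?J)"
        "gradient L m \<theta>' x0 (In i j) = (if vec_nth x0 j = 0 then 0 else ?J)" for j
      unfolding In F_eq[OF i] pre[OF i] by simp_all
    \<comment> \<open>One nonzero coordinate of \<open>x0\<close> supplies the square of the junk
      value at least once; on the side of \<open>x\<close> it occurs at most \<open>CARD('d)\<close>
      times.\<close>
    obtain j0 where j0: "vec_nth x0 j0 \<noteq> 0"
      using x0 by (metis norm_zero vec_eq_iff zero_index zero_neq_one)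
    have "(\<Sum>j\<in>UNIV. (gradient L m \<theta> x (In i j))\<^sup>2) \<le> (\<Sum>j\<in>(UNIV :: 'd set). ?J\<^sup>2)"
      by (intro sum_mono) (simp add: g)
    also have "\<dots> = CARD('d) * (gradient L m \<theta>' x0 (In i j0))\<^sup>2" using j0 by (simp add: g)
    also have "\<dots> \<le> CARD('d) * (\<Sum>j\<in>UNIV. (gradient L m \<theta>' x0 (In i j))\<^sup>2)"
      by (intro mult_left_mono member_le_sum) auto
    finally show ?thesis .
  qed
  have other: "gradient L m \<theta> x p = gradient L m \<theta>' x0 p" if p: "p \<in> params L m" "\<And>i j. p \<noteq> In i j" for p
  proof -
    have "preact (\<theta>(p := w)) x = preact \<theta> x" for \<theta> :: "'d param \<Rightarrow> real" and w x
    proof -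
      have "(\<theta>(p := w)) (In i j) = \<theta> (In i j)" for i j using p(2)[of i j] by auto
      then show ?thesis by (intro ext) (simp only: preact_def)
    qed
    then have "network L m (\<theta>(p := w)) x = network L m (\<theta>'(p := w)) x0" for w
      unfolding network_eq_from by (intro network_from_cong) (auto simp: pre \<theta>)
    then show ?thesis unfolding gradient_def by (simp add: \<theta>[OF p])
  qed
  define Q where "Q = {p \<in> params L m. \<forall>i j. p \<noteq> (In i j :: 'd param)}"
  have split: "(\<Sum>p\<in>params L m. g p) = (\<Sum>i<m. \<Sum>j\<in>UNIV. g (In i j)) + (\<Sum>p\<in>Q. g p)" for g :: "'d param \<Rightarrow> real"
  proof -
    have "params L m = (\<lambda>(i, j). In i j) ` ({..<m} \<times> UNIV) \<union> Q"
      by (auto simp: Q_def params_def image_iff)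
    then have "(\<Sum>p\<in>params L m. g p) = (\<Sum>p\<in>(\<lambda>(i, j). In i j) ` ({..<m} \<times> UNIV). g p) + (\<Sum>p\<in>Q. g p)"
      by (simp only:) (rule sum.union_disjoint, auto simp: Q_def intro: finite_subset[OF _ finite_params])
    also have "(\<Sum>p\<in>(\<lambda>(i, j). In i j) ` ({..<m} \<times> UNIV). g p) = (\<Sum>i<m. \<Sum>j\<in>UNIV. g (In i j))"
      by (subst sum.reindex) (auto simp: inj_on_def sum.cartesian_product comp_def case_prod_unfold)
    finally show ?thesis .
  qed
  have "(\<Sum>p\<in>params L m. (gradient L m \<theta> x p)\<^sup>2) \<le> (\<Sum>i<m. CARD('d) * (\<Sum>j\<in>UNIV. (gradient L m \<theta>' x0 (In i j))\<^sup>2))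
      + CARD('d) * (\<Sum>p\<in>Q. (gradient L m \<theta>' x0 p)\<^sup>2)"
  proof -
    have "(\<Sum>p\<in>Q. (gradient L m \<theta> x p)\<^sup>2) = 1 * (\<Sum>p\<in>Q. (gradient L m \<theta>' x0 p)\<^sup>2)"
      by (simp, rule sum.cong) (auto simp: Q_def other)
    also have "\<dots> \<le> CARD('d) * (\<Sum>p\<in>Q. (gradient L m \<theta>' x0 p)\<^sup>2)"
      by (intro mult_right_mono sum_nonneg) (simp_all add: Suc_le_eq)
    finally show ?thesis unfolding split by (intro add_mono sum_mono In_le) auto
  qed
  also have "\<dots> = CARD('d) * (\<Sum>p\<in>params L m. (gradient L m \<theta>' x0 p)\<^sup>2)"
    unfolding split by (simp add: sum_distrib_left distrib_left)
  finally have "(\<Sum>p\<in>params L m. (gradient L m \<theta> x p)\<^sup>2) / m \<le> CARD('d) * (\<Sum>p\<in>params L m. (gradient L m \<theta>' x0 p)\<^sup>2) / m"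
    by (rule divide_right_mono) simp
  then show ?thesis by (simp add: empirical_ntk_def power2_eq_square)
qed

text \<open>At a large width the empirical kernels at \<open>x\<close> and at a reference point
  \<open>x0\<close> are each close to their limits with probability above 1/2. A measure-preserving
  \<open>R\<close> turns the preactivations at \<open>x\<close> into those at \<open>x0\<close>, so
  some \<open>\<theta>\<close> is good for \<open>x\<close> while \<open>R \<theta>\<close> is good
  for \<open>x0\<close>, and the two empirical kernels can be compared. The width depends on
  \<open>x\<close>, the resulting bound does not.\<close>

lemma is_ntk_bounded:
  fixes X :: "(real ^ 'd::finite) set"
  assumes X: "X \<subseteq> sphere 0 1" and k: "is_ntk L X k"
  shows "\<exists>\<kappa>. \<forall>x\<in>X. k x x \<le> \<kappa>"
proof (cases "X = {}")
  case False
  then obtain x0 where x0: "x0 \<in> X" by auto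
  let ?G = "\<lambda>m x. {\<theta> \<in> space (init_weights L m). \<bar>empirical_ntk L m \<theta> x x - k x x\<bar> \<le> 1}"
  have "k x x \<le> CARD('d) * (k x0 x0 + 1) + 1" if x: "x \<in> X" for x
  proof -
    have lim: "(\<lambda>m. measure (init_weights L m) (?G m y)) \<longlonglongrightarrow> 1" if "y \<in> X" for y
      using k that unfolding is_ntk_def by (auto dest!: bspec[of _ _ y])
    have "\<forall>\<^sub>F m in sequentially. 1 / 2 < measure (init_weights L m) (?G m x) \<and> 1 / 2 < measure (init_weights L m) (?G m x0)"
      using order_tendstoD(1)[OF lim[OF x], of "1 / 2"] order_tendstoD(1)[OF lim[OF x0], of "1 / 2"]
      by (simp add: eventually_conj_iff)
    then obtain m where m: "1 / 2 < measure (init_weights L m) (?G m x)" "1 / 2 < measure (init_weights L m) (?G m x0)"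
      by (auto simp: eventually_sequentially)
    \<comment> \<open>\<open>measure\<close> vanishes on non-measurable sets, so a positive value
      already proves measurability.\<close>
    have "A \<in> sets M" if "1 / 2 < measure M A" for A and M :: "('d param \<Rightarrow> real) measure"
      using that measure_notin_sets[of A M] by fastforce
    with m have Gm: "?G m x \<in> sets (init_weights L m)" "?G m x0 \<in> sets (init_weights L m)" by blast+
    have n: "norm x = 1" "norm x0 = 1" using X x x0 by (auto simp: sphere_def)
    have "norm (wo_vec x) = norm (wo_vec x0)" using n by (simp add: norm_eq_sqrt_inner inner_wo_vec)
    then obtain f where f: "orthogonal_transformation f" and fx: "f (wo_vec x) = wo_vec x0"
      by (rule orthogonal_transformation_exists)
    obtain R where R[measurable]: "R \<in> init_weights L m \<rightarrow>\<^sub>M init_weights L m"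
      and Rd: "distr (init_weights L m) (init_weights L m) R = init_weights L m"
      and R1: "\<And>\<theta> p. (\<forall>i<m. \<forall>j. p \<noteq> In i j) \<Longrightarrow> p \<in> params L m \<Longrightarrow> R \<theta> p = \<theta> p"
      and R2: "\<And>\<theta> i. i < m \<Longrightarrow> (\<chi> j. R \<theta> (In i j)) = (\<chi> j. vec_nth (f (wo_vec (\<chi> j. \<theta> (In i j)))) (wo_abs j))"
      using rotate_first_layer[OF f order.refl, where L=L and m=m] by blast
    interpret prob_space "init_weights L m :: ('d param \<Rightarrow> real) measure"
      unfolding init_weights_def by (intro prob_space_PiM prob_space_std_normal)
    have "prob (?G m x0) = prob (R -` ?G m x0 \<inter> space (init_weights L m))"
      using measure_distr[OF R Gm(2)] Rd by simp
    \<comment> \<open>The two events have total probability above 1, so they cannot be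
      disjoint.\<close>
    then obtain \<theta> where \<theta>: "\<theta> \<in> ?G m x" "R \<theta> \<in> ?G m x0"
      using m finite_measure_Union[of "?G m x" "R -` ?G m x0 \<inter> space (init_weights L m)"] prob_le_1
        measurable_sets[OF R Gm(2)] Gm(1)
      by (smt (verit, del_insts) Int_iff disjoint_iff field_sum_of_halves vimage_eq)
    have pre: "preact \<theta> x i = preact (R \<theta>) x0 i" if "i < m" for i
    proof -
      have v: "preact \<theta> x i = inner (\<chi> j. \<theta> (In i j)) x" for \<theta> x
        by (simp add: preact_def inner_vec_def)
      have w: "wo_vec (\<chi> j. vec_nth y (wo_abs j)) = y" for y
        by (simp add: wo_vec_def vec_eq_iff)
      \<comment> \<open>The orthogonal map acts on both the row and the input, so it keeps their
        inner product.\<close>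
      have "preact (R \<theta>) x0 i = inner (f (wo_vec (\<chi> j. \<theta> (In i j)))) (f (wo_vec x))"
        unfolding v R2[OF that] by (subst inner_wo_vec[symmetric]) (simp add: w fx)
      then show ?thesis using f by (simp add: v orthogonal_transformation_def inner_wo_vec)
    qed
    have "empirical_ntk L m \<theta> x x \<le> CARD('d) * empirical_ntk L m (R \<theta>) x0 x0"
      using n by (intro empirical_ntk_le pre) (simp_all add: R1)
    also have "\<dots> \<le> CARD('d) * (k x0 x0 + 1)"
      using \<theta>(2) by (intro mult_left_mono) auto
    finally show ?thesis using \<theta>(1) by auto
  qed
  then show ?thesis by blast
qed simp


section \<open>Kernel regression and information gain\<close>

context rkhs
begin

definition feature :: "'x \<Rightarrow> 'x \<Rightarrow> real" where
  "feature x = (\<lambda>y. if y \<in> X then k x y else 0)"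

lemma feature_mem: "x \<in> X \<Longrightarrow> feature x \<in> H"
  unfolding feature_def by (rule kernel_mem)

lemma ip_feature: "f \<in> H \<Longrightarrow> x \<in> X \<Longrightarrow> ip f (feature x) = f x"
  unfolding feature_def by (rule reproducing)

lemma ip_zero: "g \<in> H \<Longrightarrow> ip (\<lambda>_. 0) g = 0"
  using ip_scale[OF zero_mem, of g 0] by simp

lemma ip_nonneg: "f \<in> H \<Longrightarrow> 0 \<le> ip f f"
  using ip_pos[of f] ip_zero[OF zero_mem] by (cases "f = (\<lambda>_. 0)") auto

lemma sum_mem:
  assumes "finite I" "\<And>i. i \<in> I \<Longrightarrow> F i \<in> H"
  shows "(\<lambda>x. \<Sum>i\<in>I. c i * F i x) \<in> H"
  using assms
proof (induction I rule: finite_induct)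
  case (insert i I)
  then have "(\<lambda>x. c i * F i x + (\<Sum>i\<in>I. c i * F i x)) \<in> H"
    by (intro add_mem[OF scale_mem]) auto
  then show ?case using insert.hyps by simp
qed (simp add: zero_mem)

lemma ip_sum:
  assumes "finite I" "\<And>i. i \<in> I \<Longrightarrow> F i \<in> H" "g \<in> H"
  shows "ip (\<lambda>x. \<Sum>i\<in>I. c i * F i x) g = (\<Sum>i\<in>I. c i * ip (F i) g)"
  using assms
proof (induction I rule: finite_induct)
  case (insert i I)
  have "ip (\<lambda>x. c i * F i x + (\<Sum>i\<in>I. c i * F i x)) g = ip (\<lambda>x. c i * F i x) g + ip (\<lambda>x. \<Sum>i\<in>I. c i * F i x) g"
    using insert by (intro ip_add scale_mem sum_mem) auto
  also have "ip (\<lambda>x. c i * F i x) g = c i * ip (F i) g"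
    using insert by (intro ip_scale) auto
  finally show ?case using insert by simp
qed (simp add: ip_zero)

lemma ip_cauchy_schwarz:
  assumes f: "f \<in> H" and g: "g \<in> H"
  shows "(ip f g)\<^sup>2 \<le> ip f f * ip g g"
proof (cases "g = (\<lambda>_. 0)")
  case True
  have "ip f (\<lambda>_. 0) = 0" using ip_commute[OF f zero_mem] ip_zero[OF f] by simp
  then show ?thesis unfolding True by (simp add: ip_zero[OF zero_mem])
next
  case False
  then have pos: "0 < ip g g" by (rule ip_pos[OF g])
  \<comment> \<open>The coefficient that makes \<open>?h\<close> orthogonal to
    \<open>g\<close>.\<close>
  define t where "t = - (ip f g / ip g g)"
  let ?h = "\<lambda>x. f x + t * g x"
  have tg: "(\<lambda>x. t * g x) \<in> H" using g by (rule scale_mem)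
  have h: "?h \<in> H" using f tg by (rule add_mem)
  have hf: "ip ?h f = ip f f + t * ip f g"
    using ip_add[OF f tg f] ip_scale[OF g f] ip_commute[OF f g] by simp
  have hg: "ip ?h g = 0"
    using ip_add[OF f tg g] ip_scale[OF g g, of t] pos by (simp add: t_def)
  have "ip ?h ?h = ip f ?h + t * ip g ?h"
    using ip_add[OF f tg h] ip_scale[OF g h] by simp
  then have "ip ?h ?h = ip f f + t * ip f g"
    using hf hg ip_commute[OF f h] ip_commute[OF g h] by simp
  then have "0 \<le> ip f f - (ip f g)\<^sup>2 / ip g g"
    using ip_nonneg[OF h] by (simp add: t_def power2_eq_square)
  then show ?thesis using pos by (simp add: field_simps)
qed

lemma k_commute: "x \<in> X \<Longrightarrow> y \<in> X \<Longrightarrow> k x y = k y x"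
  using ip_feature[of "feature x" y] ip_feature[of "feature y" x] ip_commute[of "feature x" "feature y"]
  by (simp add: feature_mem) (simp add: feature_def)

lemma feature_apply: "y \<in> X \<Longrightarrow> feature x y = k x y"
  by (simp add: feature_def)

lemma k_psd:
  assumes "finite I" "\<And>i. i \<in> I \<Longrightarrow> x i \<in> X"
  shows "0 \<le> (\<Sum>i\<in>I. \<Sum>j\<in>I. c i * c j * k (x i) (x j))"
proof -
  let ?g = "\<lambda>y. \<Sum>i\<in>I. c i * feature (x i) y"
  have g: "?g \<in> H" using assms by (intro sum_mem feature_mem) auto
  have "ip ?g ?g = (\<Sum>i\<in>I. c i * ip (feature (x i)) ?g)"
    using assms g by (intro ip_sum feature_mem) auto
  also have "\<dots> = (\<Sum>i\<in>I. c i * (\<Sum>j\<in>I. c j * k (x i) (x j)))"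
  proof (intro sum.cong refl arg_cong2[where f="(*)"])
    fix i assume i: "i \<in> I"
    have "ip (feature (x i)) ?g = ?g (x i)"
      using assms g i by (subst ip_commute) (auto intro: feature_mem ip_feature)
    also have "\<dots> = (\<Sum>j\<in>I. c j * k (x i) (x j))"
      using assms i by (intro sum.cong) (auto simp: feature_apply k_commute)
    finally show "ip (feature (x i)) ?g = (\<Sum>j\<in>I. c j * k (x i) (x j))" .
  qed
  also have "\<dots> = (\<Sum>i\<in>I. \<Sum>j\<in>I. c i * c j * k (x i) (x j))"
    by (simp add: sum_distrib_left mult.assoc)
  finally show ?thesis using ip_nonneg[OF g] by simp
qed

lemma k_nonneg: "x \<in> X \<Longrightarrow> 0 \<le> k x x"
  using k_psd[of "{0 :: nat}" "\<lambda>_. x" "\<lambda>_. 1"] by simp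

lemma abs_eval_le:
  assumes "f \<in> H" "x \<in> X"
  shows "\<bar>f x\<bar> \<le> sqrt (ip f f) * sqrt (k x x)"
proof -
  have "(f x)\<^sup>2 \<le> ip f f * k x x"
    using ip_cauchy_schwarz[OF assms(1) feature_mem[OF assms(2)]]
      ip_feature[OF assms] ip_feature[OF feature_mem[OF assms(2)] assms(2)] feature_apply[OF assms(2)] by simp
  then show ?thesis by (metis real_sqrt_abs real_sqrt_le_mono real_sqrt_mult)
qed

text \<open>The long factor is the squared norm of the feature of \<open>u\<close> minus the
  combination of the features of the \<open>x i\<close> with coefficients \<open>c\<close>; pairing
  \<open>f\<close> with that residual gives the error on the left. The bounds are then
  Cauchy-Schwarz and positivity.\<close>

lemma interpolation_error:
  assumes I: "finite I" "\<And>i. i \<in> I \<Longrightarrow> x i \<in> X" and u: "u \<in> X" and f: "f \<in> H"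
  shows "(f u - (\<Sum>i\<in>I. c i * f (x i)))\<^sup>2 \<le>
      ip f f * (k u u - 2 * (\<Sum>i\<in>I. c i * k (x i) u) + (\<Sum>i\<in>I. \<Sum>j\<in>I. c i * c j * k (x i) (x j)))"
    and "0 \<le> k u u - 2 * (\<Sum>i\<in>I. c i * k (x i) u) + (\<Sum>i\<in>I. \<Sum>j\<in>I. c i * c j * k (x i) (x j))"
proof -
  let ?g = "\<lambda>y. \<Sum>i\<in>I. - c i * feature (x i) y"
  let ?r = "\<lambda>y. feature u y + ?g y"
  have g: "?g \<in> H" using I by (intro sum_mem feature_mem) auto
  have r: "?r \<in> H" using g u by (intro add_mem feature_mem)
  have ipr: "ip h ?r = h u - (\<Sum>i\<in>I. c i * h (x i))" if h: "h \<in> H" for h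
  proof -
    have "ip h ?r = ip (feature u) h + ip ?g h"
      using h r g u by (subst ip_commute) (auto intro: ip_add feature_mem)
    also have "ip (feature u) h = h u" using h u by (subst ip_commute) (auto intro: feature_mem ip_feature)
    also have "ip ?g h = (\<Sum>i\<in>I. - c i * ip (feature (x i)) h)"
      using I h by (intro ip_sum feature_mem) auto
    also have "\<dots> = (\<Sum>i\<in>I. - c i * h (x i))"
      using I h by (intro sum.cong refl) (subst ip_commute, auto intro: feature_mem simp: ip_feature)
    finally show ?thesis by (simp add: sum_negf)
  qed
  have rr: "ip ?r ?r = k u u - 2 * (\<Sum>i\<in>I. c i * k (x i) u) + (\<Sum>i\<in>I. \<Sum>j\<in>I. c i * c j * k (x i) (x j))"
  proof -
    have ru: "?r u = k u u - (\<Sum>i\<in>I. c i * k (x i) u)"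
      using u by (simp add: feature_apply sum_negf)
    have rx: "?r (x i) = k (x i) u - (\<Sum>j\<in>I. c j * k (x i) (x j))" if "i \<in> I" for i
    proof -
      have "(\<Sum>j\<in>I. c j * k (x j) (x i)) = (\<Sum>j\<in>I. c j * k (x i) (x j))"
        using that I by (intro sum.cong) (auto simp: k_commute)
      then show ?thesis using u I that by (simp add: feature_apply sum_negf k_commute[of u])
    qed
    have "(\<Sum>i\<in>I. c i * ?r (x i)) = (\<Sum>i\<in>I. c i * k (x i) u) - (\<Sum>i\<in>I. \<Sum>j\<in>I. c i * c j * k (x i) (x j))"
    proof -
      have "(\<Sum>i\<in>I. c i * ?r (x i)) = (\<Sum>i\<in>I. c i * (k (x i) u - (\<Sum>j\<in>I. c j * k (x i) (x j))))"
        by (intro sum.cong refl) (simp only: rx)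
      then show ?thesis by (simp add: right_diff_distrib sum_subtractf sum_distrib_left mult.assoc)
    qed
    then show ?thesis unfolding ipr[OF r] ru by linarith
  qed
  show "(f u - (\<Sum>i\<in>I. c i * f (x i)))\<^sup>2 \<le>
      ip f f * (k u u - 2 * (\<Sum>i\<in>I. c i * k (x i) u) + (\<Sum>i\<in>I. \<Sum>j\<in>I. c i * c j * k (x i) (x j)))"
    using ip_cauchy_schwarz[OF f r] unfolding ipr[OF f] rr .
  show "0 \<le> k u u - 2 * (\<Sum>i\<in>I. c i * k (x i) u) + (\<Sum>i\<in>I. \<Sum>j\<in>I. c i * c j * k (x i) (x j))"
    using ip_nonneg[OF r] unfolding rr .
qed

text \<open>\<open>reg_inverse\<close> is \<open>the\<close> of an option, so the inversion must be
  shown to succeed: the kernel matrix is positive semidefinite, hence the added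
  \<open>\<sigma>\<^sup>2\<close> forces any null vector of \<open>A\<close> to be 0.\<close>

lemma reg_inverse_props:
  assumes \<psi>: "finite \<psi>" "\<And>i. i \<in> \<psi> \<Longrightarrow> x i \<in> X" and \<sigma>: "\<sigma> > 0"
  defines "A \<equiv> kernel_mat k x \<psi> + \<sigma>\<^sup>2 \<cdot>\<^sub>m 1\<^sub>m (card \<psi>)"
  shows "A * reg_inverse k \<sigma> x \<psi> = 1\<^sub>m (card \<psi>)" "reg_inverse k \<sigma> x \<psi> \<in> carrier_mat (card \<psi>) (card \<psi>)"
    "transpose_mat A = A"
proof -
  let ?n = "card \<psi>" and ?l = "sorted_list_of_set \<psi>"
  have A: "A \<in> carrier_mat ?n ?n" by (simp add: A_def kernel_mat_def Let_def)
  have l: "x (?l ! p) \<in> X" if "p < ?n" for p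
    using \<psi> that by (metis length_sorted_list_of_set nth_mem set_sorted_list_of_set)
  have Apq: "A $$ (p, q) = k (x (?l ! p)) (x (?l ! q)) + (if p = q then \<sigma>\<^sup>2 else 0)" if "p < ?n" "q < ?n" for p q
    using that by (simp add: A_def kernel_mat_def Let_def)
  show "transpose_mat A = A"
    using A by (intro eq_matI) (auto simp: Apq k_commute l)
  have "Determinant.det A \<noteq> 0"
  proof
    assume "Determinant.det A = 0"
    then obtain v where v: "v \<in> carrier_vec ?n" "v \<noteq> 0\<^sub>v ?n" "A *\<^sub>v v = 0\<^sub>v ?n"
      using det_0_iff_vec_prod_zero[OF A] by blast
    have Av: "vec_index (A *\<^sub>v v) p = (\<Sum>q<?n. A $$ (p, q) * vec_index v q)" if "p < ?n" for p
      using v(1) A that by (auto simp: scalar_prod_def atLeast0LessThan intro!: sum.cong)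
    have "0 = (\<Sum>p<?n. vec_index v p * vec_index (A *\<^sub>v v) p)"
      unfolding v(3) by simp
    also have "\<dots> = (\<Sum>p<?n. vec_index v p * (\<Sum>q<?n. A $$ (p, q) * vec_index v q))"
      by (intro sum.cong refl) (simp only: Av lessThan_iff)
    also have "\<dots> = (\<Sum>p<?n. \<Sum>q<?n. vec_index v p * vec_index v q * k (x (?l ! p)) (x (?l ! q)) + (if p = q then \<sigma>\<^sup>2 * (vec_index v p)\<^sup>2 else 0))"
      unfolding sum_distrib_left by (intro sum.cong refl) (simp add: Apq algebra_simps power2_eq_square)
    also have "\<dots> = (\<Sum>p<?n. \<Sum>q<?n. vec_index v p * vec_index v q * k (x (?l ! p)) (x (?l ! q))) + \<sigma>\<^sup>2 * (\<Sum>p<?n. (vec_index v p)\<^sup>2)"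
      by (simp add: sum.distrib sum_distrib_left)
    finally have "\<sigma>\<^sup>2 * (\<Sum>p<?n. (vec_index v p)\<^sup>2) \<le> 0"
      using k_psd[of "{..<?n}" "\<lambda>p. x (?l ! p)" "\<lambda>p. vec_index v p"] l by auto
    then have "(\<Sum>p<?n. (vec_index v p)\<^sup>2) \<le> 0" using \<sigma> by (simp add: mult_le_0_iff)
    then have "\<forall>p<?n. vec_index v p = 0"
    proof (intro allI impI)
      fix p assume p: "p < ?n"
      then have "(vec_index v p)\<^sup>2 \<le> (\<Sum>p<?n. (vec_index v p)\<^sup>2)" by (intro member_le_sum) auto
      with \<open>(\<Sum>p<?n. (vec_index v p)\<^sup>2) \<le> 0\<close> show "vec_index v p = 0"
        by (metis order_trans power2_less_eq_zero_iff)
    qed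
    then show False using v by (metis carrier_vecD eq_vecI index_zero_vec)
  qed
  then have "A \<in> Units (ring_mat TYPE(real) ?n ())" by (rule det_non_zero_imp_unit[OF A])
  then obtain B where B: "mat_inverse A = Some B" using mat_inverse(1)[OF A, where b="()"] by (cases "mat_inverse A") auto
  then show "A * reg_inverse k \<sigma> x \<psi> = 1\<^sub>m ?n" "reg_inverse k \<sigma> x \<psi> \<in> carrier_mat ?n ?n"
    using mat_inverse(2)[OF A B] by (simp_all add: reg_inverse_def A_def[symmetric])
qed

text \<open>Passes from matrices to sums. By symmetry the inverse can be moved onto the kernel
  vector; the weights are the solution of the regularized linear system, and the same weights serve
  for every reward sequence.\<close>

lemma posterior_weights:
  assumes \<psi>: "finite \<psi>" "\<And>i. i \<in> \<psi> \<Longrightarrow> x i \<in> X" and \<sigma>: "\<sigma> > 0"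
  obtains c where "\<And>i. i \<in> \<psi> \<Longrightarrow> (\<Sum>j\<in>\<psi>. k (x i) (x j) * c j) + \<sigma>\<^sup>2 * c i = k (x i) u"
    and "\<And>y. post_mean k \<sigma> x y \<psi> u = (\<Sum>i\<in>\<psi>. c i * y i)"
    and "post_sd k \<sigma> x \<psi> u = sqrt (k u u - (\<Sum>i\<in>\<psi>. c i * k (x i) u))"
proof -
  let ?n = "card \<psi>" and ?l = "sorted_list_of_set \<psi>" and ?B = "reg_inverse k \<sigma> x \<psi>"
  let ?kv = "kernel_vec k x \<psi> u"
  define A where "A = kernel_mat k x \<psi> + \<sigma>\<^sup>2 \<cdot>\<^sub>m 1\<^sub>m ?n"
  have A: "A \<in> carrier_mat ?n ?n" by (simp add: A_def kernel_mat_def Let_def)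
  note B = reg_inverse_props[where x=x, OF \<psi> \<sigma>, folded A_def]
  have kv: "?kv \<in> carrier_vec ?n" by (simp add: kernel_vec_def Let_def)
  define cv where "cv = ?B *\<^sub>v ?kv"
  have cv: "cv \<in> carrier_vec ?n" using B(2) kv by (simp add: cv_def)
  have Acv: "A *\<^sub>v cv = ?kv"
    unfolding cv_def using A B kv by (simp flip: assoc_mult_mat_vec)
  have inner_eq: "scalar_prod ?kv (?B *\<^sub>v w) = scalar_prod cv w" if w: "w \<in> carrier_vec ?n" for w
  proof -
    have Bw: "?B *\<^sub>v w \<in> carrier_vec ?n" using B(2) w by simp
    have "scalar_prod ?kv (?B *\<^sub>v w) = scalar_prod (transpose_mat A *\<^sub>v cv) (?B *\<^sub>v w)"
      by (simp add: Acv B(3))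
    also have "\<dots> = scalar_prod cv (A *\<^sub>v (?B *\<^sub>v w))"
      using transpose_vec_mult_scalar[OF A Bw cv] by simp
    also have "A *\<^sub>v (?B *\<^sub>v w) = w" using A B w by (simp flip: assoc_mult_mat_vec)
    finally show ?thesis .
  qed
  have bij: "bij_betw ((!) ?l) {..<?n} \<psi>"
    using \<psi>(1) by (intro bij_betw_nth) auto
  define c where "c i = vec_index cv (inv_into {..<?n} ((!) ?l) i)" for i
  have c_nth: "c (?l ! p) = vec_index cv p" if "p < ?n" for p
    using that bij by (simp add: c_def bij_betw_inv_into_left)
  have sum_eq: "(\<Sum>i\<in>\<psi>. g i) = (\<Sum>p<?n. g (?l ! p))" for g :: "nat \<Rightarrow> real"
    using sum.reindex_bij_betw[OF bij, of g] by simp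
  show ?thesis
  proof
    fix i assume "i \<in> \<psi>"
    then obtain p where p: "p < ?n" "i = ?l ! p"
      using bij by (auto simp: bij_betw_def)
    have "vec_index (A *\<^sub>v cv) p = (\<Sum>q<?n. A $$ (p, q) * vec_index cv q)"
      using p A cv by (auto simp: scalar_prod_def atLeast0LessThan intro!: sum.cong)
    also have "\<dots> = (\<Sum>q<?n. k (x i) (x (?l ! q)) * vec_index cv q + (if p = q then \<sigma>\<^sup>2 * vec_index cv q else 0))"
      using p by (intro sum.cong) (auto simp: A_def kernel_mat_def Let_def algebra_simps)
    also have "\<dots> = (\<Sum>q<?n. k (x i) (x (?l ! q)) * vec_index cv q) + \<sigma>\<^sup>2 * vec_index cv p"
      using p by (simp add: sum.distrib)
    finally show "(\<Sum>j\<in>\<psi>. k (x i) (x j) * c j) + \<sigma>\<^sup>2 * c i = k (x i) u"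
      unfolding Acv sum_eq using p by (simp add: c_nth kernel_vec_def Let_def)
  next
    fix y
    have "post_mean k \<sigma> x y \<psi> u = scalar_prod cv (reward_vec y \<psi>)"
      unfolding post_mean_def by (rule inner_eq) (simp add: reward_vec_def Let_def)
    then show "post_mean k \<sigma> x y \<psi> u = (\<Sum>i\<in>\<psi>. c i * y i)"
      unfolding sum_eq by (simp add: scalar_prod_def reward_vec_def Let_def c_nth atLeast0LessThan)
  next
    have "scalar_prod ?kv (?B *\<^sub>v ?kv) = (\<Sum>i\<in>\<psi>. c i * k (x i) u)"
      unfolding inner_eq[OF kv] sum_eq by (simp add: scalar_prod_def kernel_vec_def Let_def c_nth atLeast0LessThan)
    then show "post_sd k \<sigma> x \<psi> u = sqrt (k u u - (\<Sum>i\<in>\<psi>. c i * k (x i) u))"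
      by (simp add: post_sd_def)
  qed
qed

text \<open>Everything follows from one identity: for these weights the squared norm of the
  interpolation residual is the posterior variance minus \<open>\<sigma>\<^sup>2\<close> times the
  squared norm of \<open>c\<close>. Its nonnegativity bounds the weights and shows that the radicand
  in \<open>post_sd\<close> is not negative; Cauchy-Schwarz bounds the bias of the noise-free
  mean.\<close>

lemma posterior_bounds:
  assumes \<psi>: "finite \<psi>" "\<And>i. i \<in> \<psi> \<Longrightarrow> x i \<in> X" and \<sigma>: "\<sigma> > 0" and u: "u \<in> X"
  obtains c where "\<And>i. i \<in> \<psi> \<Longrightarrow> (\<Sum>j\<in>\<psi>. k (x i) (x j) * c j) + \<sigma>\<^sup>2 * c i = k (x i) u"
    and "\<And>y. post_mean k \<sigma> x y \<psi> u = (\<Sum>i\<in>\<psi>. c i * y i)"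
    and "(post_sd k \<sigma> x \<psi> u)\<^sup>2 = k u u - (\<Sum>i\<in>\<psi>. c i * k (x i) u)"
    and "\<sigma>\<^sup>2 * (\<Sum>i\<in>\<psi>. (c i)\<^sup>2) \<le> (post_sd k \<sigma> x \<psi> u)\<^sup>2"
    and "0 \<le> post_sd k \<sigma> x \<psi> u" and "(post_sd k \<sigma> x \<psi> u)\<^sup>2 \<le> k u u"
    and "\<And>f. f \<in> H \<Longrightarrow> \<bar>f u - (\<Sum>i\<in>\<psi>. c i * f (x i))\<bar> \<le> sqrt (ip f f) * post_sd k \<sigma> x \<psi> u"
proof -
  obtain c where c1: "\<And>i. i \<in> \<psi> \<Longrightarrow> (\<Sum>j\<in>\<psi>. k (x i) (x j) * c j) + \<sigma>\<^sup>2 * c i = k (x i) u"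
    and c2: "\<And>y. post_mean k \<sigma> x y \<psi> u = (\<Sum>i\<in>\<psi>. c i * y i)"
    and c3: "post_sd k \<sigma> x \<psi> u = sqrt (k u u - (\<Sum>i\<in>\<psi>. c i * k (x i) u))"
    using posterior_weights[where x=x and u=u, OF \<psi> \<sigma>] by blast
  let ?v = "k u u - (\<Sum>i\<in>\<psi>. c i * k (x i) u)"
  \<comment> \<open>The linear system, multiplied by \<open>c i\<close> and summed.\<close>
  have q: "(\<Sum>i\<in>\<psi>. \<Sum>j\<in>\<psi>. c i * c j * k (x i) (x j)) = (\<Sum>i\<in>\<psi>. c i * k (x i) u) - \<sigma>\<^sup>2 * (\<Sum>i\<in>\<psi>. (c i)\<^sup>2)"
  proof -
    have "(\<Sum>i\<in>\<psi>. c i * k (x i) u) = (\<Sum>i\<in>\<psi>. c i * ((\<Sum>j\<in>\<psi>. k (x i) (x j) * c j) + \<sigma>\<^sup>2 * c i))"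
      by (intro sum.cong) (simp_all add: c1)
    then show ?thesis
      by (simp add: distrib_left sum.distrib sum_distrib_left power2_eq_square mult_ac)
  qed
  have e: "k u u - 2 * (\<Sum>i\<in>\<psi>. c i * k (x i) u) + (\<Sum>i\<in>\<psi>. \<Sum>j\<in>\<psi>. c i * c j * k (x i) (x j)) =
      ?v - \<sigma>\<^sup>2 * (\<Sum>i\<in>\<psi>. (c i)\<^sup>2)" unfolding q by simp
  have s: "0 \<le> \<sigma>\<^sup>2 * (\<Sum>i\<in>\<psi>. (c i)\<^sup>2)" by (simp add: sum_nonneg)
  have v: "\<sigma>\<^sup>2 * (\<Sum>i\<in>\<psi>. (c i)\<^sup>2) \<le> ?v"
    using interpolation_error(2)[where x=x and c=c, OF \<psi> u zero_mem] unfolding e by simp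
  then have v0: "0 \<le> ?v" using s by simp
  have sd: "(post_sd k \<sigma> x \<psi> u)\<^sup>2 = ?v" unfolding c3 using v0 by simp
  show ?thesis
  proof (rule that[OF c1 c2 sd])
    show "\<sigma>\<^sup>2 * (\<Sum>i\<in>\<psi>. (c i)\<^sup>2) \<le> (post_sd k \<sigma> x \<psi> u)\<^sup>2" unfolding sd by (rule v)
    show "0 \<le> post_sd k \<sigma> x \<psi> u" unfolding c3 using v0 by simp
    show "(post_sd k \<sigma> x \<psi> u)\<^sup>2 \<le> k u u"
      unfolding sd using k_psd[where x=x and c=c, OF \<psi>] s unfolding q by simp
    fix f assume f: "f \<in> H"
    have "(f u - (\<Sum>i\<in>\<psi>. c i * f (x i)))\<^sup>2 \<le> ip f f * (?v - \<sigma>\<^sup>2 * (\<Sum>i\<in>\<psi>. (c i)\<^sup>2))"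
      using interpolation_error(1)[where x=x and c=c, OF \<psi> u f] unfolding e .
    also have "\<dots> \<le> ip f f * ?v" using s ip_nonneg[OF f] by (intro mult_left_mono) auto
    finally have "\<bar>f u - (\<Sum>i\<in>\<psi>. c i * f (x i))\<bar> \<le> sqrt (ip f f * ?v)"
      by (metis real_sqrt_abs real_sqrt_le_mono)
    then show "\<bar>f u - (\<Sum>i\<in>\<psi>. c i * f (x i))\<bar> \<le> sqrt (ip f f) * post_sd k \<sigma> x \<psi> u"
      by (simp add: c3 real_sqrt_mult)
  qed simp_all
qed

end

text \<open>The Schur complement of the last diagonal entry, by column operations.\<close>

lemma det_bordered:
  fixes K :: "nat \<Rightarrow> nat \<Rightarrow> real"
  assumes sol: "\<And>i. i < n \<Longrightarrow> (\<Sum>j<n. K i j * c j) = K i n"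
  shows "Determinant.det (Matrix.mat (Suc n) (Suc n) (\<lambda>(i, j). K i j)) =
    Determinant.det (Matrix.mat n n (\<lambda>(i, j). K i j)) * (K n n - (\<Sum>j<n. K n j * c j))"
proof -
  let ?M = "Matrix.mat n n (\<lambda>(i, j). K i j)" and ?M' = "Matrix.mat (Suc n) (Suc n) (\<lambda>(i, j). K i j)"
  let ?C = "four_block_mat (1\<^sub>m n) (Matrix.mat n 1 (\<lambda>(i, j). - c i)) (0\<^sub>m 1 n) (1\<^sub>m 1)"
  let ?D = "four_block_mat ?M (0\<^sub>m n 1) (Matrix.mat 1 n (\<lambda>(i, j). K n j)) (Matrix.mat 1 1 (\<lambda>_. K n n - (\<Sum>j<n. K n j * c j)))"
  define C where "C = ?C"
  define D where "D = ?D"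
  have C: "C \<in> carrier_mat (Suc n) (Suc n)" and D: "D \<in> carrier_mat (Suc n) (Suc n)"
    by (auto simp: C_def D_def)
  have M': "?M' \<in> carrier_mat (Suc n) (Suc n)" by simp
  have C_nth: "C $$ (i, j) = (if j < n then (if i = j then 1 else 0) else if i < n then - c i else 1)"
    if "i < Suc n" "j < Suc n" for i j
    using that by (auto simp: C_def less_Suc_eq)
  have D_nth: "D $$ (i, j) = (if j < n then K i j else if i < n then 0 else K n n - (\<Sum>j<n. K n j * c j))"
    if "i < Suc n" "j < Suc n" for i j
    using that by (auto simp: D_def less_Suc_eq)
  have "?M' * C = D"
  proof (rule eq_matI)
    fix i j assume "i < dim_row D" "j < dim_col D"
    then have ij: "i < Suc n" "j < Suc n" using D by auto
    have "(?M' * C) $$ (i, j) = (\<Sum>l<Suc n. K i l * C $$ (l, j))"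
      using ij C by (simp add: scalar_prod_def atLeast0LessThan)
    also have "\<dots> = (\<Sum>l<n. K i l * C $$ (l, j)) + K i n * C $$ (n, j)" by simp
    also have "\<dots> = D $$ (i, j)"
    proof (cases "j < n")
      case True
      have "(\<Sum>l<n. K i l * C $$ (l, j)) = (\<Sum>l<n. if l = j then K i l else 0)"
        using True by (intro sum.cong) (auto simp: C_nth)
      then show ?thesis using True ij by (simp add: C_nth D_nth)
    next
      case False
      have "(\<Sum>l<n. K i l * C $$ (l, j)) = - (\<Sum>l<n. K i l * c l)"
        using False ij by (simp add: sum_negf[symmetric] C_nth)
      moreover have "i < n \<or> i = n" using ij by auto
      ultimately show ?thesis using False ij sol[of i] by (elim disjE) (simp_all add: C_nth D_nth)
    qed
    finally show "(?M' * C) $$ (i, j) = D $$ (i, j)" .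
  qed (use C D in auto)
  then have "Determinant.det ?M' * Determinant.det C = Determinant.det D"
    using det_mult[OF M' C] by simp
  moreover have "Determinant.det C = 1"
    unfolding C_def by (subst det_four_block_mat_lower_left_zero[where n=n and m=1]) auto
  moreover have "Determinant.det D = Determinant.det ?M * (K n n - (\<Sum>j<n. K n j * c j))"
    unfolding D_def by (subst det_four_block_mat_upper_right_zero[where n=n and m=1]) (auto simp: det_single)
  ultimately show ?thesis by simp
qed

lemma kernel_mat_list:
  "kernel_mat k x \<psi> = (let ps = map x (sorted_list_of_set \<psi>) in
    Matrix.mat (length ps) (length ps) (\<lambda>(i, j). k (ps ! i) (ps ! j)))"
  by (auto simp: kernel_mat_def Let_def intro!: eq_matI)

lemma kernel_vec_list:
  "kernel_vec k x \<psi> u = (let ps = map x (sorted_list_of_set \<psi>) in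
    Matrix.vec (length ps) (\<lambda>i. k (ps ! i) u))"
  by (auto simp: kernel_vec_def Let_def intro!: eq_vecI)

text \<open>An index set enters only through the ordered list of its points, so rounds may be
  renumbered; this is how the rounds of a level become \<open>1, ..., n\<close>.\<close>

lemma post_sd_cong:
  assumes "map x (sorted_list_of_set \<psi>) = map x' (sorted_list_of_set \<psi>')"
  shows "post_sd k \<sigma> x \<psi> u = post_sd k \<sigma> x' \<psi>' u"
proof -
  have "card \<psi> = card \<psi>'" using arg_cong[OF assms, of length] by simp
  then show ?thesis
    using assms by (simp add: post_sd_def reg_inverse_def kernel_mat_list kernel_vec_list)
qed

section \<open>The chain rule for the determinant and the information gain\<close>

context rkhs
begin

text \<open>Induction on \<open>n\<close> by \<open>det_bordered\<close>: divided by
  \<open>\<sigma>\<^sup>2\<close>, the system for the weights of the new point is the bordering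
  system, and the Schur complement is one plus the rescaled variance. Points are numbered from 1 but
  matrix entries from 0, hence the \<open>Suc\<close> in \<open>?K\<close>.\<close>

lemma ln_det_kernel_mat:
  assumes x: "\<And>i. i \<in> {1..n} \<Longrightarrow> x i \<in> X" and \<sigma>: "\<sigma> > 0"
  shows "ln (Determinant.det (1\<^sub>m n + (1 / \<sigma>\<^sup>2) \<cdot>\<^sub>m kernel_mat k x {1..n})) =
      (\<Sum>j=1..n. ln (1 + (post_sd k \<sigma> x {1..<j} (x j))\<^sup>2 / \<sigma>\<^sup>2))"
proof -
  let ?K = "\<lambda>i j. (if i = j then 1 else 0) + k (x (Suc i)) (x (Suc j)) / \<sigma>\<^sup>2"
  have nth: "sorted_list_of_set {1..n} ! i = Suc i" if "i < n" for i n
    using that by (simp add: atLeastLessThanSuc_atLeastAtMost[symmetric] del: upt_Suc)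
  have M: "1\<^sub>m n + (1 / \<sigma>\<^sup>2) \<cdot>\<^sub>m kernel_mat k x {1..n} = Matrix.mat n n (\<lambda>(i, j). ?K i j)" for n
    by (rule eq_matI) (auto simp: kernel_mat_def Let_def nth[unfolded One_nat_def])
  have pos: "0 < 1 + (s :: real)\<^sup>2 / \<sigma>\<^sup>2" for s
    by (intro add_pos_nonneg) simp_all
  \<comment> \<open>Positivity of the determinant is carried through the induction, as the logarithm
    of the product needs it.\<close>
  have "ln (Determinant.det (Matrix.mat n n (\<lambda>(i, j). ?K i j))) =
      (\<Sum>j=1..n. ln (1 + (post_sd k \<sigma> x {1..<j} (x j))\<^sup>2 / \<sigma>\<^sup>2)) \<and> Determinant.det (Matrix.mat n n (\<lambda>(i, j). ?K i j)) > 0"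
    using x
  proof (induction n)
    case 0
    then show ?case by simp
  next
    case (Suc n)
    have xs: "\<And>i. i \<in> {1..<Suc n} \<Longrightarrow> x i \<in> X" and xn: "x (Suc n) \<in> X" using Suc.prems by auto
    obtain c where c: "\<And>i. i \<in> {1..<Suc n} \<Longrightarrow> (\<Sum>j\<in>{1..<Suc n}. k (x i) (x j) * c j) + \<sigma>\<^sup>2 * c i = k (x i) (x (Suc n))"
      and sd: "(post_sd k \<sigma> x {1..<Suc n} (x (Suc n)))\<^sup>2 = k (x (Suc n)) (x (Suc n)) - (\<Sum>i\<in>{1..<Suc n}. c i * k (x i) (x (Suc n)))"
      by (rule posterior_bounds[where x=x and \<psi>="{1..<Suc n}", OF finite_atLeastLessThan xs \<sigma> xn]) (assumption, rule that)
    have shift: "(\<Sum>j\<in>{1..<Suc n}. g j) = (\<Sum>j<n. g (Suc j))" for g :: "nat \<Rightarrow> real"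
      by (rule sum.reindex_bij_witness[of _ Suc "\<lambda>j. j - 1"]) auto
    have "Determinant.det (Matrix.mat (Suc n) (Suc n) (\<lambda>(i, j). ?K i j)) =
        Determinant.det (Matrix.mat n n (\<lambda>(i, j). ?K i j)) * (?K n n - (\<Sum>j<n. ?K n j * c (Suc j)))"
    proof (rule det_bordered)
      fix i assume i: "i < n"
      have "(\<Sum>j<n. ?K i j * c (Suc j)) = (\<Sum>j<n. (if i = j then c (Suc j) else 0) + k (x (Suc i)) (x (Suc j)) * c (Suc j) / \<sigma>\<^sup>2)"
        by (intro sum.cong) (auto simp: algebra_simps)
      also have "\<dots> = ((\<Sum>j<n. k (x (Suc i)) (x (Suc j)) * c (Suc j)) + \<sigma>\<^sup>2 * c (Suc i)) / \<sigma>\<^sup>2"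
        using i \<sigma> by (simp add: sum.distrib sum_divide_distrib add_divide_distrib)
      also have "\<dots> = ?K i n"
        using c[of "Suc i"] i unfolding shift by simp
      finally show "(\<Sum>j<n. ?K i j * c (Suc j)) = ?K i n" .
    qed
    also have "?K n n - (\<Sum>j<n. ?K n j * c (Suc j)) = 1 + (post_sd k \<sigma> x {1..<Suc n} (x (Suc n)))\<^sup>2 / \<sigma>\<^sup>2"
    proof -
      have "(\<Sum>j<n. ?K n j * c (Suc j)) = (\<Sum>j<n. c (Suc j) * k (x (Suc j)) (x (Suc n)) / \<sigma>\<^sup>2)"
        using xs xn by (intro sum.cong) (auto simp: k_commute)
      then show ?thesis
        unfolding sd shift by (simp add: sum_divide_distrib diff_divide_distrib)
    qed
    finally have d: "Determinant.det (Matrix.mat (Suc n) (Suc n) (\<lambda>(i, j). ?K i j)) =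
        Determinant.det (Matrix.mat n n (\<lambda>(i, j). ?K i j)) * (1 + (post_sd k \<sigma> x {1..<Suc n} (x (Suc n)))\<^sup>2 / \<sigma>\<^sup>2)" .
    have IH: "ln (Determinant.det (Matrix.mat n n (\<lambda>(i, j). ?K i j))) =
      (\<Sum>j=1..n. ln (1 + (post_sd k \<sigma> x {1..<j} (x j))\<^sup>2 / \<sigma>\<^sup>2))" "Determinant.det (Matrix.mat n n (\<lambda>(i, j). ?K i j)) > 0"
      using Suc by auto
    show ?case
      unfolding d using IH pos[of "post_sd k \<sigma> x {1..<Suc n} (x (Suc n))"]
      by (simp add: ln_mult_pos)
  qed
  then show ?thesis unfolding M by simp
qed

text \<open>The points of \<open>\<psi>\<close>, in increasing order of round, are padded with a
  point of \<open>X\<close> to a sequence of length \<open>T\<close>. The first terms of its chain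
  rule are the given ones, the others are nonnegative, and the sequence competes in the
  supremum.\<close>

lemma sum_ln_post_sd_le_info_gain:
  assumes \<sigma>: "\<sigma> > 0" and \<kappa>: "\<And>x. x \<in> X \<Longrightarrow> k x x \<le> \<kappa>" and X: "X \<noteq> {}"
    and \<psi>: "\<psi> \<subseteq> {1..T}" "\<And>i. i \<in> \<psi> \<Longrightarrow> x i \<in> X"
  shows "(\<Sum>t\<in>\<psi>. ln (1 + (post_sd k \<sigma> x (\<psi> \<inter> {..<t}) (x t))\<^sup>2 / \<sigma>\<^sup>2)) \<le> 2 * info_gain k \<sigma> X T"
proof -
  let ?S = "\<lambda>x. \<Sum>j=1..T. ln (1 + (post_sd k \<sigma> x {1..<j} (x j))\<^sup>2 / \<sigma>\<^sup>2)"
  have eq: "1 / 2 * ln (Determinant.det (1\<^sub>m T + (1 / \<sigma>\<^sup>2) \<cdot>\<^sub>m kernel_mat k x {1..T})) = 1 / 2 * ?S x"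
    if "x \<in> {1..T} \<rightarrow> X" for x
    using ln_det_kernel_mat[of T x \<sigma>] that \<sigma> by (auto simp: Pi_iff)
  \<comment> \<open>Makes the set of values bounded above, without which the supremum would say
    nothing.\<close>
  have S_le: "?S x \<le> T * ln (1 + \<kappa> / \<sigma>\<^sup>2)" if x: "x \<in> {1..T} \<rightarrow> X" for x
  proof -
    have "?S x \<le> (\<Sum>j=1..T. ln (1 + \<kappa> / \<sigma>\<^sup>2))"
    proof (rule sum_mono)
      fix j assume j: "j \<in> {1..T}"
      have xi: "\<And>i. i \<in> {1..<j} \<Longrightarrow> x i \<in> X" and xj: "x j \<in> X" using x j by auto
      have "(post_sd k \<sigma> x {1..<j} (x j))\<^sup>2 \<le> k (x j) (x j)"
        by (rule posterior_bounds[where x=x and \<psi>="{1..<j}", OF finite_atLeastLessThan xi \<sigma> xj])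
      also have "\<dots> \<le> \<kappa>" by (rule \<kappa>[OF xj])
      finally have "(post_sd k \<sigma> x {1..<j} (x j))\<^sup>2 / \<sigma>\<^sup>2 \<le> \<kappa> / \<sigma>\<^sup>2" by (simp add: divide_right_mono)
      moreover have "0 \<le> (post_sd k \<sigma> x {1..<j} (x j))\<^sup>2 / \<sigma>\<^sup>2" by simp
      ultimately show "ln (1 + (post_sd k \<sigma> x {1..<j} (x j))\<^sup>2 / \<sigma>\<^sup>2) \<le> ln (1 + \<kappa> / \<sigma>\<^sup>2)"
        by (intro ln_mono) linarith+
    qed
    then show ?thesis by simp
  qed
  let ?xs = "sorted_list_of_set \<psi>" and ?n = "card \<psi>"
  obtain x0 where x0: "x0 \<in> X" using X by auto
  define x' where "x' = (\<lambda>j. if 1 \<le> j \<and> j \<le> ?n then x (?xs ! (j - 1)) else x0)"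
  have fin: "finite \<psi>" using \<psi>(1) by (rule finite_subset) simp
  have nT: "?n \<le> T" using card_mono[OF _ \<psi>(1)] by simp
  have xs: "?xs ! p \<in> \<psi>" if "p < ?n" for p
    using that fin by (metis length_sorted_list_of_set nth_mem set_sorted_list_of_set)
  have x': "x' \<in> {1..T} \<rightarrow> X" by (auto simp: x'_def x0 intro!: \<psi>(2) xs)
  have bij: "bij_betw ((!) ?xs) {..<?n} \<psi>" using fin by (intro bij_betw_nth) auto
  have "(\<Sum>t\<in>\<psi>. ln (1 + (post_sd k \<sigma> x (\<psi> \<inter> {..<t}) (x t))\<^sup>2 / \<sigma>\<^sup>2)) =
      (\<Sum>p<?n. ln (1 + (post_sd k \<sigma> x (\<psi> \<inter> {..<?xs ! p}) (x (?xs ! p)))\<^sup>2 / \<sigma>\<^sup>2))"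
    by (rule sum.reindex_bij_betw[OF bij, symmetric])
  also have "\<dots> = (\<Sum>p<?n. ln (1 + (post_sd k \<sigma> x' {1..<Suc p} (x' (Suc p)))\<^sup>2 / \<sigma>\<^sup>2))"
  proof (rule sum.cong[OF refl])
    fix p assume "p \<in> {..<?n}"
    then have p: "p < ?n" by simp
    have sorted: "sorted_wrt (<) ?xs" by (rule strict_sorted_list_of_set)
    \<comment> \<open>The rounds of \<open>\<psi>\<close> before \<open>?xs ! p\<close> are the
      first \<open>p\<close> list entries, so both variances are conditioned on the same list of
      points.\<close>
    have "\<psi> \<inter> {..<?xs ! p} = set (take p ?xs)"
    proof (intro equalityI subsetI)
      fix t assume t: "t \<in> \<psi> \<inter> {..<?xs ! p}"
      then obtain q where q: "q < ?n" "t = ?xs ! q" using bij by (auto simp: bij_betw_def)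
      then have "q < p"
        using t p sorted_wrt_nth_less[OF sorted, of p q] by (cases "p = q") (auto simp: not_less le_eq_less_or_eq intro: ccontr)
      then show "t \<in> set (take p ?xs)" using q p by (auto simp: in_set_conv_nth intro!: exI[of _ q])
    next
      fix t assume "t \<in> set (take p ?xs)"
      then obtain q where "q < p" "t = ?xs ! q" using p by (auto simp: in_set_conv_nth)
      then show "t \<in> \<psi> \<inter> {..<?xs ! p}" using p sorted_wrt_nth_less[OF sorted, of q p] xs[of q] by auto
    qed
    then have "sorted_list_of_set (\<psi> \<inter> {..<?xs ! p}) = take p ?xs"
      using sorted by (simp only:) (intro sorted_list_of_set.idem_if_sorted_distinct; simp add: sorted_wrt_take strict_sorted_iff)
    then have "map x (sorted_list_of_set (\<psi> \<inter> {..<?xs ! p})) = map x' (sorted_list_of_set {1..<Suc p})"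
      using p by (intro nth_equalityI) (auto simp: x'_def simp del: upt_Suc)
    then have "post_sd k \<sigma> x (\<psi> \<inter> {..<?xs ! p}) u = post_sd k \<sigma> x' {1..<Suc p} u" for u
      by (rule post_sd_cong)
    moreover have "x' (Suc p) = x (?xs ! p)" using p by (simp add: x'_def)
    ultimately show "ln (1 + (post_sd k \<sigma> x (\<psi> \<inter> {..<?xs ! p}) (x (?xs ! p)))\<^sup>2 / \<sigma>\<^sup>2) =
        ln (1 + (post_sd k \<sigma> x' {1..<Suc p} (x' (Suc p)))\<^sup>2 / \<sigma>\<^sup>2)"
      by (simp only:)
  qed
  also have "\<dots> = (\<Sum>j=1..?n. ln (1 + (post_sd k \<sigma> x' {1..<j} (x' j))\<^sup>2 / \<sigma>\<^sup>2))"
    by (rule sum.reindex_bij_witness[of _ "\<lambda>j. j - 1" Suc]) auto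
  also have "\<dots> \<le> ?S x'"
    using nT by (intro sum_mono2) auto
  also have "\<dots> \<le> 2 * info_gain k \<sigma> X T"
  proof -
    have "1 / 2 * ?S x' \<le> info_gain k \<sigma> X T"
      unfolding info_gain_def
    proof (rule cSUP_upper2[OF _ x'])
      show "bdd_above ((\<lambda>x. 1 / 2 * ln (Determinant.det (1\<^sub>m T + (1 / \<sigma>\<^sup>2) \<cdot>\<^sub>m kernel_mat k x {1..T}))) ` ({1..T} \<rightarrow> X))"
      proof (rule bdd_aboveI2)
        fix x assume "x \<in> {1..T} \<rightarrow> X"
        then show "1 / 2 * ln (Determinant.det (1\<^sub>m T + (1 / \<sigma>\<^sup>2) \<cdot>\<^sub>m kernel_mat k x {1..T})) \<le> 1 / 2 * (T * ln (1 + \<kappa> / \<sigma>\<^sup>2))"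
          unfolding eq[OF \<open>x \<in> {1..T} \<rightarrow> X\<close>] using S_le by (intro mult_left_mono) auto
      qed
    qed (simp add: eq[OF x', simplified])
    then show ?thesis by simp
  qed
  finally show ?thesis .
qed

lemma info_gain_nonneg:
  assumes "\<sigma> > 0" and "\<And>x. x \<in> X \<Longrightarrow> k x x \<le> \<kappa>" and "X \<noteq> {}"
  shows "0 \<le> info_gain k \<sigma> X T"
  using sum_ln_post_sd_le_info_gain[OF assms, of "{}" T] by simp

end


section \<open>Elimination within a round\<close>

lemma visits_0 [simp]: "\<not> visits \<sigma> T \<mu> w 0 A"
  by (auto elim: visits.cases)

lemma visits_1 [simp]: "visits \<sigma> T \<mu> w (Suc 0) A \<longleftrightarrow> A = UNIV"
proof
  assume "visits \<sigma> T \<mu> w (Suc 0) A"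
  then show "A = UNIV" by (cases rule: visits.cases) simp_all
qed (use visits.start[of \<sigma> T \<mu> w] in simp)

lemma visits_Suc_iff:
  assumes "0 < s"
  shows "visits \<sigma> T \<mu> w (Suc s) A \<longleftrightarrow>
    (\<exists>A'. visits \<sigma> T \<mu> w s A' \<and> \<not> all_certain \<sigma> T w s A' \<and> all_narrow \<sigma> w s A' \<and> A = surviving \<sigma> \<mu> w s A')"
    (is "?L \<longleftrightarrow> ?R")
proof
  assume ?L
  then show ?R using assms by (cases rule: visits.cases) auto
qed (metis visits.eliminate)

lemma visits_unique: "visits \<sigma> T \<mu> w s A \<Longrightarrow> visits \<sigma> T \<mu> w s A' \<Longrightarrow> A = A'"
proof (induction s arbitrary: A A')
  case (Suc s)
  then show ?case by (cases "s = 0") (auto simp: visits_Suc_iff)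
qed simp

lemma visits_before:
  "visits \<sigma> T \<mu> w s A \<Longrightarrow> 0 < s' \<Longrightarrow> s' < s \<Longrightarrow>
    \<exists>A'. visits \<sigma> T \<mu> w s' A' \<and> \<not> all_certain \<sigma> T w s' A' \<and> all_narrow \<sigma> w s' A'"
proof (induction s arbitrary: A)
  case (Suc s)
  then obtain A' where "visits \<sigma> T \<mu> w s A'" "\<not> all_certain \<sigma> T w s A'" "all_narrow \<sigma> w s A'"
    by (auto simp: visits_Suc_iff)
  then show ?case using Suc by (cases "s' = s") auto
qed simp

lemma visits_cong:
  assumes "\<And>s'. s' < s \<Longrightarrow> \<mu> s' = \<mu>' s'" "\<And>s'. s' < s \<Longrightarrow> w s' = w' s'"
  shows "visits \<sigma> T \<mu> w s A \<longleftrightarrow> visits \<sigma> T \<mu>' w' s A"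
  using assms
proof (induction s arbitrary: A)
  case (Suc s)
  then have "visits \<sigma> T \<mu> w s A' \<longleftrightarrow> visits \<sigma> T \<mu>' w' s A'" for A' by simp
  moreover have "\<mu> s = \<mu>' s" "w s = w' s" using Suc.prems by auto
  ultimately show ?case
    by (cases "s = 0") (simp_all add: visits_Suc_iff all_certain_def all_narrow_def surviving_def)
qed simp

definition explores ::
    "real \<Rightarrow> nat \<Rightarrow> (nat \<Rightarrow> 'a \<Rightarrow> real) \<Rightarrow> (nat \<Rightarrow> 'a \<Rightarrow> real) \<Rightarrow> nat \<Rightarrow> 'a set \<Rightarrow> bool" where
  "explores \<sigma> T \<mu> w s A \<longleftrightarrow> visits \<sigma> T \<mu> w s A \<and> \<not> all_certain \<sigma> T w s A \<and> \<not> all_narrow \<sigma> w s A"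

lemma explores_pos: "explores \<sigma> T \<mu> w s A \<Longrightarrow> 0 < s"
  by (cases s) (auto simp: explores_def)

text \<open>A level that was left on the way up was narrow, while an exploring level is not; so a
  round can explore at one level only.\<close>

lemma explores_unique:
  assumes "explores \<sigma> T \<mu> w s A" "explores \<sigma> T \<mu> w s' A'"
  shows "s' = s \<and> A' = A"
proof -
  have False if "explores \<sigma> T \<mu> w s A" "explores \<sigma> T \<mu> w s' A'" "s < s'" for s s' A A'
    using visits_before[of \<sigma> T \<mu> w s' A' s] visits_unique[of \<sigma> T \<mu> w s A] explores_pos[OF that(1)] that
    by (auto simp: explores_def)
  then have "s' = s" using assms by (metis linorder_cases)
  moreover have "A' = A"
    using assms visits_unique[of \<sigma> T \<mu> w s A' A] unfolding \<open>s' = s\<close> explores_def by blast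
  ultimately show ?thesis ..
qed

lemma not_explores_if_certain:
  assumes "visits \<sigma> T \<mu> w s A" "all_certain \<sigma> T w s A"
  shows "\<not> explores \<sigma> T \<mu> w s' A'"
proof
  assume e: "explores \<sigma> T \<mu> w s' A'"
  have "0 < s" using assms by (cases s) auto
  consider "s < s'" | "s = s'" | "s' < s" by linarith
  then show False
  proof cases
    case 1
    then obtain A'' where "visits \<sigma> T \<mu> w s A''" "\<not> all_certain \<sigma> T w s A''"
      using visits_before[of \<sigma> T \<mu> w s' A' s] e \<open>0 < s\<close> by (auto simp: explores_def)
    then show False using visits_unique[OF assms(1)] assms(2) by blast
  next
    case 2
    then show False using e visits_unique[OF assms(1), of A'] assms(2) by (auto simp: explores_def)
  next
    case 3
    then obtain A'' where "visits \<sigma> T \<mu> w s' A''" "all_narrow \<sigma> w s' A''"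
      using visits_before[OF assms(1) explores_pos[OF e]] by blast
    then show False using visits_unique[of \<sigma> T \<mu> w s' A' A''] e by (auto simp: explores_def)
  qed
qed

text \<open>The asymmetry is the point: means count strictly below \<open>s\<close>, widths up to
  \<open>s\<close>. Whether level \<open>s\<close> explores is decided without the rewards collected
  at level \<open>s\<close>.\<close>

lemma explores_cong:
  assumes "\<And>s'. s' < s \<Longrightarrow> \<mu> s' = \<mu>' s'" "\<And>s'. s' \<le> s \<Longrightarrow> w s' = w' s'"
  shows "explores \<sigma> T \<mu> w s A \<longleftrightarrow> explores \<sigma> T \<mu>' w' s A"
  using assms visits_cong[of s \<mu> \<mu>' w w' \<sigma> T A] by (simp add: explores_def all_certain_def all_narrow_def)

lemma measurable_visits:
  fixes \<mu> :: "'e \<Rightarrow> nat \<Rightarrow> 'a::finite \<Rightarrow> real"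
  assumes \<mu>[measurable]: "\<And>s b. (\<lambda>e. \<mu> e s b) \<in> borel_measurable N"
  shows "Measurable.pred N (\<lambda>e. visits \<sigma> T (\<mu> e) w s A)"
proof (induction s arbitrary: A)
  case (Suc s)
  show ?case
  proof (cases "s = 0")
    case False
    have sv: "Measurable.pred N (\<lambda>e. A = surviving \<sigma> (\<mu> e) w s A')" for A'
    \<comment> \<open>\<open>Max\<close> is handled on nonempty sets; from an empty set nothing
      survives.\<close>
    proof (cases "A' = {}")
      case False
      have [measurable]: "(\<lambda>e. Max ((\<lambda>a'. \<mu> e s a' + w s a') ` A')) \<in> borel_measurable N"
        using False by (intro borel_measurable_Max) auto
      define P where "P b e \<longleftrightarrow> Max ((\<lambda>a'. \<mu> e s a' + w s a') ` A') - \<sigma> * 2 powr (1 - real s) \<le> \<mu> e s b + w s b" for b e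
      have P: "Measurable.pred N (P b)" for b
        unfolding P_def pred_def by (intro borel_measurable_le) measurable
      have eq: "(A = surviving \<sigma> (\<mu> e) w s A') \<longleftrightarrow> (\<forall>b\<in>UNIV. b \<in> A \<longleftrightarrow> b \<in> A' \<and> P b e)" for e
        by (auto simp: surviving_def P_def)
      show ?thesis
        unfolding eq using P by (intro pred_intros_finite pred_intros_logic) auto
    qed (simp add: surviving_def)
    have eq: "visits \<sigma> T (\<mu> e) w (Suc s) A \<longleftrightarrow> (\<exists>A'\<in>UNIV. visits \<sigma> T (\<mu> e) w s A' \<and>
        \<not> all_certain \<sigma> T w s A' \<and> all_narrow \<sigma> w s A' \<and> A = surviving \<sigma> (\<mu> e) w s A')" for e
      using False by (simp add: visits_Suc_iff)
    show ?thesis unfolding eq using Suc sv by (intro pred_intros_finite pred_intros_logic) auto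
  qed simp
qed simp

text \<open>The index \<open>\<mu> + w\<close> lies between \<open>g\<close> and
  \<open>g + 2 * w\<close>. At a narrow level with width threshold \<open>e\<close> the largest
  index is at most \<open>g b0 + 2 * e\<close>, so \<open>b0\<close> survives; a survivor loses at
  most \<open>2 * e\<close> by the elimination margin and \<open>2 * e\<close> by its own index.
  Nothing has been eliminated on arrival at level 1, hence the guard \<open>1 < s\<close>.\<close>

lemma visits_accurate:
  fixes g :: "'a::finite \<Rightarrow> real"
  assumes "visits \<sigma> T \<mu> w s A"
    and "\<And>s' b. 0 < s' \<Longrightarrow> s' < s \<Longrightarrow> \<bar>\<mu> s' b - g b\<bar> \<le> w s' b"
    and opt: "\<And>b. g b \<le> g b0"
  shows "b0 \<in> A \<and> (1 < s \<longrightarrow> (\<forall>b\<in>A. g b0 - g b \<le> 8 * \<sigma> * 2 powr (- real s)))"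
  using assms(1,2)
proof (induction s A rule: visits.induct)
  case (eliminate s A)
  have "0 < s" using eliminate.hyps(1) by (cases s) auto
  have good: "\<bar>\<mu> s b - g b\<bar> \<le> w s b" for b
    using eliminate.prems[of s b] \<open>0 < s\<close> by simp
  have narrow: "w s b \<le> \<sigma> * 2 powr (- real s)" if "b \<in> A" for b
    using eliminate.hyps that by (simp add: all_narrow_def)
  have b0: "b0 \<in> A" using eliminate by simp
  let ?U = "\<lambda>b. \<mu> s b + w s b" and ?e = "\<sigma> * 2 powr (- real s)"
  have e: "\<sigma> * 2 powr (1 - real s) = 2 * ?e" "8 * \<sigma> * 2 powr (- real (Suc s)) = 4 * ?e"
    using powr_add[of 2 1 "- real s"] powr_add[of 2 "-1" "- real s"] by (simp_all add: powr_minus)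
  have U: "g b \<le> ?U b" "?U b \<le> g b + 2 * w s b" for b using good[of b] by linarith+
  have max_le: "Max (?U ` A) \<le> g b0 + 2 * ?e"
  proof (rule Max.boundedI)
    fix y assume "y \<in> ?U ` A"
    then obtain b where "b \<in> A" "y = ?U b" by auto
    then show "y \<le> g b0 + 2 * ?e" using U(2)[of b] opt[of b] narrow[of b] by linarith
  qed (use b0 in auto)
  have max_ge: "?U b0 \<le> Max (?U ` A)" using b0 by (intro Max_ge) auto
  have "b0 \<in> surviving \<sigma> \<mu> w s A"
    using b0 max_le U(1)[of b0] unfolding surviving_def e by simp
  moreover have "g b0 - g b \<le> 4 * ?e" if "b \<in> surviving \<sigma> \<mu> w s A" for b
  proof -
    have "b \<in> A" "Max (?U ` A) - 2 * ?e \<le> ?U b" using that unfolding surviving_def e by simp_all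
    then show ?thesis using max_ge U(1)[of b0] U(2)[of b] narrow[of b] by linarith
  qed
  ultimately show ?case unfolding e by simp
qed simp


section \<open>Accuracy of the posterior means\<close>

lemma (in prob_space) sub_gaussian_sum_upper_tail:
  assumes indep: "indep_vars (\<lambda>_. borel) \<epsilon> J" and J: "finite J"
    and sg: "\<And>i. i \<in> J \<Longrightarrow> sub_gaussian M (\<epsilon> i) v"
    and r: "0 \<le> r" and V: "0 < v * (\<Sum>i\<in>J. (c i)\<^sup>2)"
  shows "prob {\<omega> \<in> space M. r * sqrt (v * (\<Sum>i\<in>J. (c i)\<^sup>2)) < (\<Sum>i\<in>J. c i * \<epsilon> i \<omega>)} \<le> exp (- r\<^sup>2 / 2)"
proof (cases "r = 0")
  case True
  then show ?thesis by simp
next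
  case False
  define V where "V = v * (\<Sum>i\<in>J. (c i)\<^sup>2)"
  have V0: "0 < V" using V by (simp add: V_def)
  \<comment> \<open>The Chernoff exponent: it minimizes
    \<open>l\<^sup>2 * V / 2 - l * r * sqrt V\<close>, with value
    \<open>- r\<^sup>2 / 2\<close>.\<close>
  define l where "l = r / sqrt V"
  have l0: "0 < l" using False r V0 by (simp add: l_def)
  let ?Y = "\<lambda>\<omega>. \<Sum>i\<in>J. c i * \<epsilon> i \<omega>"
  have [measurable]: "\<epsilon> i \<in> borel_measurable M" if "i \<in> J" for i
    using sg[OF that] by (simp add: sub_gaussian_def)
  have ind: "indep_vars (\<lambda>_. borel) (\<lambda>i \<omega>. exp (l * c i * \<epsilon> i \<omega>)) J"
    by (rule indep_vars_compose2[OF indep]) simp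
  have int: "integrable M (\<lambda>\<omega>. exp (l * c i * \<epsilon> i \<omega>))"
    and mgf: "expectation (\<lambda>\<omega>. exp (l * c i * \<epsilon> i \<omega>)) \<le> exp ((l * c i)\<^sup>2 * v / 2)" if "i \<in> J" for i
    using sg[OF that] by (simp_all add: sub_gaussian_def)
  have eq: "exp (l * ?Y \<omega>) = (\<Prod>i\<in>J. exp (l * c i * \<epsilon> i \<omega>))" for \<omega>
    by (simp add: exp_sum[OF J, symmetric] sum_distrib_left mult.assoc)
  have int': "integrable M (\<lambda>\<omega>. exp (l * ?Y \<omega>))"
    unfolding eq using indep_vars_integrable[OF J ind int] by simp
  have "expectation (\<lambda>\<omega>. exp (l * ?Y \<omega>)) = (\<Prod>i\<in>J. expectation (\<lambda>\<omega>. exp (l * c i * \<epsilon> i \<omega>)))"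
    unfolding eq by (rule indep_vars_lebesgue_integral[OF J ind int])
  also have "\<dots> \<le> (\<Prod>i\<in>J. exp ((l * c i)\<^sup>2 * v / 2))"
    by (intro prod_mono conjI mgf integral_nonneg_AE) auto
  also have "\<dots> = exp (l\<^sup>2 * V / 2)"
    by (simp add: exp_sum[OF J, symmetric] V_def sum_divide_distrib sum_distrib_left power_mult_distrib mult_ac)
  also have "l\<^sup>2 * V / 2 = r\<^sup>2 / 2"
    using V0 by (simp add: l_def power_divide)
  finally have E: "expectation (\<lambda>\<omega>. exp (l * ?Y \<omega>)) \<le> exp (r\<^sup>2 / 2)" .
  have lr: "l * (r * sqrt V) = r\<^sup>2"
    using V0 by (simp add: l_def power2_eq_square)
  have "prob {\<omega> \<in> space M. r * sqrt V < ?Y \<omega>} \<le> prob {\<omega> \<in> space M. exp (r\<^sup>2) \<le> exp (l * ?Y \<omega>)}"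
  proof (rule finite_measure_mono)
    show "{\<omega> \<in> space M. r * sqrt V < ?Y \<omega>} \<subseteq> {\<omega> \<in> space M. exp (r\<^sup>2) \<le> exp (l * ?Y \<omega>)}"
      unfolding lr[symmetric] using l0 by auto
  qed measurable
  also have "\<dots> \<le> expectation (\<lambda>\<omega>. exp (l * ?Y \<omega>)) / exp (r\<^sup>2)"
    by (rule integral_Markov_inequality_measure[OF int', of "{}"]) auto
  also have "\<dots> \<le> exp (r\<^sup>2 / 2) / exp (r\<^sup>2)" using E by (intro divide_right_mono) auto
  also have "\<dots> = exp (- r\<^sup>2 / 2)" by (simp add: exp_diff[symmetric])
  finally show ?thesis by (simp add: V_def)
qed

lemma (in prob_space) sub_gaussian_sum_tail:
  assumes indep: "indep_vars (\<lambda>_. borel) \<epsilon> J" and J: "finite J"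
    and sg: "\<And>i. i \<in> J \<Longrightarrow> sub_gaussian M (\<epsilon> i) v"
    and r: "0 \<le> r" and v: "0 < v"
  shows "prob {\<omega> \<in> space M. r * sqrt (v * (\<Sum>i\<in>J. (c i)\<^sup>2)) < \<bar>\<Sum>i\<in>J. c i * \<epsilon> i \<omega>\<bar>} \<le> 2 * exp (- r\<^sup>2 / 2)"
proof (cases "(\<Sum>i\<in>J. (c i)\<^sup>2) = 0")
  \<comment> \<open>With all weights 0 the form vanishes, and the strict inequality makes the event
    empty.\<close>
  case True
  then have "c i = 0" if "i \<in> J" for i
    using that J by (simp add: sum_nonneg_eq_0_iff)
  then have "{\<omega> \<in> space M. r * sqrt (v * (\<Sum>i\<in>J. (c i)\<^sup>2)) < \<bar>\<Sum>i\<in>J. c i * \<epsilon> i \<omega>\<bar>} = {}" by simp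
  then show ?thesis by (simp only: measure_empty) simp
next
  case False
  then have V: "0 < v * (\<Sum>i\<in>J. (c i)\<^sup>2)"
    using v by (intro mult_pos_pos) (simp_all add: sum_nonneg order_less_le)
  have [measurable]: "\<epsilon> i \<in> borel_measurable M" if "i \<in> J" for i
    using sg[OF that] by (simp add: sub_gaussian_def)
  let ?A = "\<lambda>c. {\<omega> \<in> space M. r * sqrt (v * (\<Sum>i\<in>J. (c i)\<^sup>2)) < (\<Sum>i\<in>J. c i * \<epsilon> i \<omega>)}"
  have eq: "{\<omega> \<in> space M. r * sqrt (v * (\<Sum>i\<in>J. (c i)\<^sup>2)) < \<bar>\<Sum>i\<in>J. c i * \<epsilon> i \<omega>\<bar>} = ?A c \<union> ?A (\<lambda>i. - c i)"
    by (auto simp: sum_negf)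
  have "prob (?A c \<union> ?A (\<lambda>i. - c i)) \<le> prob (?A c) + prob (?A (\<lambda>i. - c i))"
    by (intro measure_Un_le) measurable
  also have "\<dots> \<le> exp (- r\<^sup>2 / 2) + exp (- r\<^sup>2 / 2)"
  proof (rule add_mono)
    show "prob (?A c) \<le> exp (- r\<^sup>2 / 2)"
      by (rule sub_gaussian_sum_upper_tail[OF indep J sg r V])
    have V': "0 < v * (\<Sum>i\<in>J. (- c i)\<^sup>2)" using V by simp
    show "prob (?A (\<lambda>i. - c i)) \<le> exp (- r\<^sup>2 / 2)"
      by (rule sub_gaussian_sum_upper_tail[where c="\<lambda>i. - c i", OF indep J sg r V'])
  qed
  finally show ?thesis unfolding eq by simp
qed

section \<open>Histories and their level sets\<close>

lemma reward_vec_list: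
  "reward_vec y \<psi> = (let ys = map y (sorted_list_of_set \<psi>) in Matrix.vec (length ys) (\<lambda>i. ys ! i))"
  by (auto simp: reward_vec_def Let_def intro!: eq_vecI)

lemma post_mean_cong:
  assumes "finite \<psi>" "\<And>i. i \<in> \<psi> \<Longrightarrow> x i = x' i" "\<And>i. i \<in> \<psi> \<Longrightarrow> y i = y' i"
  shows "post_mean k \<sigma> x y \<psi> u = post_mean k \<sigma> x' y' \<psi> u"
proof -
  have "map x (sorted_list_of_set \<psi>) = map x' (sorted_list_of_set \<psi>)"
    "map y (sorted_list_of_set \<psi>) = map y' (sorted_list_of_set \<psi>)"
    using assms by auto
  then show ?thesis
    by (simp only: post_mean_def reg_inverse_def kernel_mat_list kernel_vec_list reward_vec_list)
qed

text \<open>A history records the level and the action of each exploring round, and \<^const>\<open>None\<close> for the other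
  rounds.\<close>

type_synonym 'a history = "nat \<Rightarrow> (nat \<times> 'a) option"

definition level_set :: "'a history \<Rightarrow> nat \<Rightarrow> nat \<Rightarrow> nat set" where
  "level_set h t s = {i \<in> {1..<t}. \<exists>b. h i = Some (s, b)}"

lemma finite_level_set [simp]: "finite (level_set h t s)"
  by (simp add: level_set_def)

text \<open>Confining both rounds and levels makes this set finite, so that probabilities can be
  summed over it.\<close>

definition histories :: "nat \<Rightarrow> nat \<Rightarrow> 'a::finite history set" where
  "histories s t = {h. \<forall>i. (i \<in> {1..<t} \<longrightarrow> h i \<in> insert None (Some ` ({1..s} \<times> UNIV))) \<and> (i \<notin> {1..<t} \<longrightarrow> h i = None)}"

lemma finite_histories: "finite (histories s t :: 'a::finite history set)"
  unfolding histories_def by (rule finite_set_of_finite_funs) auto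

text \<open>The part of a history on which means and widths of levels up to \<open>s\<close> depend
  before round \<open>t\<close> and at it. Rounds that explored above \<open>s\<close> become
  \<open>None\<close>, like rounds that did not explore, because what they did can depend on rewards
  at level \<open>s\<close>.\<close>

definition cut_history :: "nat \<Rightarrow> nat \<Rightarrow> 'a history \<Rightarrow> 'a history" where
  "cut_history s t h = (\<lambda>i. case h i of Some (s', b) \<Rightarrow> if i \<in> {1..<t} \<and> s' \<le> s then Some (s', b) else None | None \<Rightarrow> None)"

lemma cut_history_eq_Some_iff: "cut_history s t h i = Some (s', b) \<longleftrightarrow> h i = Some (s', b) \<and> i \<in> {1..<t} \<and> s' \<le> s"
  by (auto simp: cut_history_def split: option.splits if_splits)

lemma level_set_cut_history: "i \<le> t \<Longrightarrow> s' \<le> s \<Longrightarrow> level_set (cut_history s t h) i s' = level_set h i s'"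
  by (auto simp: level_set_def cut_history_eq_Some_iff)

text \<open>The horizon is fixed, so \<open>\<beta>\<close> is one number. \<open>sqrt_beta\<close>
  holds once the horizon is large; it makes \<open>sqrt \<beta> - B\<close> a nonnegative deviation
  for the tail bound.\<close>

locale bandit = rkhs X k H ip
  for X :: "'x set" and k H ip +
  fixes \<sigma> \<beta> B \<kappa> :: real and T S :: nat and arm :: "nat \<Rightarrow> 'a::finite \<Rightarrow> 'x" and f :: "'x \<Rightarrow> real"
  assumes sigma_pos: "\<sigma> > 0" and f_mem: "f \<in> H" and f_norm: "sqrt (ip f f) \<le> B"
    and arm_mem: "\<And>t b. t \<in> {1..T} \<Longrightarrow> arm t b \<in> X" and kappa: "\<And>x. x \<in> X \<Longrightarrow> k x x \<le> \<kappa>"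
    and sqrt_beta: "B \<le> sqrt \<beta>"
begin

definition point :: "'a history \<Rightarrow> nat \<Rightarrow> 'x" where
  "point h i = arm i (snd (the (h i)))"

text \<open>A function of an arbitrary history and noise sequence instead of a run, so that the
  history can be held fixed while the noise is random. The corresponding \<open>width\<close> has no
  noise argument.\<close>

definition mean :: "(nat \<Rightarrow> real) \<Rightarrow> 'a history \<Rightarrow> nat \<Rightarrow> nat \<Rightarrow> 'a \<Rightarrow> real" where
  "mean e h t s b = post_mean k \<sigma> (point h) (\<lambda>i. f (point h i) + e i) (level_set h t s) (arm t b)"

definition width :: "'a history \<Rightarrow> nat \<Rightarrow> nat \<Rightarrow> 'a \<Rightarrow> real" where
  "width h t s b = sqrt \<beta> * post_sd k \<sigma> (point h) (level_set h t s) (arm t b)"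

text \<open>Consistency of a history with the algorithm as seen from levels up to \<open>s\<close>;
  \<open>None\<close> leaves open whether the round explored higher or did not explore.\<close>

definition outcome_ok :: "nat \<Rightarrow> (nat \<Rightarrow> 'a set \<Rightarrow> 'a) \<Rightarrow> (nat \<Rightarrow> real) \<Rightarrow> 'a history \<Rightarrow> nat \<Rightarrow> bool" where
  "outcome_ok s p e h i \<longleftrightarrow> (case h i of
      Some (s', b) \<Rightarrow> s' \<le> s \<and> (\<exists>A. explores \<sigma> T (mean e h i) (width h i) s' A \<and>
        b = p i {b \<in> A. width h i s' b > \<sigma> * 2 powr (- real s')})
    | None \<Rightarrow> \<not> (\<exists>s'\<le>s. \<exists>A. explores \<sigma> T (mean e h i) (width h i) s' A))"

lemma B_nonneg: "0 \<le> B"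
  using f_norm ip_nonneg[OF f_mem] by (meson order_trans real_sqrt_ge_zero)

lemma mean_cong:
  assumes "level_set h t s = level_set h' t s" "\<And>i. i \<in> level_set h t s \<Longrightarrow> h i = h' i \<and> e i = e' i"
  shows "mean e h t s = mean e' h' t s"
proof
  fix b
  have "point h i = point h' i" if "i \<in> level_set h t s" for i
    using assms(2)[OF that] by (simp add: point_def)
  then show "mean e h t s b = mean e' h' t s b"
    unfolding mean_def assms(1)[symmetric] using assms(2) by (intro post_mean_cong) auto
qed

lemma width_cong:
  assumes "level_set h t s = level_set h' t s" "\<And>i. i \<in> level_set h t s \<Longrightarrow> h i = h' i"
  shows "width h t s = width h' t s"
proof
  fix b
  have "point h i = point h' i" if "i \<in> level_set h t s" for i
    using assms(2)[OF that] by (simp add: point_def)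
  then have "map (point h) (sorted_list_of_set (level_set h t s)) = map (point h') (sorted_list_of_set (level_set h' t s))"
    unfolding assms(1)[symmetric] by simp
  then show "width h t s b = width h' t s b"
    unfolding width_def by (intro arg_cong2[where f="(*)"] refl post_sd_cong)
qed

text \<open>Past entries determine means and widths, these determine whether and where the round
  explores, and the pick then determines the action. So the events attached to different histories
  are disjoint.\<close>

lemma outcome_unique:
  assumes h: "h \<in> histories s t" "h' \<in> histories s t"
    and ok: "\<And>i. i \<in> {1..<t} \<Longrightarrow> outcome_ok s p e h i" "\<And>i. i \<in> {1..<t} \<Longrightarrow> outcome_ok s p e h' i"
  shows "h = h'"
proof
  fix i
  show "h i = h' i"
  proof (induction i rule: less_induct)
    case (less i)
    show ?case
    proof (cases "i \<in> {1..<t}")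
      case False
      then show ?thesis using h by (simp add: histories_def)
    next
      case True
      have ls: "level_set h i s' = level_set h' i s'" for s'
        using less by (auto simp: level_set_def)
      have agree: "h j = h' j" if "j \<in> level_set h i s'" for j s'
        using less that by (auto simp: level_set_def)
      have m: "mean e h i = mean e h' i" and w: "width h i = width h' i"
        using ls agree by (auto intro!: ext mean_cong[THEN fun_cong] width_cong[THEN fun_cong])
      let ?E = "explores \<sigma> T (mean e h' i) (width h' i)"
      note ok' = ok(1)[OF True, unfolded outcome_ok_def m w] ok(2)[OF True, unfolded outcome_ok_def]
      show ?thesis
      proof (cases "h i")
        case None
        then have "\<not> (\<exists>s'\<le>s. \<exists>A. ?E s' A)" using ok'(1) by simp
        then show ?thesis using None ok'(2) by (cases "h' i") auto
      next
        case (Some sb)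
        obtain s1 b1 where sb: "sb = (s1, b1)" by (cases sb)
        obtain A1 where A1: "s1 \<le> s" "?E s1 A1" "b1 = p i {b \<in> A1. width h' i s1 b > \<sigma> * 2 powr (- real s1)}"
          using ok'(1) Some sb by auto
        have "h' i \<noteq> None"
        proof
          assume "h' i = None"
          then have "\<not> (\<exists>s'\<le>s. \<exists>A. ?E s' A)" using ok'(2) by simp
          then show False using A1(1,2) by blast
        qed
        then obtain s2 b2 where sb': "h' i = Some (s2, b2)" by auto
        obtain A2 where A2: "?E s2 A2" "b2 = p i {b \<in> A2. width h' i s2 b > \<sigma> * 2 powr (- real s2)}"
          using ok'(2) sb' by auto
        have "s2 = s1" "A2 = A1" using explores_unique[OF A1(2) A2(1)] by simp_all
        then show ?thesis using Some sb sb' A1(3) A2(2) by simp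
      qed
    qed
  qed
qed

lemma level_set_points:
  assumes "t \<le> Suc T" "i \<in> level_set h t s"
  shows "point h i \<in> X"
  using assms arm_mem[of i] by (auto simp: level_set_def point_def)

lemma weights_exist:
  assumes "t \<in> {1..T}"
  shows "\<exists>c. (\<forall>y. post_mean k \<sigma> (point h) y (level_set h t s) (arm t b) = (\<Sum>i\<in>level_set h t s. c i * y i)) \<and>
    \<sigma>\<^sup>2 * (\<Sum>i\<in>level_set h t s. (c i)\<^sup>2) \<le> (post_sd k \<sigma> (point h) (level_set h t s) (arm t b))\<^sup>2 \<and>
    \<bar>f (arm t b) - (\<Sum>i\<in>level_set h t s. c i * f (point h i))\<bar> \<le> sqrt (ip f f) * post_sd k \<sigma> (point h) (level_set h t s) (arm t b)"
proof -
  have pts: "\<And>i. i \<in> level_set h t s \<Longrightarrow> point h i \<in> X"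
    using assms by (intro level_set_points[of t]) auto
  show ?thesis
    by (rule posterior_bounds[where x="point h" and \<psi>="level_set h t s", OF finite_level_set pts sigma_pos arm_mem[OF assms]])
      (use f_mem in blast)+
qed

text \<open>A choice that depends on the history but not on the rewards: for a fixed history the
  mean is an affine function of the noise, with constant coefficients.\<close>

definition weight :: "'a history \<Rightarrow> nat \<Rightarrow> nat \<Rightarrow> 'a \<Rightarrow> nat \<Rightarrow> real" where
  "weight h t s b = (SOME c. (\<forall>y. post_mean k \<sigma> (point h) y (level_set h t s) (arm t b) = (\<Sum>i\<in>level_set h t s. c i * y i)) \<and>
    \<sigma>\<^sup>2 * (\<Sum>i\<in>level_set h t s. (c i)\<^sup>2) \<le> (post_sd k \<sigma> (point h) (level_set h t s) (arm t b))\<^sup>2 \<and>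
    \<bar>f (arm t b) - (\<Sum>i\<in>level_set h t s. c i * f (point h i))\<bar> \<le> sqrt (ip f f) * post_sd k \<sigma> (point h) (level_set h t s) (arm t b))"

lemmas weight = someI_ex[OF weights_exist, folded weight_def]

lemma post_sd_point:
  assumes "t \<in> {1..T}"
  shows "0 \<le> post_sd k \<sigma> (point h) (level_set h t s) (arm t b)"
proof -
  have pts: "\<And>i. i \<in> level_set h t s \<Longrightarrow> point h i \<in> X"
    using assms by (intro level_set_points[of t]) auto
  show ?thesis
    by (rule posterior_bounds[where x="point h" and \<psi>="level_set h t s", OF finite_level_set pts sigma_pos arm_mem[OF assms]])
qed

lemma mean_eq_weight:
  "t \<in> {1..T} \<Longrightarrow> mean e h t s b = (\<Sum>i\<in>level_set h t s. weight h t s b i * (f (point h i) + e i))"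
  unfolding mean_def using weight by blast

text \<open>The width is \<open>sqrt \<beta>\<close> posterior deviations and the bias at most
  \<open>B\<close> of them, so the noise must account for more than \<open>sqrt \<beta> - B\<close>
  deviations; a deviation in turn dominates \<open>\<sigma>\<close> times the norm of the weights,
  the sub-Gaussian scale of the form.\<close>

lemma large_noise_if_inaccurate:
  assumes t: "t \<in> {1..T}" and bad: "width h t s b < \<bar>mean e h t s b - f (arm t b)\<bar>"
  shows "(sqrt \<beta> - B) * sqrt (\<sigma>\<^sup>2 * (\<Sum>i\<in>level_set h t s. (weight h t s b i)\<^sup>2)) <
    \<bar>\<Sum>i\<in>level_set h t s. weight h t s b i * e i\<bar>"
proof -
  let ?\<psi> = "level_set h t s" and ?c = "weight h t s b"
  let ?sd = "post_sd k \<sigma> (point h) ?\<psi> (arm t b)"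
  note w = weight[OF t, of h s b]
  have sd: "0 \<le> ?sd" by (rule post_sd_point[OF t])
  have "sqrt (\<sigma>\<^sup>2 * (\<Sum>i\<in>?\<psi>. (?c i)\<^sup>2)) \<le> ?sd"
    using w sd by (intro real_le_lsqrt) auto
  then have "(sqrt \<beta> - B) * sqrt (\<sigma>\<^sup>2 * (\<Sum>i\<in>?\<psi>. (?c i)\<^sup>2)) \<le> (sqrt \<beta> - B) * ?sd"
    using sqrt_beta by (intro mult_left_mono) auto
  moreover have "sqrt (ip f f) * ?sd \<le> B * ?sd" using f_norm sd by (intro mult_right_mono)
  moreover have "mean e h t s b = (\<Sum>i\<in>?\<psi>. ?c i * f (point h i)) + (\<Sum>i\<in>?\<psi>. ?c i * e i)"
    using mean_eq_weight[OF t, of e h s b] by (simp add: distrib_left sum.distrib)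
  moreover have "width h t s b = sqrt \<beta> * ?sd" by (simp add: width_def)
  moreover have "\<bar>f (arm t b) - (\<Sum>i\<in>?\<psi>. ?c i * f (point h i))\<bar> \<le> sqrt (ip f f) * ?sd" using w by blast
  ultimately show ?thesis using bad unfolding left_diff_distrib by linarith
qed

text \<open>Turns a point of the product over \<open>J\<close> into a full noise sequence;
  invariance under masking expresses that the remaining coordinates have no influence.\<close>

definition mask :: "nat set \<Rightarrow> (nat \<Rightarrow> real) \<Rightarrow> nat \<Rightarrow> real" where
  "mask J e = (\<lambda>j. if j \<in> J then e j else 0)"

text \<open>Whether a round explores at level \<open>s\<close> depends on the rewards at lower levels only.\<close>

lemma outcome_ok_mask:
  assumes i: "i \<in> {1..<t}" and t: "t \<le> Suc T"
  shows "outcome_ok s p e h i \<longleftrightarrow> outcome_ok s p (mask ({1..T} - level_set h t s) e) h i"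
proof -
  let ?e = "mask ({1..T} - level_set h t s) e"
  \<comment> \<open>A round records one level only, so masking the rounds of level \<open>s\<close>
    leaves the noise at each lower level untouched.\<close>
  have m: "mean e h i s' = mean ?e h i s'" if "s' < s" for s'
    using that i t by (intro mean_cong) (auto simp: level_set_def mask_def)
  have "explores \<sigma> T (mean e h i) (width h i) s' A \<longleftrightarrow> explores \<sigma> T (mean ?e h i) (width h i) s' A" if "s' \<le> s" for s' A
    using that by (intro explores_cong m) auto
  then show ?thesis by (auto simp: outcome_ok_def split: option.splits)
qed

lemma measurable_outcome_ok:
  assumes i: "i \<in> {1..T}"
  shows "Measurable.pred (Pi\<^sub>M J (\<lambda>_. borel)) (\<lambda>e. outcome_ok s p (mask J e) h i)"
proof -
  have "(\<lambda>e. mask J e j) \<in> borel_measurable (Pi\<^sub>M J (\<lambda>_. borel))" for j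
    by (cases "j \<in> J") (simp_all add: mask_def)
  then have m: "(\<lambda>e. mean (mask J e) h i s' b) \<in> borel_measurable (Pi\<^sub>M J (\<lambda>_. borel))" for s' b
    unfolding mean_eq_weight[OF i] by (intro borel_measurable_sum borel_measurable_times borel_measurable_add) auto
  have e: "Measurable.pred (Pi\<^sub>M J (\<lambda>_. borel)) (\<lambda>e. explores \<sigma> T (mean (mask J e) h i) (width h i) s' A)" for s' A
    unfolding explores_def by (intro pred_intros_logic measurable_visits m) auto
  show ?thesis
  proof (cases "h i")
    case None
    have eq: "outcome_ok s p (mask J e) h i \<longleftrightarrow>
      \<not> (\<exists>s'\<in>{..s}. \<exists>A\<in>UNIV. explores \<sigma> T (mean (mask J e) h i) (width h i) s' A)" for e
      by (auto simp: outcome_ok_def None)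
    show ?thesis unfolding eq by (intro pred_intros_logic pred_intros_finite e) auto
  next
    case (Some sb)
    obtain s' b where sb: "sb = (s', b)" by (cases sb)
    have eq: "outcome_ok s p (mask J e) h i \<longleftrightarrow> s' \<le> s \<and>
      (\<exists>A\<in>UNIV. explores \<sigma> T (mean (mask J e) h i) (width h i) s' A \<and> b = p i {b \<in> A. width h i s' b > \<sigma> * 2 powr (- real s')})" for e
      by (auto simp: outcome_ok_def Some sb)
    show ?thesis unfolding eq by (intro pred_intros_logic pred_intros_finite e) auto
  qed
qed

end

section \<open>The probability of an inaccurate mean\<close>

context bandit
begin

lemma outcome_ok_restrict:
  "i \<in> I \<Longrightarrow> outcome_ok s p e h i \<longleftrightarrow> outcome_ok s (restrict p I) e h i"
  by (simp add: outcome_ok_def split: option.splits)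

text \<open>Fix a value \<open>p\<close> of the picks and a history \<open>h\<close>. The event
  \<open>E p h\<close> that both are realized involves the picks and the noise off the level set,
  while \<open>F h\<close>, a large linear form with constant weights, involves the noise on it; so
  their intersection has probability at most that of \<open>E p h\<close> times the tail
  \<open>?q\<close>. The \<open>E p h\<close> are disjoint, so the sum is at most \<open>?q\<close>.
  Only the covering set \<open>D\<close> is claimed to be measurable.\<close>

lemma inaccurate_event:
  fixes M :: "'w measure" and \<epsilon> :: "nat \<Rightarrow> 'w \<Rightarrow> real" and pick :: "nat \<Rightarrow> 'w \<Rightarrow> 'a set \<Rightarrow> 'a"
  assumes M: "prob_space M" and noise: "iid_sub_gaussian_noise M {1..T} \<epsilon> (\<sigma>\<^sup>2)"
    and picks: "random_picks M T \<epsilon> pick" and t: "t \<in> {1..T}"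
  shows "\<exists>D\<in>sets M. measure M D \<le> 2 * exp (- (sqrt \<beta> - B)\<^sup>2 / 2) \<and>
    (\<forall>\<omega>\<in>space M. \<forall>h\<in>histories s t. (\<forall>i\<in>{1..<t}. outcome_ok s (\<lambda>i. pick i \<omega>) (\<lambda>i. \<epsilon> i \<omega>) h i) \<longrightarrow>
      width h t s b < \<bar>mean (\<lambda>i. \<epsilon> i \<omega>) h t s b - f (arm t b)\<bar> \<longrightarrow> \<omega> \<in> D)"
proof -
  interpret prob_space M by fact
  let ?q = "2 * exp (- (sqrt \<beta> - B)\<^sup>2 / 2)"
  let ?N = "Pi\<^sub>M {1..T} (\<lambda>_. borel :: real measure)" and ?N' = "Pi\<^sub>M {1..T} (\<lambda>_. count_space (UNIV :: ('a set \<Rightarrow> 'a) set))"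
  define pk where "pk \<omega> = (\<lambda>t\<in>{1..T}. pick t \<omega>)" for \<omega>
  define ev where "ev \<omega> = (\<lambda>t\<in>{1..T}. \<epsilon> t \<omega>)" for \<omega>
  have indep: "indep_vars (\<lambda>_. borel) \<epsilon> {1..T}" and sg: "\<And>i. i \<in> {1..T} \<Longrightarrow> sub_gaussian M (\<epsilon> i) (\<sigma>\<^sup>2)"
    using noise by (auto simp: iid_sub_gaussian_noise_def)
  have ev[measurable]: "ev \<in> M \<rightarrow>\<^sub>M ?N" and pk[measurable]: "pk \<in> M \<rightarrow>\<^sub>M ?N'"
    and ev_pk: "indep_set {ev -` A \<inter> space M | A. A \<in> sets ?N} {pk -` A \<inter> space M | A. A \<in> sets ?N'}"
    using picks by (auto simp: random_picks_def indep_rvs_def pk_def[abs_def] ev_def[abs_def])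
  \<comment> \<open>There are finitely many rounds and finitely many functions from sets of actions
    to actions, so the pick process has finite range and a sum over its values replaces
    conditioning.\<close>
  define P where "P = (Pi\<^sub>E {1..T} (\<lambda>_. UNIV) :: (nat \<Rightarrow> 'a set \<Rightarrow> 'a) set)"
  have finP: "finite P" unfolding P_def by (intro finite_PiE) auto
  have pkP: "pk \<omega> \<in> P" for \<omega> by (auto simp: pk_def P_def)
  define E where "E p h = {\<omega> \<in> space M. pk \<omega> = p \<and> (\<forall>i\<in>{1..<t}. outcome_ok s p (\<lambda>i. \<epsilon> i \<omega>) h i)}" for p h
  define F where "F h = {\<omega> \<in> space M. (sqrt \<beta> - B) * sqrt (\<sigma>\<^sup>2 * (\<Sum>i\<in>level_set h t s. (weight h t s b i)\<^sup>2)) <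
    \<bar>\<Sum>i\<in>level_set h t s. weight h t s b i * \<epsilon> i \<omega>\<bar>}" for h
  have EF: "E p h \<in> events \<and> F h \<in> events \<and> prob (E p h \<inter> F h) = prob (E p h) * prob (F h)" if p: "p \<in> P" for p h
  proof -
    let ?\<psi> = "level_set h t s"
    define J where "J = {1..T} - ?\<psi>"
    have \<psi>: "?\<psi> \<subseteq> {1..T}" using t by (auto simp: level_set_def)
    define G where "G = {e \<in> space (Pi\<^sub>M J (\<lambda>_. borel)). \<forall>i\<in>{1..<t}. outcome_ok s p (mask J e) h i}"
    have "Measurable.pred (Pi\<^sub>M J (\<lambda>_. borel)) (\<lambda>e. \<forall>i\<in>{1..<t}. outcome_ok s p (mask J e) h i)"
      using t by (intro pred_intros_finite measurable_outcome_ok) auto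
    then have G: "G \<in> sets (Pi\<^sub>M J (\<lambda>_. borel))" by (simp add: G_def pred_def)
    define G' where "G' = {e \<in> space (Pi\<^sub>M ?\<psi> (\<lambda>_. borel)). (sqrt \<beta> - B) * sqrt (\<sigma>\<^sup>2 * (\<Sum>i\<in>?\<psi>. (weight h t s b i)\<^sup>2)) <
      \<bar>\<Sum>i\<in>?\<psi>. weight h t s b i * e i\<bar>}"
    have G': "G' \<in> sets (Pi\<^sub>M ?\<psi> (\<lambda>_. borel))"
      unfolding G'_def by measurable
    define A where "A = {\<omega> \<in> space M. restrict (\<lambda>i. \<epsilon> i \<omega>) J \<in> G}"
    have FA: "F h = {\<omega> \<in> space M. restrict (\<lambda>i. \<epsilon> i \<omega>) ?\<psi> \<in> G'}"
      by (auto simp: F_def G'_def space_PiM)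
    have EA: "E p h = {\<omega> \<in> space M. pk \<omega> = p} \<inter> A"
    proof -
      have "outcome_ok s p (\<lambda>i. \<epsilon> i \<omega>) h i \<longleftrightarrow> outcome_ok s p (mask J (restrict (\<lambda>i. \<epsilon> i \<omega>) J)) h i"
        if "i \<in> {1..<t}" for i \<omega>
      proof -
        have "mask J (restrict (\<lambda>i. \<epsilon> i \<omega>) J) = mask J (\<lambda>i. \<epsilon> i \<omega>)" by (auto simp: mask_def)
        then show ?thesis using outcome_ok_mask[OF that, of s p "\<lambda>i. \<epsilon> i \<omega>" h] t by (simp add: J_def)
      qed
      then show ?thesis by (auto simp: E_def A_def G_def space_PiM)
    qed
    have "indep_var (Pi\<^sub>M J (\<lambda>_. borel)) (\<lambda>\<omega>. restrict (\<lambda>i. \<epsilon> i \<omega>) J) (Pi\<^sub>M ?\<psi> (\<lambda>_. borel)) (\<lambda>\<omega>. restrict (\<lambda>i. \<epsilon> i \<omega>) ?\<psi>)"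
      using \<psi> by (intro indep_var_restrict[OF indep]) (auto simp: J_def)
    from indep_varD[OF this G G'] have AF: "prob (A \<inter> F h) = prob A * prob (F h)"
      by (simp add: A_def FA vimage_def Int_def conj_ac)
    \<comment> \<open>The picks are independent of the noise vector as a whole, so both noise events
      are rewritten in terms of that vector. Then \<open>A \<inter> F h\<close> is independent of
      the picks, and \<open>A\<close> of \<open>F h\<close>, which together give the product
      formula.\<close>
    define G1 where "G1 = (\<lambda>e. restrict e J) -` G \<inter> space ?N"
    define G2 where "G2 = (\<lambda>e. restrict e ?\<psi>) -` G' \<inter> space ?N"
    have "(\<lambda>e. restrict e J) \<in> ?N \<rightarrow>\<^sub>M Pi\<^sub>M J (\<lambda>_. borel)"
      by (intro measurable_restrict_subset) (auto simp: J_def)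
    then have G1: "G1 \<in> sets ?N" unfolding G1_def using G by (rule measurable_sets)
    have "(\<lambda>e. restrict e ?\<psi>) \<in> ?N \<rightarrow>\<^sub>M Pi\<^sub>M ?\<psi> (\<lambda>_. borel)"
      by (intro measurable_restrict_subset \<psi>)
    then have G2: "G2 \<in> sets ?N" unfolding G2_def using G' by (rule measurable_sets)
    have sub: "restrict (ev \<omega>) J = restrict (\<lambda>i. \<epsilon> i \<omega>) J" "restrict (ev \<omega>) ?\<psi> = restrict (\<lambda>i. \<epsilon> i \<omega>) ?\<psi>" for \<omega>
      using \<psi> by (auto simp: ev_def J_def fun_eq_iff)
    have A1: "A = ev -` G1 \<inter> space M" and F2: "F h = ev -` G2 \<inter> space M"
      using measurable_space[OF ev] by (auto simp: A_def FA G1_def G2_def sub)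
    then have AF12: "A \<inter> F h = ev -` (G1 \<inter> G2) \<inter> space M" by auto
    \<comment> \<open>\<open>p\<close> is extensional, so its singleton is a finite product of
      singletons and hence measurable.\<close>
    have "{p} = Pi\<^sub>E {1..T} (\<lambda>t. {p t})" using p by (subst PiE_singleton) (auto simp: P_def PiE_def)
    also have "\<dots> \<in> sets ?N'" by (intro sets_PiM_I_finite) auto
    finally have p': "{p} \<in> sets ?N'" .
    have pk_eq: "{\<omega> \<in> space M. pk \<omega> = p} = pk -` {p} \<inter> space M" by auto
    have "prob (A \<inter> {\<omega> \<in> space M. pk \<omega> = p}) = prob A * prob {\<omega> \<in> space M. pk \<omega> = p}"
      unfolding pk_eq using G1 p' A1 by (intro indep_setD[OF ev_pk]) auto
    moreover have "prob ((A \<inter> F h) \<inter> {\<omega> \<in> space M. pk \<omega> = p}) = prob (A \<inter> F h) * prob {\<omega> \<in> space M. pk \<omega> = p}"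
      unfolding pk_eq using G1 G2 p' AF12 by (intro indep_setD[OF ev_pk]) blast+
    moreover have "E p h \<inter> F h = (A \<inter> F h) \<inter> {\<omega> \<in> space M. pk \<omega> = p}" "E p h = A \<inter> {\<omega> \<in> space M. pk \<omega> = p}"
      using EA by auto
    moreover have "{\<omega> \<in> space M. pk \<omega> = p} \<in> events" unfolding pk_eq using pk p' by (rule measurable_sets)
    moreover have "A \<in> events" "F h \<in> events"
      unfolding A1 F2 using G1 G2 by (auto intro: measurable_sets[OF ev])
    ultimately show ?thesis by (simp add: AF)
  qed
  have F_le: "prob (F h) \<le> ?q" for h
  proof -
    have \<psi>: "level_set h t s \<subseteq> {1..T}" using t by (auto simp: level_set_def)
    show ?thesis unfolding F_def
      by (rule sub_gaussian_sum_tail[OF indep_vars_subset[OF indep \<psi>]])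
        (use \<psi> sg sqrt_beta sigma_pos in auto)
  qed
  let ?I = "P \<times> (histories s t :: 'a history set)"
  have finI: "finite ?I" using finP finite_histories by (rule finite_cartesian_product)
  define D where "D = (\<Union>(p, h)\<in>?I. E p h \<inter> F h)"
  have disj: "disjoint_family_on (\<lambda>(p, h). E p h) ?I"
    unfolding disjoint_family_on_def
  proof (intro ballI impI)
    fix x y assume xy: "x \<in> ?I" "y \<in> ?I" "x \<noteq> y"
    obtain p h p' h' where xy': "x = (p, h)" "y = (p', h')" by (cases x; cases y)
    show "(case x of (p, h) \<Rightarrow> E p h) \<inter> (case y of (p, h) \<Rightarrow> E p h) = {}"
    proof (rule ccontr)
      assume "(case x of (p, h) \<Rightarrow> E p h) \<inter> (case y of (p, h) \<Rightarrow> E p h) \<noteq> {}"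
      then obtain \<omega> where \<omega>: "\<omega> \<in> E p h" "\<omega> \<in> E p' h'" by (auto simp: xy')
      then have "p = p'" by (simp add: E_def)
      moreover have "h = h'"
        using \<omega> xy xy' by (intro outcome_unique[of h s t h' p "\<lambda>i. \<epsilon> i \<omega>"]) (auto simp: E_def)
      ultimately show False using xy xy' by simp
    qed
  qed
  have "prob D \<le> (\<Sum>(p, h)\<in>?I. prob (E p h \<inter> F h))"
    unfolding D_def case_prod_unfold by (rule measure_UNION_le[OF finI]) (use EF in auto)
  also have "\<dots> \<le> (\<Sum>(p, h)\<in>?I. prob (E p h) * ?q)"
    using F_le by (intro sum_mono) (auto simp: EF intro!: mult_left_mono)
  also have "\<dots> = prob (\<Union>(p, h)\<in>?I. E p h) * ?q"
  proof -
    have "prob (\<Union>x\<in>?I. (\<lambda>(p, h). E p h) x) = (\<Sum>x\<in>?I. prob ((\<lambda>(p, h). E p h) x))"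
      using EF by (intro finite_measure_finite_Union[OF finI _ disj]) auto
    then show ?thesis by (simp add: sum_distrib_right case_prod_unfold)
  qed
  also have "\<dots> \<le> 1 * ?q" by (intro mult_right_mono) auto
  finally have D_le: "prob D \<le> ?q" by simp
  show ?thesis
  proof (intro bexI[of _ D] conjI ballI impI D_le)
    show "D \<in> events" unfolding D_def using finI EF by (intro sets.finite_UN) auto
  next
    fix \<omega> h assume \<omega>: "\<omega> \<in> space M" and h: "h \<in> histories s t"
      and ok: "\<forall>i\<in>{1..<t}. outcome_ok s (\<lambda>i. pick i \<omega>) (\<lambda>i. \<epsilon> i \<omega>) h i"
      and bad: "width h t s b < \<bar>mean (\<lambda>i. \<epsilon> i \<omega>) h t s b - f (arm t b)\<bar>"
    have "outcome_ok s (pk \<omega>) (\<lambda>i. \<epsilon> i \<omega>) h i" if "i \<in> {1..<t}" for i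
    proof -
      have "i \<in> {1..T}" using that t by auto
      from outcome_ok_restrict[OF this, THEN iffD1] show ?thesis
        unfolding pk_def using ok that by blast
    qed
    then have "\<omega> \<in> E (pk \<omega>) h" using \<omega> by (simp add: E_def)
    moreover have "\<omega> \<in> F h" using \<omega> large_noise_if_inaccurate[OF t bad] by (simp add: F_def)
    ultimately show "\<omega> \<in> D" using pkP h by (auto simp: D_def)
  qed
qed

end


section \<open>Regret\<close>

lemma half_le_ln_one_plus: "0 \<le> x \<Longrightarrow> x \<le> 1 / 2 \<Longrightarrow> x / 2 \<le> ln (1 + x)" for x :: real
proof -
  assume x: "0 \<le> x" "x \<le> 1 / 2"
  have "x\<^sup>2 \<le> x * (1 / 2)" unfolding power2_eq_square using x by (intro mult_left_mono) auto
  then show "x / 2 \<le> ln (1 + x)" using ln_one_plus_pos_lower_bound[of x] x by linarith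
qed

context bandit
begin

text \<open>The full behaviour of a run in round \<open>t\<close>. Unlike in
  \<open>outcome_ok\<close>, all \<open>S\<close> levels count, and \<open>None\<close> means that
  the round ended at a level where all actions are certain.\<close>

definition follows :: "(nat \<Rightarrow> 'a set \<Rightarrow> 'a) \<Rightarrow> (nat \<Rightarrow> real) \<Rightarrow> (nat \<Rightarrow> 'a) \<Rightarrow> 'a history \<Rightarrow> nat \<Rightarrow> bool" where
  "follows p e a h t \<longleftrightarrow> (case h t of
      Some (s, b) \<Rightarrow> s \<in> {1..S} \<and> b = a t \<and> (\<exists>A. explores \<sigma> T (mean e h t) (width h t) s A \<and>
        a t = p t {b \<in> A. width h t s b > \<sigma> * 2 powr (- real s)})
    | None \<Rightarrow> \<exists>s\<in>{1..S}. \<exists>A. visits \<sigma> T (mean e h t) (width h t) s A \<and> all_certain \<sigma> T (width h t) s A \<and>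
        is_arg_max (\<lambda>b. mean e h t s b + width h t s b) (\<lambda>b. b \<in> A) (a t))"

text \<open>The index sets of the run are encoded in one history. By induction over the rounds its
  level sets are the \<open>\<Psi> t s\<close>, and on them \<open>point h\<close> gives the inputs
  actually played, so means and widths agree with those of the run.\<close>

lemma run_history:
  assumes run: "sup_ucb_run k \<sigma> (\<lambda>_. \<beta>) T arm p (\<lambda>t. f (arm t (a t)) + e t) a" and S: "S = num_levels T"
  shows "\<exists>h. \<forall>t\<in>{1..T}. follows p e a h t"
proof -
  let ?x = "\<lambda>i. arm i (a i)" and ?y = "\<lambda>t. f (arm t (a t)) + e t"
  obtain \<Psi> where \<Psi>0: "\<And>s. \<Psi> 1 s = {}"
    and round: "\<And>t. t \<in> {1..T} \<Longrightarrow> sup_ucb_round \<sigma> T (\<lambda>s b. post_mean k \<sigma> ?x ?y (\<Psi> t s) (arm t b))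
         (\<lambda>s b. sqrt \<beta> * post_sd k \<sigma> ?x (\<Psi> t s) (arm t b)) (p t) t (\<Psi> t) (a t) (\<Psi> (Suc t))"
    using run unfolding sup_ucb_run_def by blast
  define \<mu> where "\<mu> t = (\<lambda>s b. post_mean k \<sigma> ?x ?y (\<Psi> t s) (arm t b))" for t
  define w where "w t = (\<lambda>s b. sqrt \<beta> * post_sd k \<sigma> ?x (\<Psi> t s) (arm t b))" for t
  define Q where "Q t o' \<longleftrightarrow> (case o' of
      Some s \<Rightarrow> s \<in> {1..S} \<and> (\<exists>A. explores \<sigma> T (\<mu> t) (w t) s A \<and> a t = p t {b \<in> A. w t s b > \<sigma> * 2 powr (- real s)}) \<and>
        \<Psi> (Suc t) = (\<Psi> t)(s := \<Psi> t s \<union> {t})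
    | None \<Rightarrow> (\<exists>s\<in>{1..S}. \<exists>A. visits \<sigma> T (\<mu> t) (w t) s A \<and> all_certain \<sigma> T (w t) s A \<and>
        is_arg_max (\<lambda>b. \<mu> t s b + w t s b) (\<lambda>b. b \<in> A) (a t)) \<and> \<Psi> (Suc t) = \<Psi> t)" for t o'
  have "\<exists>o'. Q t o'" if t: "t \<in> {1..T}" for t
  proof -
    obtain s A where s: "1 \<le> s" "s \<le> S" and A: "visits \<sigma> T (\<mu> t) (w t) s A"
      and cases: "all_certain \<sigma> T (w t) s A \<and> is_arg_max (\<lambda>b. \<mu> t s b + w t s b) (\<lambda>b. b \<in> A) (a t) \<and> \<Psi> (Suc t) = \<Psi> t
       \<or> \<not> all_certain \<sigma> T (w t) s A \<and> \<not> all_narrow \<sigma> (w t) s A \<and>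
         a t = p t {b \<in> A. w t s b > \<sigma> * 2 powr (- real s)} \<and> \<Psi> (Suc t) = (\<Psi> t)(s := \<Psi> t s \<union> {t})"
      using round[OF t, folded \<mu>_def w_def] unfolding sup_ucb_round_def S by blast
    from cases show ?thesis
    proof
      assume "all_certain \<sigma> T (w t) s A \<and> is_arg_max (\<lambda>b. \<mu> t s b + w t s b) (\<lambda>b. b \<in> A) (a t) \<and> \<Psi> (Suc t) = \<Psi> t"
      then have "Q t None" using s A unfolding Q_def by auto
      then show ?thesis ..
    next
      assume "\<not> all_certain \<sigma> T (w t) s A \<and> \<not> all_narrow \<sigma> (w t) s A \<and>
         a t = p t {b \<in> A. w t s b > \<sigma> * 2 powr (- real s)} \<and> \<Psi> (Suc t) = (\<Psi> t)(s := \<Psi> t s \<union> {t})"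
      then have "Q t (Some s)" using s A unfolding Q_def explores_def by auto
      then show ?thesis ..
    qed
  qed
  then have "\<forall>t\<in>{1..T}. \<exists>o'. Q t o'" by blast
  from bchoice[OF this] obtain oc where oc: "\<And>t. t \<in> {1..T} \<Longrightarrow> Q t (oc t)" by blast
  define h where "h t = (if t \<in> {1..T} then map_option (\<lambda>s. (s, a t)) (oc t) else None)" for t
  have ls: "\<Psi> t s = level_set h t s" if "t \<in> {1..Suc T}" for t s
    using that
  proof (induction t)
    case (Suc t)
    show ?case
    proof (cases "t = 0")
      case True
      then show ?thesis using \<Psi>0 by (simp add: level_set_def)
    next
      case False
      then have t: "t \<in> {1..T}" using Suc.prems by auto
      have step: "level_set h (Suc t) s = (if \<exists>b. h t = Some (s, b) then insert t (level_set h t s) else level_set h t s)"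
        using t by (auto simp: level_set_def less_Suc_eq)
      have IH: "\<Psi> t s = level_set h t s" using Suc t by auto
      show ?thesis
        using oc[OF t] t unfolding step Q_def by (cases "oc t") (auto simp: h_def IH)
    qed
  qed simp
  have pt: "?x i = point h i" if "i \<in> level_set h t s" for i t s
    using that by (auto simp: level_set_def point_def h_def split: if_splits)
  have \<mu>: "\<mu> t = mean e h t" and w: "w t = width h t" if "t \<in> {1..T}" for t
  proof -
    show "\<mu> t = mean e h t"
    proof (intro ext)
      fix s b
      show "\<mu> t s b = mean e h t s b"
        unfolding \<mu>_def mean_def using that ls[of t s] by (simp, intro post_mean_cong) (auto dest: pt)
    qed
    show "w t = width h t"
    proof (intro ext)
      fix s b
      have "map ?x (sorted_list_of_set (\<Psi> t s)) = map (point h) (sorted_list_of_set (level_set h t s))"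
        using that ls[of t s] pt by simp
      then show "w t s b = width h t s b"
        unfolding w_def width_def by (intro arg_cong2[where f="(*)"] refl post_sd_cong)
    qed
  qed
  have "follows p e a h t" if t: "t \<in> {1..T}" for t
    using oc[OF t] t unfolding Q_def follows_def \<mu>[OF t] w[OF t] by (cases "oc t") (auto simp: h_def)
  then show ?thesis by blast
qed

section \<open>Regret of a single round\<close>

definition accurate :: "(nat \<Rightarrow> real) \<Rightarrow> 'a history \<Rightarrow> nat \<Rightarrow> bool" where
  "accurate e h t \<longleftrightarrow> (\<forall>s\<in>{1..S}. \<forall>b. \<bar>mean e h t s b - f (arm t b)\<bar> \<le> width h t s b)"

text \<open>By the reproducing property \<open>f\<close> is bounded by
  \<open>B * sqrt \<kappa>\<close> on \<open>X\<close>.\<close>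

definition max_gap :: real where
  "max_gap = 2 * B * sqrt \<kappa>"

definition gap :: "(nat \<Rightarrow> 'a) \<Rightarrow> nat \<Rightarrow> real" where
  "gap a t = Max (range (\<lambda>b. f (arm t b))) - f (arm t (a t))"

lemma gap_eq:
  obtains b0 where "gap a t = f (arm t b0) - f (arm t (a t))" "\<And>b. f (arm t b) \<le> f (arm t b0)"
proof -
  have "Max (range (\<lambda>b. f (arm t b))) \<in> range (\<lambda>b. f (arm t b))" by (intro Max_in) auto
  then obtain b0 where b0: "Max (range (\<lambda>b. f (arm t b))) = f (arm t b0)" by (rule rangeE)
  show ?thesis
  proof
    show "gap a t = f (arm t b0) - f (arm t (a t))" by (simp add: gap_def b0)
    show "f (arm t b) \<le> f (arm t b0)" for b unfolding b0[symmetric] by (intro Max_ge) auto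
  qed
qed

lemma gap_le_max_gap:
  assumes "t \<in> {1..T}"
  shows "gap a t \<le> max_gap" "0 \<le> max_gap"
proof -
  have *: "\<bar>f (arm t b)\<bar> \<le> B * sqrt \<kappa>" for b
  proof -
    have "\<bar>f (arm t b)\<bar> \<le> sqrt (ip f f) * sqrt (k (arm t b) (arm t b))"
      by (rule abs_eval_le[OF f_mem arm_mem[OF assms]])
    also have "\<dots> \<le> B * sqrt \<kappa>"
      using f_norm B_nonneg kappa[OF arm_mem[OF assms]] k_nonneg[OF arm_mem[OF assms]] by (intro mult_mono) auto
    finally show ?thesis .
  qed
  obtain b0 where "gap a t = f (arm t b0) - f (arm t (a t))" using gap_eq by blast
  then show "gap a t \<le> max_gap" using *[of b0] *[of "a t"] by (simp add: max_gap_def)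
  show "0 \<le> max_gap" using *[of "a t"] by (simp add: max_gap_def)
qed

text \<open>Optimism: the best action is still present, its index dominates its value, and the
  chosen index exceeds the value of the chosen action by at most two widths.\<close>

lemma gap_if_certain:
  assumes t: "t \<in> {1..T}" and acc: "accurate e h t" and fol: "follows p e a h t" and h: "h t = None"
  shows "gap a t \<le> 2 * \<sigma> / sqrt T"
proof -
  obtain b0 where b0: "gap a t = f (arm t b0) - f (arm t (a t))" "\<And>b. f (arm t b) \<le> f (arm t b0)"
    using gap_eq by blast
  obtain s A where s: "s \<in> {1..S}" and A: "visits \<sigma> T (mean e h t) (width h t) s A" "all_certain \<sigma> T (width h t) s A"
    "is_arg_max (\<lambda>b. mean e h t s b + width h t s b) (\<lambda>b. b \<in> A) (a t)"
    using fol h by (auto simp: follows_def)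
  have acc': "\<bar>mean e h t s' b - f (arm t b)\<bar> \<le> width h t s' b" if "s' \<in> {1..S}" for s' b
    using acc that by (auto simp: accurate_def)
  have "b0 \<in> A"
    using visits_accurate[OF A(1), of "\<lambda>b. f (arm t b)" b0] acc' s b0(2) by auto
  then have "mean e h t s b0 + width h t s b0 \<le> mean e h t s (a t) + width h t s (a t)" "a t \<in> A"
    using A(3) by (auto simp: is_arg_max_linorder)
  moreover have "width h t s (a t) \<le> \<sigma> / sqrt T" using A(2) \<open>a t \<in> A\<close> by (simp add: all_certain_def)
  ultimately show ?thesis using acc'[OF s, of b0] acc'[OF s, of "a t"] b0(1) by linarith
qed

lemma explored:
  assumes fol: "follows p e a h t" and h: "h t = Some (s, b)" and p: "\<And>Q. Q \<noteq> {} \<Longrightarrow> p t Q \<in> Q"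
  shows "b = a t" "s \<in> {1..S}" "\<sigma> * 2 powr (- real s) < width h t s (a t)"
    "\<exists>A. a t \<in> A \<and> visits \<sigma> T (mean e h t) (width h t) s A"
proof -
  obtain A where A: "explores \<sigma> T (mean e h t) (width h t) s A"
      "a t = p t {b \<in> A. width h t s b > \<sigma> * 2 powr (- real s)}" and *: "b = a t" "s \<in> {1..S}"
    using fol h by (auto simp: follows_def)
  have "{b \<in> A. width h t s b > \<sigma> * 2 powr (- real s)} \<noteq> {}"
    using A(1) by (auto simp: explores_def all_narrow_def not_le)
  then have "a t \<in> {b \<in> A. width h t s b > \<sigma> * 2 powr (- real s)}" using p A(2) by metis
  then show "b = a t" "s \<in> {1..S}" "\<sigma> * 2 powr (- real s) < width h t s (a t)"
      "\<exists>A. a t \<in> A \<and> visits \<sigma> T (mean e h t) (width h t) s A"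
    using A(1) * by (auto simp: explores_def)
qed

lemma gap_if_explored:
  assumes t: "t \<in> {1..T}" and acc: "accurate e h t" and fol: "follows p e a h t" and h: "h t = Some (s, b)"
    and p: "\<And>Q. Q \<noteq> {} \<Longrightarrow> p t Q \<in> Q"
  shows "gap a t \<le> (8 * \<sigma> + 2 * max_gap) * 2 powr (- real s)"
proof -
  obtain b0 where b0: "gap a t = f (arm t b0) - f (arm t (a t))" "\<And>b. f (arm t b) \<le> f (arm t b0)"
    using gap_eq by blast
  note ex = explored[OF fol h p]
  obtain A where A: "a t \<in> A" "visits \<sigma> T (mean e h t) (width h t) s A" using ex(4) by blast
  have acc': "\<bar>mean e h t s' b - f (arm t b)\<bar> \<le> width h t s' b" if "s' \<in> {1..S}" for s' b
    using acc that by (auto simp: accurate_def)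
  show ?thesis
  proof (cases "s = 1")
    \<comment> \<open>No elimination precedes level 1, so only the trivial bound is available; the
      summand \<open>2 * max_gap\<close> of the constant compensates for the factor 1/2.\<close>
    case True
    then have "(8 * \<sigma> + 2 * max_gap) * 2 powr (- real s) = 4 * \<sigma> + max_gap"
      by (simp add: powr_minus)
    then show ?thesis using gap_le_max_gap(1)[OF t, of a] sigma_pos by simp
  next
    case False
    then have "gap a t \<le> 8 * \<sigma> * 2 powr (- real s)"
      using visits_accurate[OF A(2), of "\<lambda>b. f (arm t b)" b0] acc' ex(2) b0 A(1) by auto
    moreover have "0 \<le> 2 * max_gap * 2 powr (- real s)" using gap_le_max_gap(2)[OF t] by simp
    ultimately show ?thesis by (simp add: distrib_right)
  qed
qed

text \<open>Each exploration at level \<open>s\<close> has width above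
  \<open>\<sigma> * 2 powr (- s)\<close>, so it contributes at least
  \<open>4 powr (- s) / (2 * \<beta>)\<close> to the sum of logarithms, which is at most twice the
  information gain. The regret of the level is proportional to the product bounded here, and the
  bound is the same for all levels.\<close>

lemma card_level_set_le:
  assumes fol: "\<And>t. t \<in> {1..T} \<Longrightarrow> follows p e a h t" and p: "\<And>t Q. t \<in> {1..T} \<Longrightarrow> Q \<noteq> {} \<Longrightarrow> p t Q \<in> Q"
    and \<beta>: "1 \<le> \<beta>" and T: "1 \<le> T" and s: "1 \<le> s"
  shows "card (level_set h (Suc T) s) * 2 powr (- real s) \<le> 2 * sqrt T * sqrt (\<beta> * info_gain k \<sigma> X T)"
proof -
  let ?E = "level_set h (Suc T) s" and ?\<gamma> = "info_gain k \<sigma> X T" and ?x = "2 powr (- real s)"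
  have ET: "?E \<subseteq> {1..T}" by (auto simp: level_set_def)
  have pts: "\<And>t. t \<in> ?E \<Longrightarrow> point h t \<in> X" by (rule level_set_points[of "Suc T"]) auto
  have X: "X \<noteq> {}" using arm_mem[of 1] T by auto
  \<comment> \<open>Together with \<open>\<beta> \<ge> 1\<close> this puts
    \<open>?x\<^sup>2 / \<beta>\<close> in the range of \<open>half_le_ln_one_plus\<close>.\<close>
  have x: "0 < ?x" "?x\<^sup>2 \<le> 1 / 2"
  proof -
    have "?x \<le> 2 powr (- 1)" using s by (intro powr_mono) auto
    also have "\<dots> = 1 / 2" by (simp add: powr_minus)
    finally have "?x \<le> 1 / 2" .
    then have "?x\<^sup>2 \<le> (1 / 2)\<^sup>2" by (intro power_mono) auto
    also have "\<dots> \<le> 1 / 2" by (simp add: power2_eq_square)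
    finally show "?x\<^sup>2 \<le> 1 / 2" .
  qed simp
  have term_ge: "?x\<^sup>2 / \<beta> / 2 \<le> ln (1 + (post_sd k \<sigma> (point h) (?E \<inter> {..<t}) (point h t))\<^sup>2 / \<sigma>\<^sup>2)" if t: "t \<in> ?E" for t
  proof -
    have tT: "t \<in> {1..T}" using t ET by auto
    obtain b where b: "h t = Some (s, b)" using t by (auto simp: level_set_def)
    note ex = explored[OF fol[OF tT] b p[OF tT]]
    have "?E \<inter> {..<t} = level_set h t s" using tT by (auto simp: level_set_def)
    moreover have "point h t = arm t (a t)" using b ex(1) by (simp add: point_def)
    ultimately have "width h t s (a t) = sqrt \<beta> * post_sd k \<sigma> (point h) (?E \<inter> {..<t}) (point h t)"
      by (simp add: width_def)
    then have "\<sigma> * ?x \<le> sqrt \<beta> * post_sd k \<sigma> (point h) (?E \<inter> {..<t}) (point h t)" (is "_ \<le> _ * ?sd")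
      using ex(3) by simp
    then have "(\<sigma> * ?x)\<^sup>2 \<le> (sqrt \<beta> * ?sd)\<^sup>2" using sigma_pos x by (intro power_mono) auto
    then have "\<sigma>\<^sup>2 * ?x\<^sup>2 \<le> \<beta> * ?sd\<^sup>2" using \<beta> by (simp add: power_mult_distrib)
    then have le: "?x\<^sup>2 / \<beta> \<le> ?sd\<^sup>2 / \<sigma>\<^sup>2" using \<beta> sigma_pos by (simp add: field_simps)
    have "?x\<^sup>2 / \<beta> \<le> ?x\<^sup>2 / 1" using \<beta> by (intro divide_left_mono) auto
    then have "?x\<^sup>2 / \<beta> \<le> 1 / 2" using x(2) by linarith
    then have "?x\<^sup>2 / \<beta> / 2 \<le> ln (1 + ?x\<^sup>2 / \<beta>)" using \<beta> by (intro half_le_ln_one_plus) auto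
    also have "\<dots> \<le> ln (1 + ?sd\<^sup>2 / \<sigma>\<^sup>2)" using le \<beta> by (intro ln_mono) (auto intro!: add_pos_nonneg)
    finally show ?thesis .
  qed
  have "card ?E * (?x\<^sup>2 / \<beta> / 2) \<le> (\<Sum>t\<in>?E. ln (1 + (post_sd k \<sigma> (point h) (?E \<inter> {..<t}) (point h t))\<^sup>2 / \<sigma>\<^sup>2))"
    using sum_mono[of ?E "\<lambda>_. ?x\<^sup>2 / \<beta> / 2", OF term_ge] by simp
  also have "\<dots> \<le> 2 * ?\<gamma>"
    by (rule sum_ln_post_sd_le_info_gain[OF sigma_pos kappa X ET pts])
  finally have n: "card ?E * ?x\<^sup>2 \<le> 4 * (\<beta> * ?\<gamma>)" using \<beta> by (simp add: field_simps)
  \<comment> \<open>One factor \<open>card ?E\<close> is traded for \<open>T\<close>; the root then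
    gives the geometric mean of \<open>T\<close> and
    \<open>4 * (\<beta> * ?\<gamma>)\<close>.\<close>
  have "(card ?E * ?x)\<^sup>2 = card ?E * (card ?E * ?x\<^sup>2)" by (simp add: power2_eq_square)
  also have "\<dots> \<le> T * (4 * (\<beta> * ?\<gamma>))"
    using n card_mono[OF _ ET] by (intro mult_mono[of "real (card ?E)" "real T"]) (simp_all only: of_nat_le_iff, simp_all)
  finally have "card ?E * ?x \<le> sqrt (T * (4 * (\<beta> * ?\<gamma>)))" by (rule real_le_rsqrt)
  then show ?thesis by (simp add: real_sqrt_mult)
qed

text \<open>Every round is charged to one of three terms: inaccurate rounds pay the maximal gap,
  accurate rounds without exploration pay \<open>2 * \<sigma> / sqrt T\<close>, and accurate
  explorations pay by level. All terms are nonnegative, so they are added in each round, and the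
  sums over rounds and levels are exchanged.\<close>

lemma regret_le:
  assumes fol: "\<And>t. t \<in> {1..T} \<Longrightarrow> follows p e a h t" and p: "\<And>t Q. t \<in> {1..T} \<Longrightarrow> Q \<noteq> {} \<Longrightarrow> p t Q \<in> Q"
    and \<beta>: "1 \<le> \<beta>" and T: "1 \<le> T"
  shows "regret f arm T a \<le> card {t \<in> {1..T}. \<not> accurate e h t} * max_gap + 2 * \<sigma> * sqrt T
    + (8 * \<sigma> + 2 * max_gap) * S * (2 * sqrt T * sqrt (\<beta> * info_gain k \<sigma> X T))"
proof -
  let ?C = "8 * \<sigma> + 2 * max_gap" and ?E = "\<lambda>s. level_set h (Suc T) s"
  have mg: "0 \<le> max_gap" using gap_le_max_gap(2)[of 1] T by auto
  have C: "0 \<le> ?C" using mg sigma_pos by simp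
  have gap: "gap a t \<le> (if accurate e h t then 0 else max_gap) + 2 * \<sigma> / sqrt T
      + (\<Sum>s\<in>{1..S}. if t \<in> ?E s then ?C * 2 powr (- real s) else 0)" if t: "t \<in> {1..T}" for t
  proof -
    have s0: "0 \<le> (\<Sum>s\<in>{1..S}. if t \<in> ?E s then ?C * 2 powr (- real s) else 0)"
      using C by (intro sum_nonneg) auto
    have \<sigma>T: "0 \<le> 2 * \<sigma> / sqrt T" using sigma_pos by simp
    show ?thesis
    proof (cases "accurate e h t")
      case False
      then show ?thesis using gap_le_max_gap(1)[OF t, of a] s0 \<sigma>T by simp
    next
      case acc: True
      show ?thesis
      proof (cases "h t")
        case None
        then show ?thesis using gap_if_certain[OF t acc fol[OF t]] acc s0 by simp
      next
        case (Some sb)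
        then obtain s b where sb: "h t = Some (s, b)" by (cases sb) auto
        have s: "s \<in> {1..S}" by (rule explored(2)[OF fol[OF t] sb p[OF t]])
        have "gap a t \<le> (if t \<in> ?E s then ?C * 2 powr (- real s) else 0)"
          using gap_if_explored[OF t acc fol[OF t] sb p[OF t]] t sb by (simp add: level_set_def)
        also have "\<dots> \<le> (\<Sum>s\<in>{1..S}. if t \<in> ?E s then ?C * 2 powr (- real s) else 0)"
          using s C by (intro member_le_sum) auto
        finally show ?thesis using acc \<sigma>T by simp
      qed
    qed
  qed
  have "regret f arm T a = (\<Sum>t=1..T. gap a t)" by (simp add: regret_def gap_def)
  also have "\<dots> \<le> (\<Sum>t=1..T. (if accurate e h t then 0 else max_gap) + 2 * \<sigma> / sqrt T
      + (\<Sum>s\<in>{1..S}. if t \<in> ?E s then ?C * 2 powr (- real s) else 0))"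
    by (intro sum_mono gap)
  also have "\<dots> = (\<Sum>t=1..T. if accurate e h t then 0 else max_gap) + T * (2 * \<sigma> / sqrt T)
      + (\<Sum>t=1..T. \<Sum>s\<in>{1..S}. if t \<in> ?E s then ?C * 2 powr (- real s) else 0)"
    by (simp add: sum.distrib)
  also have "(\<Sum>t=1..T. if accurate e h t then 0 else max_gap) = card {t \<in> {1..T}. \<not> accurate e h t} * max_gap"
  proof -
    have "(\<Sum>t=1..T. if accurate e h t then 0 else max_gap) = (\<Sum>t\<in>{t \<in> {1..T}. \<not> accurate e h t}. max_gap)"
      by (rule sum.mono_neutral_cong_right) auto
    then show ?thesis by simp
  qed
  also have "T * (2 * \<sigma> / sqrt T) = 2 * \<sigma> * sqrt T"
    using T by (simp add: field_simps)
  also have "(\<Sum>t=1..T. \<Sum>s\<in>{1..S}. if t \<in> ?E s then ?C * 2 powr (- real s) else 0) =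
      (\<Sum>s\<in>{1..S}. ?C * (card (?E s) * 2 powr (- real s)))"
  proof -
    have "(\<Sum>t=1..T. if t \<in> ?E s then ?C * 2 powr (- real s) else 0) = ?C * (card (?E s) * 2 powr (- real s))" for s
    proof -
      have "{1..T} \<inter> ?E s = ?E s" by (auto simp: level_set_def)
      then have "(\<Sum>t=1..T. if t \<in> ?E s then ?C * 2 powr (- real s) else 0) = (\<Sum>t\<in>?E s. ?C * 2 powr (- real s))"
        using sum.inter_restrict[of "{1..T}" "\<lambda>_. ?C * 2 powr (- real s)" "?E s"] by (simp only: finite_atLeastAtMost)
      then show ?thesis by (simp only: sum_constant mult.left_commute)
    qed
    then show ?thesis by (subst sum.swap) simp
  qed
  also have "\<dots> \<le> (\<Sum>s\<in>{1..S}. ?C * (2 * sqrt T * sqrt (\<beta> * info_gain k \<sigma> X T)))"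
    using card_level_set_le[where p=p and e=e and a=a and h=h, OF fol p \<beta> T] C
    by (intro sum_mono mult_left_mono) auto
  also have "\<dots> = ?C * S * (2 * sqrt T * sqrt (\<beta> * info_gain k \<sigma> X T))" by simp
  finally show ?thesis by linarith
qed

end

section \<open>From inaccurate means to the regret in probability\<close>

context bandit
begin

text \<open>Truncation does not alter the level sets up to \<open>s\<close>, so the algorithm
  behaves identically there; and a round that explored above \<open>s\<close>, or found all actions
  certain, explores at no level up to \<open>s\<close>.\<close>

lemma cut_history_follows:
  assumes fol: "\<And>i. i \<in> {1..T} \<Longrightarrow> follows p e a h i" and t: "t \<le> Suc T"
  shows "cut_history s t h \<in> histories s t" "i \<in> {1..<t} \<Longrightarrow> outcome_ok s p e (cut_history s t h) i"
proof -
  let ?h = "cut_history s t h"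
  have lev: "s' \<in> {1..S}" if "h i = Some (s', b)" "i \<in> {1..<t}" for i s' b
    using fol[of i] that t by (auto simp: follows_def)
  have "?h i \<in> insert None (Some ` ({1..s} \<times> UNIV))" if "i \<in> {1..<t}" for i
    using lev[OF _ that] by (auto simp: cut_history_def split: option.splits)
  moreover have "?h i = None" if "i \<notin> {1..<t}" for i
    using that by (auto simp: cut_history_def split: option.splits)
  ultimately show "?h \<in> histories s t" by (simp add: histories_def)
  assume i: "i \<in> {1..<t}"
  have agree: "?h j = h j" if "j \<in> level_set h i s'" "s' \<le> s" for j s'
    using that i by (auto simp: level_set_def cut_history_def)
  have m: "mean e ?h i s' = mean e h i s'" and w: "width ?h i s' = width h i s'" if "s' \<le> s" for s'
  proof -
    have ls: "level_set ?h i s' = level_set h i s'" using i that by (intro level_set_cut_history) auto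
    show "mean e ?h i s' = mean e h i s'" using agree[OF _ that] by (intro mean_cong ls) (simp add: ls)
    show "width ?h i s' = width h i s'" using agree[OF _ that] by (intro width_cong ls) (simp add: ls)
  qed
  have ex: "explores \<sigma> T (mean e ?h i) (width ?h i) s' A \<longleftrightarrow> explores \<sigma> T (mean e h i) (width h i) s' A" if "s' \<le> s" for s' A
    using that by (intro explores_cong m w) auto
  have fi: "follows p e a h i" using i t by (intro fol) auto
  show "outcome_ok s p e ?h i"
  proof (cases "h i")
    case None
    then have "?h i = None" by (simp add: cut_history_def)
    moreover have "\<not> explores \<sigma> T (mean e h i) (width h i) s' A" for s' A
      using fi None not_explores_if_certain[of \<sigma> T "mean e h i" "width h i"] by (auto simp: follows_def)
    ultimately show ?thesis using ex by (auto simp: outcome_ok_def)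
  next
    case (Some sb)
    then obtain s1 b1 where sb: "h i = Some (s1, b1)" by (cases sb) auto
    then obtain A1 where A1: "explores \<sigma> T (mean e h i) (width h i) s1 A1"
        "b1 = p i {b \<in> A1. width h i s1 b > \<sigma> * 2 powr (- real s1)}"
      using fi by (auto simp: follows_def)
    show ?thesis
    proof (cases "s1 \<le> s")
      case True
      then have "?h i = Some (s1, b1)" using sb i by (simp add: cut_history_eq_Some_iff)
      then show ?thesis using A1 True ex[OF True] w[OF True] by (auto simp: outcome_ok_def)
    next
      case False
      then have "?h i = None" using sb by (simp add: cut_history_def)
      moreover have "\<not> explores \<sigma> T (mean e h i) (width h i) s' A" if "s' \<le> s" for s' A
        using explores_unique[OF A1(1), of s' A] that False by auto
      ultimately show ?thesis using ex by (auto simp: outcome_ok_def)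
    qed
  qed
qed

lemma mean_width_cut_history:
  assumes "i \<le> t"
  shows "mean e (cut_history s t h) i s = mean e h i s" "width (cut_history s t h) i s = width h i s"
proof -
  have ls: "level_set (cut_history s t h) i s = level_set h i s" using assms by (intro level_set_cut_history) auto
  have agree: "cut_history s t h j = h j" if "j \<in> level_set h i s" for j
    using that assms by (auto simp: level_set_def cut_history_def)
  show "mean e (cut_history s t h) i s = mean e h i s" using agree by (intro mean_cong ls) (simp add: ls)
  show "width (cut_history s t h) i s = width h i s" using agree by (intro width_cong ls) (simp add: ls)
qed

lemma regret_measurable:
  assumes "\<And>t. t \<in> {1..T} \<Longrightarrow> a t \<in> measurable M (count_space UNIV)"
  shows "(\<lambda>\<omega>. regret f arm T (\<lambda>t. a t \<omega>)) \<in> borel_measurable M"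
  unfolding regret_def
proof (intro borel_measurable_sum)
  fix t assume "t \<in> {1..T}"
  then show "(\<lambda>\<omega>. Max (range (\<lambda>b. f (arm t b))) - f (arm t (a t \<omega>))) \<in> borel_measurable M"
    using measurable_compose[OF assms, of t "\<lambda>b. Max (range (\<lambda>b. f (arm t b))) - f (arm t b)"] by simp
qed

text \<open>The bound of \<open>regret_le\<close> with \<open>sqrt T\<close> inaccurate
  rounds.\<close>

definition regret_bound :: real where
  "regret_bound = sqrt T * max_gap + 2 * \<sigma> * sqrt T
    + (8 * \<sigma> + 2 * max_gap) * S * (2 * sqrt T * sqrt (\<beta> * info_gain k \<sigma> X T))"

text \<open>The history is chosen separately for each \<open>\<omega>\<close>, so the number of
  inaccurate rounds is not itself treated as a random variable. It is dominated by \<open>N\<close>,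
  which counts the measurable covering events over all rounds, levels and actions, and Markov's
  inequality is applied to \<open>N\<close>.\<close>

lemma prob_regret_le:
  fixes M :: "'w measure"
  assumes M: "prob_space M" and noise: "iid_sub_gaussian_noise M {1..T} \<epsilon> (\<sigma>\<^sup>2)"
    and picks: "random_picks M T \<epsilon> pick"
    and a: "\<And>t. t \<in> {1..T} \<Longrightarrow> a t \<in> measurable M (count_space UNIV)"
    and run: "\<And>\<omega>. \<omega> \<in> space M \<Longrightarrow> sup_ucb_run k \<sigma> (\<lambda>_. \<beta>) T arm (\<lambda>t. pick t \<omega>) (\<lambda>t. f (arm t (a t \<omega>)) + \<epsilon> t \<omega>) (\<lambda>t. a t \<omega>)"
    and S: "S = num_levels T" and \<beta>: "1 \<le> \<beta>" and T: "1 \<le> T"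
  shows "1 - sqrt T * S * CARD('a) * (2 * exp (- (sqrt \<beta> - B)\<^sup>2 / 2)) \<le>
    measure M {\<omega> \<in> space M. regret f arm T (\<lambda>t. a t \<omega>) \<le> regret_bound}"
proof -
  interpret prob_space M by fact
  let ?q = "2 * exp (- (sqrt \<beta> - B)\<^sup>2 / 2)"
  let ?I = "{1..T} \<times> {1..S} \<times> (UNIV :: 'a set)"
  have "\<forall>x\<in>?I. \<exists>D. D \<in> sets M \<and> measure M D \<le> ?q \<and>
    (\<forall>\<omega>\<in>space M. \<forall>h\<in>histories (fst (snd x)) (fst x). (\<forall>i\<in>{1..<fst x}. outcome_ok (fst (snd x)) (\<lambda>i. pick i \<omega>) (\<lambda>i. \<epsilon> i \<omega>) h i) \<longrightarrow>
      width h (fst x) (fst (snd x)) (snd (snd x)) < \<bar>mean (\<lambda>i. \<epsilon> i \<omega>) h (fst x) (fst (snd x)) (snd (snd x)) - f (arm (fst x) (snd (snd x)))\<bar> \<longrightarrow> \<omega> \<in> D)"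
  proof
    fix x assume "x \<in> ?I"
    then have "fst x \<in> {1..T}" by auto
    from inaccurate_event[OF M noise picks this, of "fst (snd x)" "snd (snd x)"]
    show "\<exists>D. D \<in> sets M \<and> measure M D \<le> ?q \<and>
      (\<forall>\<omega>\<in>space M. \<forall>h\<in>histories (fst (snd x)) (fst x). (\<forall>i\<in>{1..<fst x}. outcome_ok (fst (snd x)) (\<lambda>i. pick i \<omega>) (\<lambda>i. \<epsilon> i \<omega>) h i) \<longrightarrow>
      width h (fst x) (fst (snd x)) (snd (snd x)) < \<bar>mean (\<lambda>i. \<epsilon> i \<omega>) h (fst x) (fst (snd x)) (snd (snd x)) - f (arm (fst x) (snd (snd x)))\<bar> \<longrightarrow> \<omega> \<in> D)"
      by blast
  qed
  from bchoice[OF this] obtain D where D_all: "\<forall>x\<in>?I. D x \<in> sets M \<and> prob (D x) \<le> ?q \<and>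
    (\<forall>\<omega>\<in>space M. \<forall>h\<in>histories (fst (snd x)) (fst x). (\<forall>i\<in>{1..<fst x}. outcome_ok (fst (snd x)) (\<lambda>i. pick i \<omega>) (\<lambda>i. \<epsilon> i \<omega>) h i) \<longrightarrow>
      width h (fst x) (fst (snd x)) (snd (snd x)) < \<bar>mean (\<lambda>i. \<epsilon> i \<omega>) h (fst x) (fst (snd x)) (snd (snd x)) - f (arm (fst x) (snd (snd x)))\<bar> \<longrightarrow> \<omega> \<in> D x)" ..
  have D: "\<omega> \<in> D (t, s, b)" if "t \<in> {1..T}" "s \<in> {1..S}" "\<omega> \<in> space M" "h \<in> histories s t"
      "\<And>i. i \<in> {1..<t} \<Longrightarrow> outcome_ok s (\<lambda>i. pick i \<omega>) (\<lambda>i. \<epsilon> i \<omega>) h i"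
      "width h t s b < \<bar>mean (\<lambda>i. \<epsilon> i \<omega>) h t s b - f (arm t b)\<bar>" for t s b \<omega> h
  proof -
    have "(t, s, b) \<in> ?I" using that by simp
    from bspec[OF D_all this] that show ?thesis unfolding fst_conv snd_conv by blast
  qed
  define N where "N \<omega> = (\<Sum>x\<in>?I. indicator (D x) \<omega> :: real)" for \<omega>
  have N_int: "integrable M N" and N_exp: "expectation N = (\<Sum>x\<in>?I. prob (D x))"
  proof -
    have "D x \<in> sets M" if "x \<in> ?I" for x using D_all that by blast
    then show "integrable M N" "expectation N = (\<Sum>x\<in>?I. prob (D x))"
      unfolding N_def by (auto intro!: Bochner_Integration.integrable_sum integrable_real_indicator simp: emeasure_eq_measure Bochner_Integration.integral_sum)
  qed
  have [measurable]: "N \<in> borel_measurable M" using N_int by (rule borel_measurable_integrable)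
  have "(\<Sum>x\<in>?I. prob (D x)) \<le> (\<Sum>x\<in>?I. ?q)"
    using D_all by (intro sum_mono) blast
  then have N_le: "expectation N \<le> T * S * CARD('a) * ?q" unfolding N_exp by (simp add: card_cartesian_product)
  have N0: "0 \<le> N \<omega>" for \<omega> unfolding N_def by (intro sum_nonneg) simp
  have "prob {\<omega> \<in> space M. sqrt T \<le> N \<omega>} \<le> expectation N / sqrt T"
    by (rule integral_Markov_inequality_measure[OF N_int, of "{}"]) (use N0 T in auto)
  also have "\<dots> \<le> T * S * CARD('a) * ?q / sqrt T" using N_le by (intro divide_right_mono) auto
  also have "\<dots> = (T / sqrt T) * (S * CARD('a) * ?q)" by simp
  also have "T / sqrt T = sqrt T" by (simp add: real_div_sqrt)
  finally have "1 - sqrt T * S * CARD('a) * ?q \<le> 1 - prob {\<omega> \<in> space M. sqrt T \<le> N \<omega>}"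
    by (simp add: mult.assoc)
  also have "\<dots> = prob {\<omega> \<in> space M. \<not> sqrt T \<le> N \<omega>}"
    by (rule prob_neg[symmetric]) measurable
  also have "\<dots> \<le> prob {\<omega> \<in> space M. regret f arm T (\<lambda>t. a t \<omega>) \<le> regret_bound}"
  proof (rule finite_measure_mono)
    show "{\<omega> \<in> space M. regret f arm T (\<lambda>t. a t \<omega>) \<le> regret_bound} \<in> events"
      by (intro borel_measurable_le regret_measurable a) auto
    show "{\<omega> \<in> space M. \<not> sqrt T \<le> N \<omega>} \<subseteq> {\<omega> \<in> space M. regret f arm T (\<lambda>t. a t \<omega>) \<le> regret_bound}"
    proof safe
      fix \<omega> assume \<omega>: "\<omega> \<in> space M" and "\<not> sqrt T \<le> N \<omega>"
      then have N_lt: "N \<omega> \<le> sqrt T" by simp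
      let ?e = "\<lambda>i. \<epsilon> i \<omega>" and ?p = "\<lambda>i. pick i \<omega>" and ?a = "\<lambda>t. a t \<omega>"
      obtain h where h: "\<And>t. t \<in> {1..T} \<Longrightarrow> follows ?p ?e ?a h t"
        using run_history[OF run[OF \<omega>] S] by blast
      have p: "?p t Q \<in> Q" if "t \<in> {1..T}" "Q \<noteq> {}" for t Q
        using picks that \<omega> by (auto simp: random_picks_def)
      have bad: "1 \<le> (\<Sum>y\<in>{1..S} \<times> UNIV. indicator (D (t, y)) \<omega> :: real)" if t: "t \<in> {1..T}" and "\<not> accurate ?e h t" for t
      proof -
        obtain s b where s: "s \<in> {1..S}" and sb: "width h t s b < \<bar>mean ?e h t s b - f (arm t b)\<bar>"
          using \<open>\<not> accurate ?e h t\<close> by (auto simp: accurate_def not_le)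
        have tT: "t \<le> Suc T" using t by auto
        \<comment> \<open>The covering events are stated for truncated histories; truncation changes
          neither mean nor width at level \<open>s\<close>.\<close>
        have "\<omega> \<in> D (t, s, b)"
        proof (rule D[OF t s \<omega>, of "cut_history s t h"])
          show "cut_history s t h \<in> histories s t" by (rule cut_history_follows(1)[OF h tT])
          show "outcome_ok s ?p ?e (cut_history s t h) i" if "i \<in> {1..<t}" for i
            by (rule cut_history_follows(2)[OF h tT that])
          show "width (cut_history s t h) t s b < \<bar>mean ?e (cut_history s t h) t s b - f (arm t b)\<bar>"
            using sb by (simp add: mean_width_cut_history)
        qed
        then have "1 = (indicator (D (t, (s, b))) \<omega> :: real)" by simp
        also have "\<dots> \<le> (\<Sum>y\<in>{1..S} \<times> UNIV. indicator (D (t, y)) \<omega>)"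
          using s by (intro member_le_sum) auto
        finally show ?thesis .
      qed
      have "real (card {t \<in> {1..T}. \<not> accurate ?e h t}) = (\<Sum>t\<in>{t \<in> {1..T}. \<not> accurate ?e h t}. 1)" by simp
      also have "\<dots> \<le> (\<Sum>t\<in>{t \<in> {1..T}. \<not> accurate ?e h t}. \<Sum>y\<in>{1..S} \<times> UNIV. indicator (D (t, y)) \<omega>)"
        using bad by (intro sum_mono) auto
      also have "\<dots> \<le> (\<Sum>t\<in>{1..T}. \<Sum>y\<in>{1..S} \<times> UNIV. indicator (D (t, y)) \<omega>)"
        by (intro sum_mono2) (auto intro!: sum_nonneg)
      also have "\<dots> = N \<omega>" unfolding N_def by (simp add: sum.cartesian_product case_prod_unfold)
      finally have "real (card {t \<in> {1..T}. \<not> accurate ?e h t}) \<le> sqrt T" using N_lt by linarith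
      then have "card {t \<in> {1..T}. \<not> accurate ?e h t} * max_gap \<le> sqrt T * max_gap"
        using gap_le_max_gap(2)[of 1] T by (intro mult_right_mono) auto
      then show "regret f arm T ?a \<le> regret_bound"
        using regret_le[OF h p \<beta> T] unfolding regret_bound_def by linarith
    qed
  qed
  finally show ?thesis .
qed

end

section \<open>Asymptotics in the horizon\<close>

lemma failure_probability_tendsto_0:
  fixes A \<delta> B :: real
  assumes "A > 0" "\<delta> > 0"
  shows "((\<lambda>T :: nat. sqrt T * (ln T + 1) * A * (2 * exp (- (sqrt (2 * ln (2 * real T * A / \<delta>)) - B)\<^sup>2 / 2))) \<longlongrightarrow> 0) sequentially"
proof (rule tendsto_sandwich[where f="\<lambda>_. 0" and
      h="\<lambda>T :: nat. sqrt T * (ln T + 1) * A * (2 * (exp (3 / 2 * B\<^sup>2) * (2 * real T * A / \<delta>) powr (- 3 / 4)))"])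
  \<comment> \<open>Completing the square gives up a quarter of the exponent to isolate
    \<open>B\<close>. With \<open>b\<^sup>2 = \<beta>\<close> what remains is a power
    \<open>- 3 / 4\<close> of \<open>T\<close>, still enough against
    \<open>sqrt T * ln T\<close>.\<close>
  have bound: "exp (- (b - B)\<^sup>2 / 2) \<le> exp (3 / 2 * B\<^sup>2) * exp (- 3 / 8 * b\<^sup>2)" for b :: real
  proof -
    have "0 \<le> (b / 2 - 2 * B)\<^sup>2" by simp
    then have "- (b - B)\<^sup>2 / 2 \<le> 3 / 2 * B\<^sup>2 + - 3 / 8 * b\<^sup>2" by (simp add: power2_eq_square field_simps)
    then show ?thesis by (simp flip: exp_add)
  qed
  show "\<forall>\<^sub>F T :: nat in sequentially. sqrt T * (ln T + 1) * A * (2 * exp (- (sqrt (2 * ln (2 * real T * A / \<delta>)) - B)\<^sup>2 / 2)) \<le>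
      sqrt T * (ln T + 1) * A * (2 * (exp (3 / 2 * B\<^sup>2) * (2 * real T * A / \<delta>) powr (- 3 / 4)))"
  proof -
    have "\<forall>\<^sub>F T :: nat in sequentially. 0 \<le> ln T" by real_asymp
    moreover have "\<forall>\<^sub>F T :: nat in sequentially. 1 \<le> 2 * real T * A / \<delta>" using assms by real_asymp
    ultimately show ?thesis
    proof eventually_elim
      case (elim T)
      have "T \<noteq> 0" using elim(2) by (intro notI) simp
      have "exp (- 3 / 8 * (sqrt (2 * ln (2 * real T * A / \<delta>)))\<^sup>2) = (2 * real T * A / \<delta>) powr (- 3 / 4)"
        using elim \<open>T \<noteq> 0\<close> assms by (subst real_sqrt_pow2) (auto simp: powr_def)
      then show ?case
        using bound[of "sqrt (2 * ln (2 * real T * A / \<delta>))"] elim assms by (intro mult_left_mono) auto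
    qed
  qed
  show "((\<lambda>T :: nat. sqrt T * (ln T + 1) * A * (2 * (exp (3 / 2 * B\<^sup>2) * (2 * real T * A / \<delta>) powr (- 3 / 4)))) \<longlongrightarrow> 0) sequentially"
    using assms by real_asymp
  show "\<forall>\<^sub>F T :: nat in sequentially. 0 \<le> sqrt T * (ln T + 1) * A * (2 * exp (- (sqrt (2 * ln (2 * real T * A / \<delta>)) - B)\<^sup>2 / 2))"
  proof -
    have "\<forall>\<^sub>F T :: nat in sequentially. 0 \<le> ln T" by real_asymp
    then show ?thesis by eventually_elim (use assms in simp)
  qed
qed simp

lemma eventually_parameters:
  fixes A \<delta> B :: real
  assumes "A > 0" "\<delta> > 0"
  shows "\<forall>\<^sub>F T :: nat in sequentially. 2 \<le> ln T \<and> 1 \<le> 2 * ln (2 * real T * A / \<delta>) \<and> B \<le> sqrt (2 * ln (2 * real T * A / \<delta>))"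
proof (intro eventually_conj)
  show "\<forall>\<^sub>F T :: nat in sequentially. 2 \<le> ln T" by real_asymp
  show "\<forall>\<^sub>F T :: nat in sequentially. 1 \<le> 2 * ln (2 * real T * A / \<delta>)" using assms by real_asymp
  have "filterlim (\<lambda>T :: nat. sqrt (2 * ln (2 * real T * A / \<delta>))) at_top sequentially" using assms by real_asymp
  then show "\<forall>\<^sub>F T :: nat in sequentially. B \<le> sqrt (2 * ln (2 * real T * A / \<delta>))"
    by (simp add: filterlim_at_top)
qed

text \<open>\<open>S\<^sup>2 * \<beta>\<close> is at most a multiple of
  \<open>(ln T)\<^sup>2 * ?\<Lambda>\<close>; one spare factor \<open>ln T\<close> leads to the
  third power. The remaining multiples of \<open>sqrt T\<close> are absorbed by
  \<open>\<sigma> * B\<close>, which is why the constant divides by it and \<open>B\<close> must be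
  positive.\<close>

lemma (in bandit) regret_bound_le:
  fixes A \<delta> :: real
  assumes "0 < B" and S: "S = num_levels T" and L: "2 \<le> ln T"
    and \<beta>: "\<beta> = 2 * ln (2 * real T * A / \<delta>)" "1 \<le> \<beta>" and A: "0 < A" and \<delta>: "0 < \<delta>"
  shows "regret_bound \<le> (6 * \<sigma> * (8 * \<sigma> + 2 * max_gap) + (max_gap + 2 * \<sigma>) / (\<sigma> * B)) *
    (sqrt T * (sqrt (info_gain k \<sigma> X T * (1 / \<sigma>\<^sup>2) * (ln T) ^ 3 * ln (T * ln T * A / \<delta>)) + \<sigma> * B))"
proof -
  let ?\<gamma> = "info_gain k \<sigma> X T" and ?\<Lambda> = "ln (T * ln T * A / \<delta>)"
  let ?Q = "sqrt (?\<gamma> * (1 / \<sigma>\<^sup>2) * (ln T) ^ 3 * ?\<Lambda>)"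
  have T: "1 \<le> T" using L by (cases T) auto
  have X: "X \<noteq> {}" using arm_mem[of 1] T by auto
  have \<gamma>: "0 \<le> ?\<gamma>" by (rule info_gain_nonneg[OF sigma_pos kappa X])
  have mg: "0 \<le> max_gap" using gap_le_max_gap(2)[of 1] T by auto
  have "real S \<le> ln T + 1" using L unfolding S num_levels_def by linarith
  then have S_le: "real S \<le> 2 * ln T" using L by simp
  \<comment> \<open>The argument of the logarithm in \<open>\<beta>\<close> has 2 in the place of
    \<open>ln T\<close>, which is why \<open>2 \<le> ln T\<close> is required.\<close>
  have "2 * real T * A / \<delta> \<le> T * ln T * A / \<delta>"
    using L A \<delta> T by (intro divide_right_mono mult_right_mono) auto
  moreover have "0 < 2 * real T * A / \<delta>" using A \<delta> T by simp
  ultimately have \<beta>_le: "\<beta> \<le> 2 * ?\<Lambda>" unfolding \<beta>(1) by simp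
  then have \<Lambda>: "0 \<le> ?\<Lambda>" using \<beta>(2) by simp
  have "(S * sqrt (\<beta> * ?\<gamma>))\<^sup>2 = (real S)\<^sup>2 * (\<beta> * ?\<gamma>)"
    using \<beta>(2) \<gamma> by (simp add: power_mult_distrib)
  also have "\<dots> \<le> (2 * ln T)\<^sup>2 * ((2 * ?\<Lambda>) * ?\<gamma>)"
    using S_le \<beta>_le \<beta>(2) \<gamma> by (intro mult_mono power_mono) auto
  also have "\<dots> = 8 * ((ln T)\<^sup>2 * 1 * (?\<Lambda> * ?\<gamma>))" by (simp add: power_mult_distrib)
  \<comment> \<open>Rounding 8 up to 9 makes the constant a square.\<close>
  also have "\<dots> \<le> 9 * ((ln T)\<^sup>2 * ln T * (?\<Lambda> * ?\<gamma>))"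
    using L \<Lambda> \<gamma> by (intro mult_mono) auto
  also have "\<dots> = 9 * \<sigma>\<^sup>2 * (?\<gamma> * (1 / \<sigma>\<^sup>2) * (ln T) ^ 3 * ?\<Lambda>)"
    using sigma_pos by (simp add: power2_eq_square power3_eq_cube)
  also have "\<dots> = 9 * \<sigma>\<^sup>2 * ?Q\<^sup>2"
    using L \<Lambda> \<gamma> by (subst real_sqrt_pow2) auto
  also have "\<dots> = (3 * \<sigma> * ?Q)\<^sup>2" unfolding power_mult_distrib by simp
  finally have "S * sqrt (\<beta> * ?\<gamma>) \<le> 3 * \<sigma> * ?Q"
    by (rule power2_le_imp_le) (use sigma_pos \<Lambda> \<gamma> L in auto)
  then have "(8 * \<sigma> + 2 * max_gap) * 2 * sqrt T * (S * sqrt (\<beta> * ?\<gamma>)) \<le> (8 * \<sigma> + 2 * max_gap) * 2 * sqrt T * (3 * \<sigma> * ?Q)"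
    using mg sigma_pos by (intro mult_left_mono) auto
  then have 1: "(8 * \<sigma> + 2 * max_gap) * S * (2 * sqrt T * sqrt (\<beta> * ?\<gamma>)) \<le> 6 * \<sigma> * (8 * \<sigma> + 2 * max_gap) * (sqrt T * ?Q)"
    by (simp add: algebra_simps)
  have 2: "sqrt T * max_gap + 2 * \<sigma> * sqrt T = (max_gap + 2 * \<sigma>) / (\<sigma> * B) * (sqrt T * (\<sigma> * B))"
    using \<open>0 < B\<close> sigma_pos by (simp add: field_simps)
  have 3: "0 \<le> 6 * \<sigma> * (8 * \<sigma> + 2 * max_gap) * (sqrt T * (\<sigma> * B))"
    using \<open>0 < B\<close> sigma_pos mg by auto
  have 4: "0 \<le> (max_gap + 2 * \<sigma>) / (\<sigma> * B) * (sqrt T * ?Q)"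
    using \<open>0 < B\<close> sigma_pos mg \<gamma> \<Lambda> L by auto
  show ?thesis unfolding regret_bound_def using 1 2 3 4 unfolding distrib_left distrib_right by linarith
qed

text \<open>\<open>C\<close> and the threshold for the horizon are chosen before the contexts,
  \<open>f\<close>, the noise and the probability space, so the growth bound is uniform in all of
  them. The inequality is strict because the failure probability tends to 0 and thus eventually lies
  below \<open>\<delta>\<close>.\<close>

theorem theorem3p3:
  fixes L :: nat and X :: "(real ^ 'd::finite) set" and k :: "real ^ 'd \<Rightarrow> real ^ 'd \<Rightarrow> real"
    and H :: "(real ^ 'd \<Rightarrow> real) set" and ip :: "(real ^ 'd \<Rightarrow> real) \<Rightarrow> (real ^ 'd \<Rightarrow> real) \<Rightarrow> real"
    and \<delta> \<sigma> B :: real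
  assumes "L \<ge> 1" and "X \<subseteq> sphere 0 1" and "is_ntk L X k" and "rkhs X k H ip"
    and "0 < \<delta>" and "\<delta> < 1" and "\<sigma> > 0"
  shows "\<exists>C. \<forall>\<^sub>F T in sequentially.
    \<forall>(z :: nat \<Rightarrow> real ^ 'a::finite ^ 'd) (f :: real ^ 'd \<Rightarrow> real) (M :: 'w measure)
      (\<epsilon> :: nat \<Rightarrow> 'w \<Rightarrow> real) (pick :: nat \<Rightarrow> 'w \<Rightarrow> 'a set \<Rightarrow> 'a) (a :: nat \<Rightarrow> 'w \<Rightarrow> 'a).
      (\<forall>t\<in>{1..T}. \<forall>j. column j (z t) \<in> X) \<longrightarrow>
      f \<in> H \<longrightarrow> sqrt (ip f f) \<le> B \<longrightarrow>
      prob_space M \<longrightarrow>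
      iid_sub_gaussian_noise M {1..T} \<epsilon> (\<sigma>\<^sup>2) \<longrightarrow>
      random_picks M T \<epsilon> pick \<longrightarrow>
      (\<forall>t\<in>{1..T}. a t \<in> measurable M (count_space UNIV)) \<longrightarrow>
      (\<forall>\<omega>\<in>space M. sup_ucb_run k \<sigma> (\<lambda>t. 2 * ln (2 * real T * real CARD('a) / \<delta>)) T
         (context_arm z) (\<lambda>t. pick t \<omega>)
         (\<lambda>t. f (context_arm z t (a t \<omega>)) + \<epsilon> t \<omega>) (\<lambda>t. a t \<omega>)) \<longrightarrow>
      measure M {\<omega> \<in> space M. regret f (context_arm z) T (\<lambda>t. a t \<omega>) \<le>
          C * (sqrt (real T) *
            (sqrt (info_gain k \<sigma> X T * (1 / \<sigma>\<^sup>2) * (ln (real T)) ^ 3 *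
               ln (real T * ln (real T) * real CARD('a) / \<delta>)) + \<sigma> * B))} > 1 - \<delta>"
proof -
  interpret rkhs X k H ip by fact
  note \<delta> = \<open>0 < \<delta>\<close> and \<sigma> = \<open>\<sigma> > 0\<close>
  obtain \<kappa> where \<kappa>: "\<And>x. x \<in> X \<Longrightarrow> k x x \<le> \<kappa>"
    using is_ntk_bounded[OF assms(2,3)] by blast
  define A where "A = real CARD('a)"
  have A: "0 < A" by (simp add: A_def)
  define R0 where "R0 = 2 * B * sqrt \<kappa>"
  define C where "C = (if 0 < B then 6 * \<sigma> * (8 * \<sigma> + 2 * R0) + (R0 + 2 * \<sigma>) / (\<sigma> * B) else 0)"
  have "\<forall>\<^sub>F T :: nat in sequentially. sqrt T * (ln T + 1) * A * (2 * exp (- (sqrt (2 * ln (2 * real T * A / \<delta>)) - B)\<^sup>2 / 2)) < \<delta>"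
    using order_tendstoD(2)[OF failure_probability_tendsto_0[OF A \<delta>] \<delta>] .
  then show ?thesis
    using eventually_parameters[OF A \<delta>, of B]
  proof (intro exI[of _ C], eventually_elim, intro allI impI)
    fix T :: nat and z :: "nat \<Rightarrow> real ^ 'a ^ 'd" and f :: "real ^ 'd \<Rightarrow> real" and M :: "'w measure"
      and \<epsilon> :: "nat \<Rightarrow> 'w \<Rightarrow> real" and pick :: "nat \<Rightarrow> 'w \<Rightarrow> 'a set \<Rightarrow> 'a" and a :: "nat \<Rightarrow> 'w \<Rightarrow> 'a"
    let ?\<beta> = "2 * ln (2 * real T * real CARD('a) / \<delta>)"
    let ?R = "sqrt (real T) * (sqrt (info_gain k \<sigma> X T * (1 / \<sigma>\<^sup>2) * (ln (real T)) ^ 3 *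
               ln (real T * ln (real T) * real CARD('a) / \<delta>)) + \<sigma> * B)"
    assume small: "sqrt T * (ln T + 1) * A * (2 * exp (- (sqrt (2 * ln (2 * real T * A / \<delta>)) - B)\<^sup>2 / 2)) < \<delta>"
      and par: "2 \<le> ln (real T) \<and> 1 \<le> 2 * ln (2 * real T * A / \<delta>) \<and> B \<le> sqrt (2 * ln (2 * real T * A / \<delta>))"
      and z: "\<forall>t\<in>{1..T}. \<forall>j. column j (z t) \<in> X"
      and f: "f \<in> H" "sqrt (ip f f) \<le> B" and M: "prob_space M"
      and noise: "iid_sub_gaussian_noise M {1..T} \<epsilon> (\<sigma>\<^sup>2)" and picks: "random_picks M T \<epsilon> pick"
      and a: "\<forall>t\<in>{1..T}. a t \<in> measurable M (count_space UNIV)"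
      and run: "\<forall>\<omega>\<in>space M. sup_ucb_run k \<sigma> (\<lambda>t. ?\<beta>) T (context_arm z) (\<lambda>t. pick t \<omega>)
         (\<lambda>t. f (context_arm z t (a t \<omega>)) + \<epsilon> t \<omega>) (\<lambda>t. a t \<omega>)"
    interpret prob_space M by fact
    show "1 - \<delta> < measure M {\<omega> \<in> space M. regret f (context_arm z) T (\<lambda>t. a t \<omega>) \<le> C * ?R}"
    proof (cases "0 < B")
      \<comment> \<open>Here \<open>\<sigma> * B\<close> cannot absorb anything, but the norm bound
        forces \<open>f = 0\<close>, so the regret is 0.\<close>
      case False
      then have "ip f f = 0" using f ip_nonneg[OF f(1)] by (metis antisym order_trans not_less real_sqrt_le_0_iff)
      then have "f = (\<lambda>_. 0)" using ip_pos[OF f(1)] by auto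
      then have "regret f (context_arm z) T (\<lambda>t. a t \<omega>) \<le> C * ?R" for \<omega>
        using False by (simp add: regret_def C_def)
      then have "{\<omega> \<in> space M. regret f (context_arm z) T (\<lambda>t. a t \<omega>) \<le> C * ?R} = space M" by auto
      then show ?thesis using \<delta> by (simp only: prob_space)
    next
      case True
      interpret bandit X k H ip \<sigma> ?\<beta> B \<kappa> T "num_levels T" "context_arm z" f
      proof
        show "context_arm z t b \<in> X" if "t \<in> {1..T}" for t b
          using z that by (simp add: context_arm_def matrix_vector_mult_basis)
      qed (use par f \<kappa> \<sigma> in \<open>auto simp: A_def\<close>)
      have T: "1 \<le> T" using par by (cases T) auto
      have "regret_bound \<le> C * ?R"
        using regret_bound_le[OF True refl, of "real CARD('a)" \<delta>] par \<delta> True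
        by (simp add: C_def R0_def max_gap_def A_def)
      then have "1 - sqrt T * num_levels T * CARD('a) * (2 * exp (- (sqrt ?\<beta> - B)\<^sup>2 / 2)) \<le>
          prob {\<omega> \<in> space M. regret f (context_arm z) T (\<lambda>t. a t \<omega>) \<le> C * ?R}"
      proof (intro order_trans[OF prob_regret_le[OF M noise picks] finite_measure_mono])
        show "{\<omega> \<in> space M. regret f (context_arm z) T (\<lambda>t. a t \<omega>) \<le> C * ?R} \<in> events"
          using a by (intro borel_measurable_le regret_measurable) auto
      qed (use a run par T in \<open>auto simp: A_def\<close>)
      moreover have "sqrt T * num_levels T * A * (2 * exp (- (sqrt (2 * ln (2 * real T * A / \<delta>)) - B)\<^sup>2 / 2)) \<le>
          sqrt T * (ln T + 1) * A * (2 * exp (- (sqrt (2 * ln (2 * real T * A / \<delta>)) - B)\<^sup>2 / 2))"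
      proof (intro mult_right_mono mult_left_mono)
        show "real (num_levels T) \<le> ln T + 1" using par unfolding num_levels_def by linarith
      qed (use A in auto)
      ultimately show ?thesis using small unfolding A_def by linarith
    qed
  qed
qed

end
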